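(* For every $r\ge1$ and any partitions $\lambda^1,\dots,\lambda^r$, one has $$\kappa^J(\lambda^1,\dots,\lambda^r)=O(\alpha^{r-1}).$$
   Context: Notation. $[r]=\{1,\dots,r\}$; $\lambda\oplus\mu=(\lambda_1+\mu_1,\lambda_2+\mu_2,\dots)$ is the entry-wise sum of partitions and $\lambda^I:=\bigoplus_{i\in I}\lambda^i$ for $I\subseteq[r]$. Cumulants of Jack polynomials. $\kappa^J(\lambda^1,\dots,\lambda^r)=\sum_{\pi\in\mathcal{P}([r])}\mu(\pi,\{[r]\})\prod_{B\in\pi}J^{(\alpha)}_{\lambda^B}$, where $\mathcal{P}([r])$ is the set of set partitions of $[r]$ and $\mu$ is the Möbius function of the lattice of set partitions ordered by refinement: $\mu(\pi,\{[r]\})=(-1)^{\#(\pi)-1}(\#(\pi)-1)!$ with $\#(\pi)$ the number of blocks. $O$-notation. For a field $R$, a rational function $f\in R(\alpha)$ and an integer $k$, $f=O(\alpha^k)$ means that $f\cdot\alpha^{-k}$ has no pole at $\alpha=0$. Here symmetric functions are considered as rational functions of $\alpha$ with coefficients in the field of fractions of the ring of symmetric functions over $\mathbb{Q}$. Partitions. $|\lambda|$ and $\ell(\lambda)$ denote size and length; $\lambda^t$ is the conjugate partition; $b(\lambda)=\sum_i\binom{\lambda_i}{2}$. The Young diagram of $\lambda$ is $\{(i,j):1\le i\le\lambda_j,\ 1\le j\le\ell(\lambda)\}$. For a box $\square=(i,j)\in\lambda$, put $a(\square)=\lambda_j-i$ and $\ell(\square)=\lambda^t_i-j$; $\mathrm{hook}_\alpha(\lambda)=\prod_{\square\in\lambda}(\alpha\,a(\square)+\ell(\square)+1)$.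 Jack symmetric functions. On symmetric polynomials in $x_1,\dots,x_N$ over $\mathbb{Q}(\alpha)$, let $D_1=\sum_{i\le N}\sum_{j\ne i}\frac{x_i^2}{x_i-x_j}\frac{\partial}{\partial x_i}$, $D_2=\frac12\sum_{i\le N}x_i^2\frac{\partial^2}{\partial x_i^2}$ and $D_\alpha=D_1+\alpha D_2$. There is a unique family $J^{(\alpha)}_\lambda$, indexed by partitions with $\ell(\lambda)\le N$, such that (C1) $D_\alpha J^{(\alpha)}_\lambda=\big(\alpha b(\lambda)-b(\lambda^t)+(N-1)|\lambda|\big)J^{(\alpha)}_\lambda$, and (C2) $J^{(\alpha)}_\lambda=\mathrm{hook}_\alpha(\lambda)m_\lambda+\sum_{\nu<\lambda}a^\lambda_\nu m_\nu$ with $a^\lambda_\nu\in\mathbb{Q}(\alpha)$, where $m_\nu$ are monomial symmetric functions and $<$ is strict dominance order. These satisfy $J^{(\alpha)}_\lambda(x_1,\dots,x_N,0)=J^{(\alpha)}_\lambda(x_1,\dots,x_N)$, so they define symmetric functions $J^{(\alpha)}_\lambda$ in infinitely many variables. *)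

theory Defs
  imports
    "HOL-Computational_Algebra.Computational_Algebra"
    "HOL-Combinatorics.Permutations"
    "HOL-Library.Poly_Mapping"
    "HOL-Library.Disjoint_Sets"
begin

abbreviation lookup :: "('a \<Rightarrow>\<^sub>0 'b::zero) \<Rightarrow> 'a \<Rightarrow> 'b" where
  "lookup \<equiv> Poly_Mapping.lookup"

abbreviation keys :: "('a \<Rightarrow>\<^sub>0 'b::zero) \<Rightarrow> 'a set" where
  "keys \<equiv> Poly_Mapping.keys"


section \<open>Partitions\<close>

text \<open>
  Partitions and exponent vectors are finitely supported functions on \<^typ>\<open>nat\<close>, indexed
  from 0: the part written \<open>\<lambda>\<^sub>j\<close> for \<open>j \<ge> 1\<close> is \<open>lookup \<lambda> (j - 1)\<close>, and the variable \<open>x\<^sub>i\<close> for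
  \<open>i \<ge> 1\<close> has index \<open>i - 1\<close>. The entry-wise sum of partitions is addition of \<^type>\<open>poly_mapping\<close>.
  The type class order on \<^type>\<open>poly_mapping\<close> is lexicographic and is not used here.
\<close>

definition is_partition :: "(nat \<Rightarrow>\<^sub>0 nat) \<Rightarrow> bool" where
  "is_partition p \<longleftrightarrow> (\<forall>i j. i \<le> j \<longrightarrow> lookup p j \<le> lookup p i)"

definition weight :: "(nat \<Rightarrow>\<^sub>0 nat) \<Rightarrow> nat" where
  "weight m = (\<Sum>i\<in>keys m. lookup m i)"

definition part_length :: "(nat \<Rightarrow>\<^sub>0 nat) \<Rightarrow> nat" where
  "part_length p = card (keys p)"

lift_definition conjugate :: "(nat \<Rightarrow>\<^sub>0 nat) \<Rightarrow> nat \<Rightarrow>\<^sub>0 nat" is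
  "\<lambda>p i. card {j. i < p j}"
proof -
  fix p :: "nat \<Rightarrow> nat"
  assume fin: "finite {x. p x \<noteq> 0}"
  have "{i. card {j. i < p j} \<noteq> 0} \<subseteq> (\<Union>j\<in>{x. p x \<noteq> 0}. {..<p j})"
  proof
    fix i assume "i \<in> {i. card {j. i < p j} \<noteq> 0}"
    then have "{j. i < p j} \<noteq> {}"
      by (metis (mono_tags) card.empty mem_Collect_eq)
    then obtain j where "i < p j" by auto
    then show "i \<in> (\<Union>j\<in>{x. p x \<noteq> 0}. {..<p j})" by force
  qed
  then show "finite {i. card {j. i < p j} \<noteq> 0}"
    by (rule finite_subset) (use fin in auto)
qed

definition b_stat :: "(nat \<Rightarrow>\<^sub>0 nat) \<Rightarrow> nat" where
  "b_stat p = (\<Sum>i\<in>keys p. lookup p i choose 2)"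

definition strictly_dominates :: "(nat \<Rightarrow>\<^sub>0 nat) \<Rightarrow> (nat \<Rightarrow>\<^sub>0 nat) \<Rightarrow> bool" where
  "strictly_dominates p q \<longleftrightarrow>
     weight q = weight p \<and> q \<noteq> p \<and> (\<forall>k. (\<Sum>i<k. lookup q i) \<le> (\<Sum>i<k. lookup p i))"

definition diagram :: "(nat \<Rightarrow>\<^sub>0 nat) \<Rightarrow> (nat \<times> nat) set" where
  "diagram p = {(i, j). j < part_length p \<and> i < lookup p j}"

text \<open>With boxes indexed from 0, the truncated subtractions below are exact on the diagram.\<close>

definition arm :: "(nat \<Rightarrow>\<^sub>0 nat) \<Rightarrow> nat \<times> nat \<Rightarrow> nat" where
  "arm p = (\<lambda>(i, j). lookup p j - (i + 1))"

definition leg :: "(nat \<Rightarrow>\<^sub>0 nat) \<Rightarrow> nat \<times> nat \<Rightarrow> nat" where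
  "leg p = (\<lambda>(i, j). lookup (conjugate p) i - (j + 1))"


section \<open>Polynomials in the variables \<open>x\<^sub>0, x\<^sub>1, \<dots>\<close>\<close>

type_synonym 'a mpoly = "(nat \<Rightarrow>\<^sub>0 nat) \<Rightarrow>\<^sub>0 'a"

definition mconst :: "'a::zero \<Rightarrow> 'a mpoly" where
  "mconst c = Poly_Mapping.single 0 c"

definition mvar :: "nat \<Rightarrow> 'a::zero_neq_one mpoly" where
  "mvar i = Poly_Mapping.single (Poly_Mapping.single i 1) 1"

definition partial_deriv :: "nat \<Rightarrow> 'a::comm_ring_1 mpoly \<Rightarrow> 'a mpoly" where
  "partial_deriv i f = (\<Sum>m\<in>keys f.
     Poly_Mapping.single (m - Poly_Mapping.single i 1) (of_nat (lookup m i) * lookup f m))"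

text \<open>Setting all variables but the first \<open>N\<close> to zero.\<close>

lift_definition restrict_vars :: "nat \<Rightarrow> 'a::zero mpoly \<Rightarrow> 'a mpoly" is
  "\<lambda>N f m. if keys m \<subseteq> {..<N} then f m else 0"
  by (rule finite_subset[rotated]) auto

text \<open>
  \<^term>\<open>Poly_Mapping.map_key \<sigma> m\<close> is \<open>m \<circ> \<sigma>\<close>, i.e. the exponent vector with permuted entries.
\<close>

definition is_sym_poly :: "nat \<Rightarrow> 'a::zero mpoly \<Rightarrow> bool" where
  "is_sym_poly N f \<longleftrightarrow>
     (\<forall>m\<in>keys f. keys m \<subseteq> {..<N}) \<and>
     (\<forall>\<sigma>. \<sigma> permutes {..<N} \<longrightarrow> (\<forall>m. lookup f (Poly_Mapping.map_key \<sigma> m) = lookup f m))"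

definition rearrangements :: "nat \<Rightarrow> (nat \<Rightarrow>\<^sub>0 nat) \<Rightarrow> (nat \<Rightarrow>\<^sub>0 nat) set" where
  "rearrangements N p = {m. keys m \<subseteq> {..<N} \<and> (\<exists>\<sigma>. bij \<sigma> \<and> m = Poly_Mapping.map_key \<sigma> p)}"

text \<open>\<open>m\<^sub>p(x\<^sub>0, \<dots>, x\<^sub>N\<^sub>-\<^sub>1)\<close>; it is \<open>0\<close> if \<open>p\<close> has more than \<open>N\<close> parts.\<close>

definition monomial_sym_poly :: "nat \<Rightarrow> (nat \<Rightarrow>\<^sub>0 nat) \<Rightarrow> 'a::comm_ring_1 mpoly" where
  "monomial_sym_poly N p = (\<Sum>m\<in>rearrangements N p. Poly_Mapping.single m 1)"


subsection \<open>Auxiliary facts\<close>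

lemma lookup_restrict_vars:
  "lookup (restrict_vars N f) m = (if keys m \<subseteq> {..<N} then lookup f m else 0)"
  by transfer simp

lemma restrict_vars_add:
  "restrict_vars N (f + g) = restrict_vars N f + restrict_vars N (g :: 'a::comm_ring_1 mpoly)"
  by (rule poly_mapping_eqI) (simp add: lookup_restrict_vars lookup_add)

lemma restrict_vars_uminus:
  "restrict_vars N (- f) = - restrict_vars N (f :: 'a::comm_ring_1 mpoly)"
  by (rule poly_mapping_eqI) (simp add: lookup_restrict_vars)

lemma keys_add_nat: "keys (a + b) = keys a \<union> keys (b :: nat \<Rightarrow>\<^sub>0 nat)"
  by (auto simp: in_keys_iff lookup_add)

lemma restrict_vars_id:
  assumes "\<And>m. m \<in> keys f \<Longrightarrow> keys m \<subseteq> {..<N}"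
  shows "restrict_vars N f = f"
proof (rule poly_mapping_eqI)
  fix m show "lookup (restrict_vars N f) m = lookup f m"
    using assms[of m] by (cases "m \<in> keys f") (auto simp: lookup_restrict_vars in_keys_iff)
qed

lemma restrict_vars_0:
  assumes "\<And>m. m \<in> keys f \<Longrightarrow> \<not> keys m \<subseteq> {..<N}"
  shows "restrict_vars N f = 0"
proof (rule poly_mapping_eqI)
  fix m show "lookup (restrict_vars N f) m = lookup 0 m"
    using assms[of m] by (cases "m \<in> keys f") (auto simp: lookup_restrict_vars in_keys_iff)
qed

lemma keys_restrict_vars: "keys (restrict_vars N f) = {m \<in> keys f. keys m \<subseteq> {..<N}}"
  unfolding set_eq_iff by (metis (mono_tags, lifting) in_keys_iff lookup_restrict_vars mem_Collect_eq)

lemma restrict_vars_mult: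
  "restrict_vars N (f * g) = restrict_vars N f * restrict_vars N (g :: 'a::comm_ring_1 mpoly)"
proof -
  define f1 f2 g1 g2 where
    "f1 = restrict_vars N f" and "f2 = f - f1" and "g1 = restrict_vars N g" and "g2 = g - g1"
  have 1: "f * g = f1 * g1 + (f2 * g + f1 * g2)"
    by (simp add: f2_def g2_def algebra_simps)
  have f2: "\<not> keys m \<subseteq> {..<N}" if "m \<in> keys f2" for m
    using that by (auto simp: f2_def f1_def in_keys_iff lookup_restrict_vars lookup_minus split: if_splits)
  have g2: "\<not> keys m \<subseteq> {..<N}" if "m \<in> keys g2" for m
    using that by (auto simp: g2_def g1_def in_keys_iff lookup_restrict_vars lookup_minus split: if_splits)
  have a: "restrict_vars N (f1 * g1) = f1 * g1"
    by (rule restrict_vars_id, drule subsetD[OF keys_mult])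
      (auto simp: f1_def g1_def keys_restrict_vars keys_add_nat)
  have b: "restrict_vars N (f2 * g) = 0"
    by (rule restrict_vars_0, drule subsetD[OF keys_mult]) (use f2 in \<open>auto simp: keys_add_nat\<close>)
  have c: "restrict_vars N (f1 * g2) = 0"
    by (rule restrict_vars_0, drule subsetD[OF keys_mult]) (use g2 in \<open>auto simp: keys_add_nat\<close>)
  show ?thesis
    using a b c by (simp add: 1 restrict_vars_add f1_def[symmetric] g1_def[symmetric])
qed

lemma lookup_map_key_inj: "inj \<sigma> \<Longrightarrow> lookup (Poly_Mapping.map_key \<sigma> m) i = lookup m (\<sigma> i)"
  by (simp add: map_key.rep_eq)

lemma bij_map_key:
  assumes "bij \<sigma>"
  shows "bij (Poly_Mapping.map_key \<sigma> :: (nat \<Rightarrow>\<^sub>0 nat) \<Rightarrow> (nat \<Rightarrow>\<^sub>0 nat))"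
proof (rule bijI')
  have inj: "inj \<sigma>" "inj (inv \<sigma>)"
    using assms by (auto simp: bij_is_inj bij_imp_bij_inv)
  show "\<exists>x. y = Poly_Mapping.map_key \<sigma> x" for y :: "nat \<Rightarrow>\<^sub>0 nat"
  proof
    show "y = Poly_Mapping.map_key \<sigma> (Poly_Mapping.map_key (inv \<sigma>) y)"
      by (rule poly_mapping_eqI) (simp add: lookup_map_key_inj inj inv_f_f)
  qed
  show "Poly_Mapping.map_key \<sigma> x = Poly_Mapping.map_key \<sigma> y \<longleftrightarrow> x = y" for x y :: "nat \<Rightarrow>\<^sub>0 nat"
  proof
    assume *: "Poly_Mapping.map_key \<sigma> x = Poly_Mapping.map_key \<sigma> y"
    show "x = y"
    proof (rule poly_mapping_eqI)
      fix i
      from * have "lookup (Poly_Mapping.map_key \<sigma> x) (inv \<sigma> i) =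
          lookup (Poly_Mapping.map_key \<sigma> y) (inv \<sigma> i)" by simp
      then show "lookup x i = lookup y i"
        using assms by (simp add: lookup_map_key_inj inj bij_inv_eq_iff surj_f_inv_f bij_is_surj)
    qed
  qed auto
qed

lemma is_sym_poly_mult:
  fixes f g :: "'a::comm_ring_1 mpoly"
  assumes "is_sym_poly N f" "is_sym_poly N g"
  shows "is_sym_poly N (f * g)"
  unfolding is_sym_poly_def
proof (intro conjI allI impI ballI)
  fix m assume "m \<in> keys (f * g)"
  then show "keys m \<subseteq> {..<N}"
    using assms subsetD[OF keys_mult] unfolding is_sym_poly_def
    by (fastforce simp: keys_add_nat)
next
  fix \<sigma> :: "nat \<Rightarrow> nat" and m assume \<sigma>: "\<sigma> permutes {..<N}"
  let ?t = "Poly_Mapping.map_key \<sigma> :: (nat \<Rightarrow>\<^sub>0 nat) \<Rightarrow> (nat \<Rightarrow>\<^sub>0 nat)"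
  have bij: "bij \<sigma>" using \<sigma> by (rule permutes_bij)
  have t: "bij ?t" by (rule bij_map_key[OF bij])
  have add: "?t (a + b) = ?t a + ?t b" for a b
    by (rule map_key_plus[OF bij_is_inj[OF bij]])
  have eq: "?t a = ?t b \<longleftrightarrow> a = b" for a b
    using t by (auto simp: bij_def inj_def)
  have f: "lookup f (?t a) = lookup f a" and g: "lookup g (?t a) = lookup g a" for a
    using assms \<sigma> by (auto simp: is_sym_poly_def)
  have inner: "(\<Sum>q. lookup g q when ?t m = ?t l + q) = (\<Sum>q. lookup g q when m = l + q)" for l
    by (rule Sum_any.reindex_cong[OF t]) (simp add: fun_eq_iff g eq flip: add)
  show "lookup (f * g) (?t m) = lookup (f * g) m"
    unfolding lookup_mult
    by (rule Sum_any.reindex_cong[OF t]) (simp add: fun_eq_iff f inner)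
qed

lemma finite_bounded_exponents: "finite {m :: nat \<Rightarrow>\<^sub>0 nat. keys m \<subseteq> {..<N} \<and> (\<forall>i. lookup m i \<le> B)}"
proof (rule finite_imageD)
  show "finite (lookup ` {m :: nat \<Rightarrow>\<^sub>0 nat. keys m \<subseteq> {..<N} \<and> (\<forall>i. lookup m i \<le> B)})"
    by (rule finite_subset[OF _ finite_set_of_finite_funs[of "{..<N}" "{..B}" 0]])
      (auto simp: in_keys_iff)
  show "inj_on lookup {m :: nat \<Rightarrow>\<^sub>0 nat. keys m \<subseteq> {..<N} \<and> (\<forall>i. lookup m i \<le> B)}"
    by (auto simp: inj_on_def)
qed

lemma lookup_le_weight: "lookup m i \<le> weight m"
  unfolding weight_def
  by (cases "i \<in> keys m") (auto simp: in_keys_iff intro: member_le_sum)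

lemma weight_map_key:
  assumes "bij \<sigma>" shows "weight (Poly_Mapping.map_key \<sigma> p) = weight p"
proof -
  have "bij_betw \<sigma> (\<sigma> -` keys p) (keys p)"
    using assms by (auto simp: bij_betw_def bij_def inj_on_def image_vimage_eq)
  from sum.reindex_bij_betw[OF this, of "lookup p"] show ?thesis
    by (simp add: weight_def keys_map_key lookup_map_key_inj bij_is_inj assms)
qed

lemma weight_superset:
  "finite A \<Longrightarrow> keys m \<subseteq> A \<Longrightarrow> weight m = (\<Sum>i\<in>A. lookup m i)"
  unfolding weight_def by (rule sum.mono_neutral_left) (auto simp: in_keys_iff)

lemma weight_add: "weight (a + b) = weight a + weight b"
proof -
  have "weight x = (\<Sum>i\<in>keys a \<union> keys b. lookup x i)" if "keys x \<subseteq> keys a \<union> keys b" for x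
    using that by (rule weight_superset[rotated]) simp
  then show ?thesis by (simp add: keys_add_nat lookup_add sum.distrib)
qed

lemma keys_partition_subset:
  assumes "is_partition p" shows "keys p \<subseteq> {..<weight p}"
proof
  fix i assume "i \<in> keys p"
  then have 1: "1 \<le> lookup p j" if "j \<le> i" for j
    using assms that by (fastforce simp: is_partition_def in_keys_iff)
  then have "{..i} \<subseteq> keys p" by (force simp: in_keys_iff)
  then have "(\<Sum>j\<le>i. lookup p j) \<le> weight p"
    unfolding weight_def by (intro sum_mono2) auto
  moreover have "(\<Sum>j\<le>i. 1) \<le> (\<Sum>j\<le>i. lookup p j)"
    by (rule sum_mono) (use 1 in auto)
  ultimately show "i \<in> {..<weight p}" by simp
qed

lemma finite_partitions_weight_le: "finite {p. is_partition p \<and> weight p \<le> d}"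
  by (rule finite_subset[OF _ finite_bounded_exponents[of d d]])
    (use keys_partition_subset lookup_le_weight in \<open>fastforce intro: order_trans\<close>)

lemma finite_strictly_dominated: "finite {q. is_partition q \<and> strictly_dominates p q}"
  by (rule finite_subset[OF _ finite_partitions_weight_le[of "weight p"]])
    (auto simp: strictly_dominates_def)

lemma finite_rearrangements: "finite (rearrangements N p)"
proof (rule finite_subset[OF _ finite_bounded_exponents[of N "weight p"]])
  show "rearrangements N p \<subseteq> {m. keys m \<subseteq> {..<N} \<and> (\<forall>i. lookup m i \<le> weight p)}"
    unfolding rearrangements_def
    by clarsimp (metis lookup_le_weight weight_map_key)
qed

lemma lookup_monomial_sym_poly:
  "lookup (monomial_sym_poly N p) m = (if m \<in> rearrangements N p then 1 else 0)"
  by (simp add: monomial_sym_poly_def lookup_sum lookup_single when_def finite_rearrangements)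

lemma map_key_in_rearrangements:
  assumes "\<sigma> permutes {..<N}" "m \<in> rearrangements N p"
  shows "Poly_Mapping.map_key \<sigma> m \<in> rearrangements N p"
proof -
  have inj: "inj \<sigma>" and bij: "bij \<sigma>"
    using assms(1) by (auto simp: permutes_bij permutes_inj)
  obtain \<tau> where \<tau>: "bij \<tau>" "m = Poly_Mapping.map_key \<tau> p" and m: "keys m \<subseteq> {..<N}"
    using assms(2) by (auto simp: rearrangements_def)
  have "Poly_Mapping.map_key \<sigma> m = Poly_Mapping.map_key (\<tau> \<circ> \<sigma>) p"
    using \<tau> inj by (simp add: map_key_compose bij_is_inj)
  moreover have "bij (\<tau> \<circ> \<sigma>)" using \<tau> bij by (simp add: bij_comp)
  moreover have "keys (Poly_Mapping.map_key \<sigma> m) \<subseteq> {..<N}"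
    using m permutes_in_image[OF assms(1)] by (auto simp: keys_map_key inj)
  ultimately show ?thesis by (auto simp: rearrangements_def)
qed

lemma is_sym_poly_monomial_sym_poly: "is_sym_poly N (monomial_sym_poly N p)"
  unfolding is_sym_poly_def
proof (intro conjI ballI allI impI)
  fix m assume "m \<in> keys (monomial_sym_poly N p :: 'a mpoly)"
  then show "keys m \<subseteq> {..<N}"
    by (auto simp: in_keys_iff lookup_monomial_sym_poly rearrangements_def split: if_splits)
next
  fix \<sigma> :: "nat \<Rightarrow> nat" and m assume \<sigma>: "\<sigma> permutes {..<N}"
  have "m \<in> rearrangements N p" if "Poly_Mapping.map_key \<sigma> m \<in> rearrangements N p"
  proof -
    have "Poly_Mapping.map_key (inv \<sigma>) (Poly_Mapping.map_key \<sigma> m) = m"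
      by (rule poly_mapping_eqI)
        (simp add: lookup_map_key_inj permutes_inj[OF \<sigma>]
          permutes_inj[OF permutes_inv[OF \<sigma>]] permutes_inverses[OF \<sigma>])
    then show ?thesis
      using map_key_in_rearrangements[OF permutes_inv[OF \<sigma>] that] by simp
  qed
  then show "lookup (monomial_sym_poly N p) (Poly_Mapping.map_key \<sigma> m) =
      lookup (monomial_sym_poly N p :: 'a mpoly) m"
    using map_key_in_rearrangements[OF \<sigma>] by (auto simp: lookup_monomial_sym_poly)
qed

lemma restrict_monomial_sym_poly:
  "restrict_vars N (monomial_sym_poly (Suc N) p) = monomial_sym_poly N p"
  by (rule poly_mapping_eqI)
    (auto simp: lookup_restrict_vars lookup_monomial_sym_poly rearrangements_def)

lemma weight_keys_monomial_sym_poly: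
  "m \<in> keys (monomial_sym_poly N p) \<Longrightarrow> weight m = weight p"
  by (auto simp: in_keys_iff lookup_monomial_sym_poly rearrangements_def weight_map_key
      split: if_splits)

lemma is_sym_poly_add:
  "is_sym_poly N f \<Longrightarrow> is_sym_poly N g \<Longrightarrow> is_sym_poly N (f + g :: 'a::comm_ring_1 mpoly)"
  unfolding is_sym_poly_def using Poly_Mapping.keys_add[of f g] by (force simp: lookup_add)

lemma is_sym_poly_uminus:
  "is_sym_poly N f \<Longrightarrow> is_sym_poly N (- f :: 'a::comm_ring_1 mpoly)"
  unfolding is_sym_poly_def by (simp add: in_keys_iff)

lemma is_sym_poly_0: "is_sym_poly N (0 :: 'a::comm_ring_1 mpoly)"
  by (simp add: is_sym_poly_def)

lemma is_sym_poly_1: "is_sym_poly N (1 :: 'a::comm_ring_1 mpoly)"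
  unfolding is_sym_poly_def
proof (intro conjI ballI allI impI)
  fix m :: "nat \<Rightarrow>\<^sub>0 nat" assume "m \<in> keys (1 :: 'a mpoly)"
  then show "keys m \<subseteq> {..<N}" by (simp add: in_keys_iff lookup_one when_def split: if_splits)
next
  fix \<sigma> :: "nat \<Rightarrow> nat" and m :: "nat \<Rightarrow>\<^sub>0 nat" assume \<sigma>: "\<sigma> permutes {..<N}"
  have "Poly_Mapping.map_key \<sigma> m = 0 \<longleftrightarrow> m = 0"
    using bij_map_key[OF permutes_bij[OF \<sigma>]] map_key_zero[OF permutes_inj[OF \<sigma>]]
    by (metis bij_pointE)
  then show "lookup 1 (Poly_Mapping.map_key \<sigma> m) = (lookup 1 m :: 'a)"
    by (simp add: lookup_one when_def)
qed


section \<open>Symmetric functions\<close>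

text \<open>
  The ring of symmetric functions as a projective limit: a symmetric function of bounded degree
  is a sequence of symmetric polynomials \<open>F(x\<^sub>0, \<dots>, x\<^sub>N\<^sub>-\<^sub>1)\<close>, \<open>N \<ge> 0\<close>, compatible with
  \<open>F(x\<^sub>0, \<dots>, x\<^sub>N\<^sub>-\<^sub>1, 0) = F(x\<^sub>0, \<dots>, x\<^sub>N\<^sub>-\<^sub>1)\<close>.
\<close>

typedef (overloaded) 'a symfun =
  "{F :: nat \<Rightarrow> 'a::comm_ring_1 mpoly.
     (\<forall>N. is_sym_poly N (F N)) \<and>
     (\<forall>N. restrict_vars N (F (Suc N)) = F N) \<and>
     (\<exists>d. \<forall>N. \<forall>m\<in>keys (F N). weight m \<le> d)}"
  morphisms in_vars Abs_symfun
  by (rule exI[of _ "\<lambda>_. 0"]) (auto simp: is_sym_poly_0 intro: restrict_vars_0)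

setup_lifting type_definition_symfun

instantiation symfun :: (comm_ring_1) comm_ring_1
begin

lift_definition zero_symfun :: "'a symfun" is "\<lambda>_. 0"
  by (auto simp: is_sym_poly_0 intro: restrict_vars_0)

lift_definition one_symfun :: "'a symfun" is "\<lambda>_. 1"
  by (auto simp: is_sym_poly_1 weight_def intro!: restrict_vars_id exI[of _ 0])

lift_definition plus_symfun :: "'a symfun \<Rightarrow> 'a symfun \<Rightarrow> 'a symfun" is "\<lambda>F G N. F N + G N"
proof (intro conjI allI)
  fix F G :: "nat \<Rightarrow> 'a mpoly"
  assume *: "(\<forall>N. is_sym_poly N (F N)) \<and> (\<forall>N. restrict_vars N (F (Suc N)) = F N) \<and>
      (\<exists>d. \<forall>N. \<forall>m\<in>keys (F N). weight m \<le> d)"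
    "(\<forall>N. is_sym_poly N (G N)) \<and> (\<forall>N. restrict_vars N (G (Suc N)) = G N) \<and>
      (\<exists>d. \<forall>N. \<forall>m\<in>keys (G N). weight m \<le> d)"
  from * show "is_sym_poly N (F N + G N)" for N by (simp add: is_sym_poly_add)
  from * show "restrict_vars N (F (Suc N) + G (Suc N)) = F N + G N" for N
    by (simp add: restrict_vars_add)
  from * obtain d e where d: "\<And>N m. m \<in> keys (F N) \<Longrightarrow> weight m \<le> d"
    and e: "\<And>N m. m \<in> keys (G N) \<Longrightarrow> weight m \<le> e" by metis
  show "\<exists>d. \<forall>N. \<forall>m\<in>keys (F N + G N). weight m \<le> d"
    using d e Poly_Mapping.keys_add
    by (intro exI[of _ "max d e"]) (fastforce simp: le_max_iff_disj)
qed

lift_definition uminus_symfun :: "'a symfun \<Rightarrow> 'a symfun" is "\<lambda>F N. - F N"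
  by (auto simp: is_sym_poly_uminus restrict_vars_uminus)

definition minus_symfun :: "'a symfun \<Rightarrow> 'a symfun \<Rightarrow> 'a symfun" where
  "minus_symfun F G = F + - G"

lift_definition times_symfun :: "'a symfun \<Rightarrow> 'a symfun \<Rightarrow> 'a symfun" is "\<lambda>F G N. F N * G N"
proof (intro conjI allI)
  fix F G :: "nat \<Rightarrow> 'a mpoly"
  assume *: "(\<forall>N. is_sym_poly N (F N)) \<and> (\<forall>N. restrict_vars N (F (Suc N)) = F N) \<and>
      (\<exists>d. \<forall>N. \<forall>m\<in>keys (F N). weight m \<le> d)"
    "(\<forall>N. is_sym_poly N (G N)) \<and> (\<forall>N. restrict_vars N (G (Suc N)) = G N) \<and>
      (\<exists>d. \<forall>N. \<forall>m\<in>keys (G N). weight m \<le> d)"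
  from * show "is_sym_poly N (F N * G N)" for N by (simp add: is_sym_poly_mult)
  from * show "restrict_vars N (F (Suc N) * G (Suc N)) = F N * G N" for N
    by (simp add: restrict_vars_mult)
  from * obtain d e where d: "\<And>N m. m \<in> keys (F N) \<Longrightarrow> weight m \<le> d"
    and e: "\<And>N m. m \<in> keys (G N) \<Longrightarrow> weight m \<le> e" by metis
  have "weight m \<le> d + e" if m: "m \<in> keys (F N * G N)" for N m
  proof -
    from subsetD[OF keys_mult m] obtain a b where "m = a + b" "a \<in> keys (F N)" "b \<in> keys (G N)"
      by auto
    with d[of a N] e[of b N] show ?thesis by (simp add: weight_add)
  qed
  then show "\<exists>d. \<forall>N. \<forall>m\<in>keys (F N * G N). weight m \<le> d" by blast
qed

instance
proof
  show "(0::'a symfun) \<noteq> 1" by transfer (simp add: fun_eq_iff)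
qed ((unfold minus_symfun_def)?, transfer, simp add: fun_eq_iff algebra_simps)+

end

lemma in_vars_add: "in_vars (F + G) N = in_vars F N + in_vars G N"
  by transfer simp

lemma in_vars_mult: "in_vars (F * G) N = in_vars F N * in_vars G N"
  by transfer simp

lemma in_vars_of_nat: "in_vars (of_nat n) N = of_nat n"
  by (induction n) (simp_all add: in_vars_add zero_symfun.rep_eq one_symfun.rep_eq)

lemma in_vars_le:
  assumes "N \<le> M" "in_vars F M = 0" shows "in_vars F N = 0"
  using assms
proof (induction M rule: dec_induct)
  case (step M)
  have "in_vars F M = restrict_vars M (in_vars F (Suc M))"
    using in_vars[of F] by auto
  also have "\<dots> = 0" using step.prems by (auto intro: restrict_vars_0)
  finally show ?case by (rule step.IH)
qed

instance symfun :: (idom) idom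
proof
  fix F G :: "'a symfun" assume "F \<noteq> 0" "G \<noteq> 0"
  then obtain N M where "in_vars F N \<noteq> 0" "in_vars G M \<noteq> 0"
    by (metis in_vars_inject zero_symfun.rep_eq ext)
  then have "in_vars F (max N M) \<noteq> 0" "in_vars G (max N M) \<noteq> 0"
    using in_vars_le max.cobounded1 max.cobounded2 by metis+
  then have "in_vars (F * G) (max N M) \<noteq> 0" by (simp add: in_vars_mult)
  then show "F * G \<noteq> 0" by (auto simp: zero_symfun.rep_eq)
qed

instance symfun :: ("{comm_ring_1, ring_char_0}") ring_char_0
proof
  show "inj (of_nat :: nat \<Rightarrow> 'a symfun)"
  proof (rule injI)
    fix m n assume "(of_nat m :: 'a symfun) = of_nat n"
    then have "in_vars (of_nat m :: 'a symfun) 0 = in_vars (of_nat n) 0" by simp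
    then show "m = n" by (simp add: in_vars_of_nat)
  qed
qed

lift_definition monomial_symfun :: "(nat \<Rightarrow>\<^sub>0 nat) \<Rightarrow> 'a::comm_ring_1 symfun" is
  "\<lambda>p N. monomial_sym_poly N p"
  by (auto simp: is_sym_poly_monomial_sym_poly restrict_monomial_sym_poly
      weight_keys_monomial_sym_poly intro!: exI[of _ "weight p" for p])

definition monomial_coeff :: "'a::comm_ring_1 symfun \<Rightarrow> (nat \<Rightarrow>\<^sub>0 nat) \<Rightarrow> 'a" where
  "monomial_coeff F p = lookup (in_vars F (part_length p)) p"

lemma finite_monomial_coeff: "finite {p. is_partition p \<and> monomial_coeff F p \<noteq> 0}"
proof -
  from in_vars[of F] obtain d where "\<forall>N. \<forall>m\<in>keys (in_vars F N). weight m \<le> d"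
    by auto
  then have d: "\<And>N m. m \<in> keys (in_vars F N) \<Longrightarrow> weight m \<le> d" by simp
  show ?thesis
    by (rule finite_subset[OF _ finite_partitions_weight_le[of d]])
      (auto simp: monomial_coeff_def in_keys_iff intro: d)
qed


section \<open>Rational functions of \<open>\<alpha>\<close>\<close>

instance fract :: ("{idom, ring_char_0}") field_char_0
proof
  show "inj (of_nat :: nat \<Rightarrow> 'a fract)"
    by (rule injI) (simp add: Fraction_Field.of_nat_fract eq_fract)
qed

type_synonym 'r ratfun = "'r poly fract"

definition alpha :: "'r::field ratfun" where
  "alpha = to_fract [:0, 1:]"

definition no_pole_at_0 :: "'r::field ratfun \<Rightarrow> bool" where
  "no_pole_at_0 f \<longleftrightarrow> (\<exists>p q. poly q 0 \<noteq> 0 \<and> f = Fraction_Field.Fract p q)"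

definition is_O_alpha :: "'r::field ratfun \<Rightarrow> int \<Rightarrow> bool" where
  "is_O_alpha f k \<longleftrightarrow> no_pole_at_0 (f * alpha powi (- k))"

text \<open>The inclusion of \<open>\<rat>(\<alpha>)\<close> into \<open>R(\<alpha>)\<close> for a field \<open>R\<close> of characteristic 0.\<close>

lemma map_poly_of_rat_mult:
  "map_poly of_rat (p * q) = map_poly of_rat p * (map_poly of_rat q :: 'r::field_char_0 poly)"
  by (rule poly_eqI) (simp add: coeff_map_poly coeff_mult of_rat_sum of_rat_mult)

lemma map_poly_of_rat_eq_0: "map_poly of_rat p = (0 :: 'r::field_char_0 poly) \<longleftrightarrow> p = 0"
  by (simp add: poly_eq_iff coeff_map_poly)

definition extend_scalars :: "rat ratfun \<Rightarrow> 'r::field_char_0 ratfun" where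
  "extend_scalars f = (THE g. \<exists>p q. q \<noteq> 0 \<and> f = Fraction_Field.Fract p q \<and>
     g = Fraction_Field.Fract (map_poly of_rat p) (map_poly of_rat q))"

lemma extend_scalars_Fract:
  assumes "q \<noteq> 0"
  shows "extend_scalars (Fraction_Field.Fract p q) =
    (Fraction_Field.Fract (map_poly of_rat p) (map_poly of_rat q) :: 'r::field_char_0 ratfun)"
  unfolding extend_scalars_def
  using assms
  by (intro the_equality)
    (auto simp: eq_fract map_poly_of_rat_eq_0 simp flip: map_poly_of_rat_mult)

text \<open>
  A symmetric function over \<open>\<rat>(\<alpha>)\<close>, regarded as a rational function of \<open>\<alpha>\<close> over the fraction
  field of the ring of symmetric functions over \<open>\<rat>\<close>: \<open>\<Sum>\<^sub>p c\<^sub>p(\<alpha>) m\<^sub>p\<close> is read with the \<open>m\<^sub>p\<close> as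
  constants.
\<close>

definition as_ratfun :: "rat ratfun symfun \<Rightarrow> rat symfun fract ratfun" where
  "as_ratfun F = (\<Sum>p | is_partition p \<and> monomial_coeff F p \<noteq> 0.
     extend_scalars (monomial_coeff F p) * to_fract [:to_fract (monomial_symfun p):])"


section \<open>Jack symmetric functions and their cumulants\<close>

definition hook_alpha :: "(nat \<Rightarrow>\<^sub>0 nat) \<Rightarrow> rat ratfun" where
  "hook_alpha p = (\<Prod>s\<in>diagram p. alpha * of_nat (arm p s) + of_nat (leg p s) + 1)"

text \<open>
  The operators take values in the fraction field of the polynomial ring, since the individual
  summands of \<open>D\<^sub>1\<close> are not polynomials.
\<close>

definition D1 :: "nat \<Rightarrow> 'a::field_char_0 mpoly \<Rightarrow> 'a mpoly fract" where
  "D1 N f = (\<Sum>i<N. \<Sum>j\<in>{..<N} - {i}.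
     Fraction_Field.Fract (mvar i ^ 2) (mvar i - mvar j) * to_fract (partial_deriv i f))"

definition D2 :: "nat \<Rightarrow> 'a::field_char_0 mpoly \<Rightarrow> 'a mpoly fract" where
  "D2 N f = to_fract (mconst (1 / 2) *
     (\<Sum>i<N. mvar i ^ 2 * partial_deriv i (partial_deriv i f)))"

definition D_alpha :: "nat \<Rightarrow> rat ratfun mpoly \<Rightarrow> rat ratfun mpoly fract" where
  "D_alpha N f = D1 N f + to_fract (mconst alpha) * D2 N f"

definition jack_eigenvalue :: "nat \<Rightarrow> (nat \<Rightarrow>\<^sub>0 nat) \<Rightarrow> rat ratfun" where
  "jack_eigenvalue N p =
     alpha * of_nat (b_stat p) - of_nat (b_stat (conjugate p)) + (of_nat N - 1) * of_nat (weight p)"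

definition is_jack_poly :: "nat \<Rightarrow> (nat \<Rightarrow>\<^sub>0 nat) \<Rightarrow> rat ratfun mpoly \<Rightarrow> bool" where
  "is_jack_poly N p f \<longleftrightarrow>
     is_sym_poly N f \<and>
     D_alpha N f = to_fract (mconst (jack_eigenvalue N p) * f) \<and>
     (\<exists>a. f = mconst (hook_alpha p) * monomial_sym_poly N p +
        (\<Sum>q | is_partition q \<and> strictly_dominates p q. mconst (a q) * monomial_sym_poly N q))"

text \<open>Meaningful for partitions with at most \<open>N\<close> parts.\<close>

definition jack_poly :: "nat \<Rightarrow> (nat \<Rightarrow>\<^sub>0 nat) \<Rightarrow> rat ratfun mpoly" where
  "jack_poly N p = (THE f. is_jack_poly N p f)"

definition jack :: "(nat \<Rightarrow>\<^sub>0 nat) \<Rightarrow> rat ratfun symfun" where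
  "jack p = (THE F. \<forall>N\<ge>part_length p. in_vars F N = jack_poly N p)"

definition jack_cumulant :: "nat \<Rightarrow> (nat \<Rightarrow> (nat \<Rightarrow>\<^sub>0 nat)) \<Rightarrow> rat ratfun symfun" where
  "jack_cumulant r lam = (\<Sum>P | partition_on {1..r} P.
     of_int ((- 1) ^ (card P - 1) * fact (card P - 1)) * (\<Prod>B\<in>P. jack (\<Sum>i\<in>B. lam i)))"

end

theory Submission
  imports Defs
begin

text \<open>
  Read a family of ring elements indexed by finite sets \<open>I\<close> as a polynomial in square-free monomials
  \<open>t\<^sup>I\<close>; then the cumulants are the coefficients of \<open>K = log F\<close>, where \<open>F = \<Sum> J(\<lambda>\<^sup>I) t\<^sup>I\<close>. The operator
  \<open>D\<^sub>1\<close> is a derivation and \<open>D\<^sub>2\<close> is of second order; the eigenvalue is additive in \<open>I\<close> up to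
  \<open>\<alpha> b(\<lambda>\<^sup>I)\<close>, and \<open>b\<close> is quadratic. Dividing the eigenvalue equation for \<open>F\<close> by \<open>F\<close> shows that
  \<open>D\<^sub>\<alpha> \<kappa>\<^sub>I - e\<^sub>I \<kappa>\<^sub>I\<close> is \<open>\<alpha>/2\<close> times a bilinear expression in cumulants over complementary proper
  subsets of \<open>I\<close>, which is \<open>O(\<alpha>\<^bsup>|I| - 1\<^esup>)\<close> by induction. The operator \<open>D\<^sub>\<alpha>\<close> is triangular on
  monomial symmetric functions, and the difference of its eigenvalues at \<open>\<mu> < \<lambda>\<close> is a unit at
  \<open>\<alpha> = 0\<close>; so all coefficients of \<open>\<kappa>\<^sub>I\<close> are \<open>O(\<alpha>\<^bsup>|I| - 1\<^esup>)\<close> as soon as the leading one is.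

  The leading coefficient is a cumulant of hook products. A function \<open>u\<close> on sets has cumulants of
  that order if its multiplicative finite differences \<open>\<Prod> u(B)\<^bsup>\<plusminus>1\<^esup>\<close> over \<open>B \<subseteq> A\<close> are
  \<open>1 + O(\<alpha>\<^bsup>|A| - 1\<^esup>)\<close>. Hook products factor into products of \<open>c + \<alpha> a\<close> over intervals of \<open>a\<close> whose
  end points are additive in \<open>I\<close>, and the coefficients of the logarithmic derivative in \<open>\<alpha>\<close> are
  power sums over such intervals, which are polynomials killed by high finite differences.
\<close>

section \<open>Rational functions regular at 0\<close>

text \<open>At the top exponent the difference of eigenvalues is zero, so the triangular equation is
  silent there; this forces the separate argument with hook products. The orders in the bilinear
  terms only add up to (|A| - 1) + (|I - A| - 1) = |I| - 2, and the factor \<alpha> of the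
  second-order operator supplies the missing power. The difference of eigenvalues at
  \<open>q\<close> below \<open>p\<close> has the constant term \<open>n_stat q - n_stat p\<close>,
  which is positive because the dominating partition has the smaller \<open>n_stat\<close>. Instead
  of a logarithm series, first-order equations for all \<open>delta i\<close> pin \<open>K\<close>
  down. They make sense over any commutative ring, so the same lemmas serve the polynomial family of
  Jack polynomials and the scalar family of hook products. As \<open>D_1\<close> maps into
  fractions, it becomes a derivation of the polynomial ring only after multiplication with a common
  denominator. \<open>jack\<close> is given by descriptions, so existence, uniqueness and stability
  in the number of variables have to be established too; the coefficients defined by the triangular
  recursion yield all three.\<close>

lemma alpha_nonzero: "alpha \<noteq> (0 :: 'r::field ratfun)"
  by (simp add: alpha_def to_fract_eq_0_iff)

lemma to_fract_const_of_nat: "to_fract [:of_nat n:] = (of_nat n :: 'r::field ratfun)"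
  by (simp add: to_fract_def Fraction_Field.of_nat_fract of_nat_poly)

lemma no_pole_at_0_to_fract: "no_pole_at_0 (to_fract p)"
  unfolding no_pole_at_0_def to_fract_def by (intro exI[of _ p] exI[of _ 1]) simp

lemma no_pole_at_0_add:
  assumes "no_pole_at_0 f" "no_pole_at_0 g" shows "no_pole_at_0 (f + g)"
proof -
  obtain p q p' q' where "poly q 0 \<noteq> 0" "f = Fraction_Field.Fract p q"
    "poly q' 0 \<noteq> 0" "g = Fraction_Field.Fract p' q'"
    using assms by (auto simp: no_pole_at_0_def)
  moreover from this have "q \<noteq> 0" "q' \<noteq> 0" by auto
  ultimately show ?thesis unfolding no_pole_at_0_def
    by (intro exI[of _ "p * q' + p' * q"] exI[of _ "q * q'"]) simp
qed

lemma no_pole_at_0_mult: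
  assumes "no_pole_at_0 f" "no_pole_at_0 g" shows "no_pole_at_0 (f * g)"
proof -
  obtain p q p' q' where "poly q 0 \<noteq> 0" "f = Fraction_Field.Fract p q"
    "poly q' 0 \<noteq> 0" "g = Fraction_Field.Fract p' q'"
    using assms by (auto simp: no_pole_at_0_def)
  then show ?thesis unfolding no_pole_at_0_def
    by (intro exI[of _ "p * p'"] exI[of _ "q * q'"]) simp
qed

lemma no_pole_at_0_of_int: "no_pole_at_0 (of_int n :: 'r::field ratfun)"
proof -
  have "(of_int n :: 'r ratfun) = to_fract [:of_int n:]"
    by (cases n) (simp_all add: of_nat_poly to_fract_def Fraction_Field.of_nat_fract
        Fraction_Field.One_fract_def one_pCons)
  then show ?thesis by (simp add: no_pole_at_0_to_fract)
qed

lemma no_pole_at_0_of_nat: "no_pole_at_0 (of_nat n)"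
  using no_pole_at_0_of_int[of "int n"] by simp

lemma no_pole_at_0_alpha: "no_pole_at_0 alpha"
  by (simp add: alpha_def no_pole_at_0_to_fract)


lemma is_O_alpha_0 [simp]: "is_O_alpha 0 k"
  using no_pole_at_0_of_nat[of 0] by (simp add: is_O_alpha_def)

lemma is_O_alpha_add: "is_O_alpha f k \<Longrightarrow> is_O_alpha g k \<Longrightarrow> is_O_alpha (f + g) k"
  by (simp add: is_O_alpha_def ring_distribs no_pole_at_0_add)

lemma is_O_alpha_mult: "is_O_alpha f k \<Longrightarrow> is_O_alpha g l \<Longrightarrow> is_O_alpha (f * g) (k + l)"
  using no_pole_at_0_mult[of "f * alpha powi (- k)" "g * alpha powi (- l)"]
  by (simp add: is_O_alpha_def power_int_diff power_int_minus alpha_nonzero field_simps)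

lemma is_O_alpha_no_pole: "no_pole_at_0 f \<Longrightarrow> is_O_alpha f 0"
  by (simp add: is_O_alpha_def)

lemma is_O_alpha_power_int: "is_O_alpha (alpha powi k) k"
  using no_pole_at_0_of_nat[of 1]
  by (simp add: is_O_alpha_def alpha_nonzero flip: power_int_add)

lemma is_O_alpha_alpha: "is_O_alpha alpha 1"
  using is_O_alpha_power_int[of 1] by simp

lemma no_pole_at_0_power_alpha: "no_pole_at_0 (alpha ^ n)"
  by (induction n) (use no_pole_at_0_of_nat[of 1] in \<open>auto simp: no_pole_at_0_mult no_pole_at_0_alpha\<close>)

lemma is_O_alpha_mono:
  assumes "is_O_alpha f k" "l \<le> k" shows "is_O_alpha f l"
proof -
  have "- l = - k + int (nat (k - l))" using assms(2) by simp
  then have "f * alpha powi (- l) = f * alpha powi (- k) * alpha ^ nat (k - l)"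
    by (simp only: power_int_add[OF disjI1[OF alpha_nonzero]] power_int_of_nat mult.assoc)
  with assms(1) show ?thesis
    by (simp only: is_O_alpha_def no_pole_at_0_mult no_pole_at_0_power_alpha)
qed

lemma is_O_alpha_scale: "no_pole_at_0 c \<Longrightarrow> is_O_alpha f k \<Longrightarrow> is_O_alpha (c * f) k"
  using is_O_alpha_mult[OF is_O_alpha_no_pole] by fastforce

lemma is_O_alpha_uminus: "is_O_alpha f k \<Longrightarrow> is_O_alpha (- f) k"
  using is_O_alpha_scale[OF no_pole_at_0_of_int[of "-1"]] by fastforce

lemma is_O_alpha_diff: "is_O_alpha f k \<Longrightarrow> is_O_alpha g k \<Longrightarrow> is_O_alpha (f - g) k"
  using is_O_alpha_add[OF _ is_O_alpha_uminus, of f k g] by simp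

lemma is_O_alpha_sum: "(\<And>x. x \<in> A \<Longrightarrow> is_O_alpha (f x) k) \<Longrightarrow> is_O_alpha (sum f A) k"
  by (induction A rule: infinite_finite_induct) (auto simp: is_O_alpha_add)

section \<open>Set functions and cumulants\<close>

text \<open>
  Functions vanish on infinite sets because the sum over the subsets of an infinite set is \<open>0\<close>;
  otherwise the product below would have no unit.
\<close>

typedef (overloaded) ('i, 'a) setfun = "{f :: 'i set \<Rightarrow> 'a::zero. \<forall>I. infinite I \<longrightarrow> f I = 0}"
  morphisms set_coeff Abs_setfun
  by (rule exI[of _ "\<lambda>_. 0"]) simp

setup_lifting type_definition_setfun

lemma setfun_eqI: "(\<And>I. finite I \<Longrightarrow> set_coeff f I = set_coeff g I) \<Longrightarrow> f = g"
  by transfer (metis ext mem_Collect_eq)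

instantiation setfun :: (type, comm_ring_1) comm_ring_1
begin

lift_definition zero_setfun :: "('a, 'b) setfun" is "\<lambda>_. 0" by simp

lift_definition one_setfun :: "('a, 'b) setfun" is "\<lambda>I. if I = {} then 1 else 0" by auto

lift_definition plus_setfun :: "('a, 'b) setfun \<Rightarrow> ('a, 'b) setfun \<Rightarrow> ('a, 'b) setfun"
  is "\<lambda>f g I. f I + g I" by simp

lift_definition minus_setfun :: "('a, 'b) setfun \<Rightarrow> ('a, 'b) setfun \<Rightarrow> ('a, 'b) setfun"
  is "\<lambda>f g I. f I - g I" by simp

lift_definition uminus_setfun :: "('a, 'b) setfun \<Rightarrow> ('a, 'b) setfun"
  is "\<lambda>f I. - f I" by simp

lift_definition times_setfun :: "('a, 'b) setfun \<Rightarrow> ('a, 'b) setfun \<Rightarrow> ('a, 'b) setfun"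
  is "\<lambda>f g I. \<Sum>A\<in>Pow I. f A * g (I - A)"
  by (simp add: finite_Pow_iff)

instance
proof
  fix f g h :: "('a, 'b) setfun"
  show "f * g * h = f * (g * h)"
  proof (rule setfun_eqI, transfer)
    fix f g h :: "'a set \<Rightarrow> 'b" and I :: "'a set" assume I: "finite I"
    have fin: "finite A" if "A \<subseteq> I" for A using that I finite_subset by blast
    have "(\<Sum>A\<in>Pow I. (\<Sum>B\<in>Pow A. f B * g (A - B)) * h (I - A)) =
        (\<Sum>(A, B)\<in>Sigma (Pow I) Pow. f B * g (A - B) * h (I - A))"
      using I fin by (subst sum.Sigma[symmetric]) (auto simp: sum_distrib_right)
    also have "\<dots> = (\<Sum>(B, C)\<in>Sigma (Pow I) (\<lambda>B. Pow (I - B)). f B * (g C * h (I - B - C)))"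
      by (rule sum.reindex_bij_witness[where i = "\<lambda>(B, C). (B \<union> C, B)" and j = "\<lambda>(A, B). (B, A - B)"])
        (auto simp: mult.assoc Un_Diff intro!: arg_cong[where f = h] arg_cong2[where f = "(*)"])
    also have "\<dots> = (\<Sum>B\<in>Pow I. f B * (\<Sum>C\<in>Pow (I - B). g C * h (I - B - C)))"
      using I fin by (subst sum.Sigma[symmetric]) (auto simp: sum_distrib_left)
    finally show "(\<Sum>A\<in>Pow I. (\<Sum>B\<in>Pow A. f B * g (A - B)) * h (I - A)) =
      (\<Sum>B\<in>Pow I. f B * (\<Sum>C\<in>Pow (I - B). g C * h (I - B - C)))" .
  qed
  show "f * g = g * f"
  proof (rule setfun_eqI, transfer)
    fix f g :: "'a set \<Rightarrow> 'b" and I :: "'a set" assume I: "finite I"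
    show "(\<Sum>A\<in>Pow I. f A * g (I - A)) = (\<Sum>A\<in>Pow I. g A * f (I - A))"
      by (rule sum.reindex_bij_witness[where i = "\<lambda>A. I - A" and j = "\<lambda>A. I - A"])
        (auto simp: double_diff mult.commute)
  qed
  show "1 * f = f"
  proof (rule setfun_eqI, transfer)
    fix f :: "'a set \<Rightarrow> 'b" and I :: "'a set" assume I: "finite I"
    have "(\<Sum>A\<in>Pow I. (if A = {} then 1 else 0) * f (I - A)) =
        (\<Sum>A\<in>Pow I. if A = {} then f I else 0)"
      by (rule sum.cong) auto
    then show "(\<Sum>A\<in>Pow I. (if A = {} then 1 else 0) * f (I - A)) = f I"
      using I by simp
  qed
  show "(f + g) * h = f * h + g * h"
    by transfer (simp add: fun_eq_iff ring_distribs sum.distrib)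
  show "(0::('a, 'b) setfun) \<noteq> 1"
    by transfer (auto simp: fun_eq_iff)
qed (transfer, simp add: fun_eq_iff algebra_simps)+

end

lemmas set_coeff_simps [simp] = zero_setfun.rep_eq plus_setfun.rep_eq minus_setfun.rep_eq
  uminus_setfun.rep_eq

lemma set_coeff_times: "set_coeff (f * g) I = (\<Sum>A\<in>Pow I. set_coeff f A * set_coeff g (I - A))"
  by (simp add: times_setfun.rep_eq)

lemma set_coeff_times_empty [simp]: "set_coeff (f * g) {} = set_coeff f {} * set_coeff g {}"
  by (simp add: set_coeff_times)

lemma set_coeff_sum: "set_coeff (sum f A) I = (\<Sum>x\<in>A. set_coeff (f x) I)"
  by (induction A rule: infinite_finite_induct) auto

lift_definition delta :: "'i \<Rightarrow> ('i, 'a::zero) setfun \<Rightarrow> ('i, 'a) setfun" is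
  "\<lambda>i f I. if i \<in> I then f I else 0" by simp

text \<open>The guard keeps the value 0 on infinite sets, since \<open>d 0\<close> is arbitrary
  here.\<close>

lift_definition map_setfun :: "('a::zero \<Rightarrow> 'a) \<Rightarrow> ('i, 'a) setfun \<Rightarrow> ('i, 'a) setfun" is
  "\<lambda>d f I. if finite I then d (f I) else 0" by simp

text \<open>This is the sum of the operators c_i t_i d/dt_i, for which t^I is an eigenvector with
  eigenvalue \<open>sum c I\<close>. It makes multiplication by a quantity additive in I a
  derivation.\<close>

lift_definition weight_setfun :: "('i \<Rightarrow> 'a) \<Rightarrow> ('i, 'a::comm_ring_1) setfun \<Rightarrow> ('i, 'a) setfun" is
  "\<lambda>c f I. sum c I * f I" by simp

lift_definition const_setfun :: "'a \<Rightarrow> ('i, 'a::zero) setfun" is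
  "\<lambda>c I. if I = {} then c else 0" by auto

lemma set_coeff_const_mult: "set_coeff (const_setfun c * f) I = c * set_coeff f I"
proof (cases "finite I")
  case True
  have "set_coeff (const_setfun c * f) I = (\<Sum>A\<in>Pow I. if A = {} then c * set_coeff f I else 0)"
    unfolding set_coeff_times const_setfun.rep_eq by (rule sum.cong) auto
  then show ?thesis using True by simp
next
  case False
  then have "set_coeff f I = 0" "set_coeff (const_setfun c * f) I = 0"
    using set_coeff[of f] set_coeff[of "const_setfun c * f"] by auto
  then show ?thesis by simp
qed

lemma delta_const_setfun [simp]: "delta i (const_setfun c) = 0"
  by (rule setfun_eqI) (simp add: delta.rep_eq const_setfun.rep_eq)

section \<open>Derivations of the ring of set functions\<close>

definition derivation :: "('a::comm_ring \<Rightarrow> 'a) \<Rightarrow> bool" where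
  "derivation d \<longleftrightarrow> (\<forall>f g. d (f + g) = d f + d g) \<and> (\<forall>f g. d (f * g) = d f * g + f * d g)"

lemma derivation_add: "derivation d \<Longrightarrow> d (f + g) = d f + d g"
  and derivation_mult: "derivation d \<Longrightarrow> d (f * g) = d f * g + f * d g"
  by (auto simp: derivation_def)

lemma derivation_0: assumes "derivation d" shows "d 0 = 0"
  using derivation_add[OF assms, of 0 0] by simp

lemma derivation_diff: assumes "derivation d" shows "d (f - g) = d f - d g"
  using derivation_add[OF assms, of "f - g" g] by simp


lemma derivation_sum: assumes "derivation d" shows "d (sum f A) = (\<Sum>x\<in>A. d (f x))"
  by (induction A rule: infinite_finite_induct)
    (auto simp: derivation_0[OF assms] derivation_add[OF assms])

lemma derivation_1: assumes "derivation d" shows "d (1 :: 'a::comm_ring_1) = 0"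
  using derivation_mult[OF assms, of 1 1] by simp

text \<open>For i in I and A \<subseteq> I, the element i lies in exactly one of A and I - A, so
  exactly one of the two product terms survives.\<close>

lemma derivation_delta: "derivation (delta i :: ('i, 'a::comm_ring_1) setfun \<Rightarrow> _)"
  unfolding derivation_def
proof (intro conjI allI)
  fix f g :: "('i, 'a) setfun"
  show "delta i (f + g) = delta i f + delta i g" by transfer auto
  show "delta i (f * g) = delta i f * g + f * delta i g"
  proof (rule setfun_eqI)
    fix I :: "'i set" assume I: "finite I"
    show "set_coeff (delta i (f * g)) I = set_coeff (delta i f * g + f * delta i g) I"
      unfolding plus_setfun.rep_eq set_coeff_times delta.rep_eq sum.distrib[symmetric]
      by (cases "i \<in> I") (auto intro!: sum.cong sum.neutral)
  qed
qed

lemma derivation_map_setfun: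
  assumes "derivation d" shows "derivation (map_setfun d)"
  unfolding derivation_def
  using assms
  by (auto intro!: setfun_eqI simp: map_setfun.rep_eq set_coeff_times derivation_add derivation_mult
      derivation_sum sum.distrib finite_subset intro!: sum.cong)

lemma derivation_weight_setfun: "derivation (weight_setfun c :: ('i, 'a::comm_ring_1) setfun \<Rightarrow> _)"
  unfolding derivation_def
proof (intro conjI allI)
  fix f g :: "('i, 'a) setfun"
  show "weight_setfun c (f + g) = weight_setfun c f + weight_setfun c g"
    by transfer (auto simp: ring_distribs)
  show "weight_setfun c (f * g) = weight_setfun c f * g + f * weight_setfun c g"
  proof (rule setfun_eqI)
    fix I :: "'i set" assume I: "finite I"
    have "sum c I = sum c A + sum c (I - A)" if "A \<subseteq> I" for A
      using sum.subset_diff[OF that I, of c] by (simp add: add.commute)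
    then show "set_coeff (weight_setfun c (f * g)) I =
        set_coeff (weight_setfun c f * g + f * weight_setfun c g) I"
      unfolding plus_setfun.rep_eq set_coeff_times weight_setfun.rep_eq sum.distrib[symmetric]
        sum_distrib_left
      by (intro sum.cong) (auto simp: algebra_simps)
  qed
qed

lemma delta_map_setfun:
  "d 0 = 0 \<Longrightarrow> delta i (map_setfun d f) = map_setfun d (delta i f)"
  by (rule setfun_eqI) (simp add: delta.rep_eq map_setfun.rep_eq)

lemma delta_weight_setfun: "delta i (weight_setfun c f) = weight_setfun c (delta i f)"
  by (rule setfun_eqI) (simp add: delta.rep_eq weight_setfun.rep_eq)


text \<open>
  With \<open>delta i\<close> in the role of \<open>t\<^sub>i d/dt\<^sub>i\<close>, this says that \<open>K\<close> is the logarithm of \<open>F\<close>.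
\<close>

definition is_log :: "('i, 'a::comm_ring_1) setfun \<Rightarrow> ('i, 'a) setfun \<Rightarrow> bool" where
  "is_log F K \<longleftrightarrow> set_coeff F {} = 1 \<and> set_coeff K {} = 0 \<and> (\<forall>i. delta i F = delta i K * F)"

text \<open>In the coefficient at I with i in I, the factor \<open>delta i K\<close> is supported on
  sets containing i, so only values of E at proper subsets of I enter.\<close>

lemma delta_ode_unique:
  fixes E K :: "('i, 'a::comm_ring_1) setfun"
  assumes "\<And>i. delta i E = delta i K * E" "set_coeff E {} = 0"
  shows "E = 0"
proof (rule setfun_eqI)
  fix I :: "'i set" assume "finite I"
  then show "set_coeff E I = set_coeff 0 I"
  proof (induction I rule: finite_psubset_induct)
    case (psubset I)
    show ?case
    proof (cases "I = {}")
      case False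
      then obtain i where i: "i \<in> I" by auto
      have "set_coeff E I = set_coeff (delta i E) I"
        using i by (simp add: delta.rep_eq)
      also have "\<dots> = (\<Sum>A\<in>Pow I. set_coeff (delta i K) A * set_coeff E (I - A))"
        by (simp add: assms(1) set_coeff_times)
      also have "\<dots> = 0"
      proof (rule sum.neutral, rule ballI)
        fix A assume "A \<in> Pow I"
        then have "I - A \<subset> I" if "i \<in> A" using that i by auto
        then show "set_coeff (delta i K) A * set_coeff E (I - A) = 0"
          using psubset.IH by (simp add: delta.rep_eq)
      qed
      finally show ?thesis by simp
    qed (use assms(2) in simp)
  qed
qed

text \<open>The constant term 1 makes multiplication by F triangular for inclusion: the coefficient
  at I is the value of G at I plus terms with G at proper subsets.\<close>

lemma setfun_cancel:
  fixes F G :: "('i, 'a::comm_ring_1) setfun"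
  assumes "G * F = 0" "set_coeff F {} = 1"
  shows "G = 0"
proof (rule setfun_eqI)
  fix I :: "'i set" assume "finite I"
  then show "set_coeff G I = set_coeff 0 I"
  proof (induction I rule: finite_psubset_induct)
    case (psubset I)
    have "0 = set_coeff (G * F) I" by (simp add: assms(1))
    also have "\<dots> = (\<Sum>A\<in>Pow I. if A = I then set_coeff G I else 0)"
      unfolding set_coeff_times using psubset.IH assms(2) by (intro sum.cong) auto
    also have "\<dots> = set_coeff G I" using psubset.hyps by simp
    finally show ?case by simp
  qed
qed

text \<open>The error \<open>d F - d K * F\<close> satisfies the same first-order equations as F,
  with constant term 0, and so vanishes. Derivations commuting with all \<open>delta i\<close> thus
  differentiate the logarithm as usual.\<close>

lemma is_log_derivation:
  assumes "is_log F K" "derivation d" and comm: "\<And>i f. delta i (d f) = d (delta i f)"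
    and "set_coeff (d F) {} = 0" "set_coeff (d K) {} = 0"
  shows "d F = d K * F"
proof -
  have "d F - d K * F = 0"
  proof (rule delta_ode_unique)
    have F: "delta i F = delta i K * F" for i using assms(1) by (simp add: is_log_def)
    show "delta i (d F - d K * F) = delta i K * (d F - d K * F)" for i
      by (simp add: derivation_diff[OF derivation_delta] derivation_mult[OF derivation_delta] comm F
          derivation_mult[OF assms(2)] algebra_simps)
  qed (use assms in \<open>simp add: is_log_def\<close>)
  then show ?thesis by simp
qed

lemma derivation_twice_log:
  assumes "derivation d" "d F = d K * F"
  shows "d (d F) = (d (d K) + d K * d K) * F"
  by (simp add: assms derivation_mult algebra_simps)

section \<open>Cumulants over set partitions as coefficients of a logarithm\<close>

definition cumulant :: "('i set \<Rightarrow> 'a::comm_ring_1) \<Rightarrow> 'i set \<Rightarrow> 'a" where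
  "cumulant f I = (\<Sum>P | partition_on I P.
     of_int ((- 1) ^ (card P - 1) * fact (card P - 1)) * (\<Prod>B\<in>P. f B))"

lemma finite_partitions_on: "finite I \<Longrightarrow> finite {P. partition_on I P}"
  by (rule finite_subset[of _ "Pow (Pow I)"]) (auto simp: partition_on_def)

lemma card_blocks_not_containing:
  assumes "finite I" "partition_on I P" "i \<in> I"
  shows "card {C \<in> P. i \<notin> C} = card P - 1"
proof -
  from assms obtain B where B: "B \<in> P" "i \<in> B" by (auto simp: partition_on_def)
  then have "{C \<in> P. i \<notin> C} = P - {B}"
    using assms(2) by (auto simp: partition_on_def disjoint_def)
  with B finite_elements[OF assms(1,2)] show ?thesis by simp
qed

text \<open>Coefficientwise form of \<open>delta i F = delta i K * F\<close>. From a partition of I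
  a block not containing i is split off; k blocks leave k - 1 choices, and the Moebius values
  satisfy \<mu>(k) + (k - 1) \<mu>(k - 1) = 0 for k \<ge> 2, so only the one-block partition
  survives.\<close>

lemma cumulant_recursion:
  fixes f :: "'i set \<Rightarrow> 'a::comm_ring_1"
  assumes I: "finite I" "i \<in> I" and f: "f {} = 1"
  shows "(\<Sum>A | i \<in> A \<and> A \<subseteq> I. cumulant f A * f (I - A)) = f I"
proof -
  define \<mu> :: "nat \<Rightarrow> 'a" where "\<mu> k = of_int ((- 1) ^ (k - 1) * fact (k - 1))" for k
  have fin: "finite {A. i \<in> A \<and> A \<subseteq> I}" "finite {A. i \<in> A \<and> A \<subset> I}"
    using I by (auto intro: finite_subset[of _ "Pow I"])
  have finA: "finite A" if "A \<subseteq> I" for A using that I finite_subset by blast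
  have "{A. i \<in> A \<and> A \<subseteq> I} = insert I {A. i \<in> A \<and> A \<subset> I}" using I by auto
  then have "(\<Sum>A | i \<in> A \<and> A \<subseteq> I. cumulant f A * f (I - A)) =
      cumulant f I + (\<Sum>A | i \<in> A \<and> A \<subset> I. cumulant f A * f (I - A))"
    using fin f by simp
  also have "(\<Sum>A | i \<in> A \<and> A \<subset> I. cumulant f A * f (I - A)) =
      (\<Sum>(A, P)\<in>Sigma {A. i \<in> A \<and> A \<subset> I} (\<lambda>A. {P. partition_on A P}).
        \<mu> (card P) * (\<Prod>B\<in>P. f B) * f (I - A))"
    unfolding cumulant_def sum_distrib_right \<mu>_def
    using fin finA by (subst sum.Sigma) (auto simp: finite_partitions_on)
  also have "\<dots> = (\<Sum>(Q, C)\<in>Sigma {Q. partition_on I Q} (\<lambda>Q. {C \<in> Q. i \<notin> C}).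
        \<mu> (card Q - 1) * (\<Prod>B\<in>Q. f B))"
  \<comment> \<open>The pair (A, P) corresponds to the partition of I with the additional block I -
    A, that block being marked.\<close>
  proof (rule sum.reindex_bij_witness[where i = "\<lambda>(Q, C). (I - C, Q - {C})"
        and j = "\<lambda>(A, P). (insert (I - A) P, I - A)"], goal_cases)
    case (1 x)
    then obtain A P where x: "x = (A, P)" and *: "i \<in> A" "A \<subset> I" "partition_on A P" by auto
    then have "I - A \<notin> P" by (auto simp: partition_on_def)
    then show ?case using * by (auto simp: x)
  next
    case (2 x)
    then obtain A P where x: "x = (A, P)" and *: "i \<in> A" "A \<subset> I" "partition_on A P" by auto
    then show ?case by (auto simp: x partition_on_def disjoint_def)
  next
    case (3 x)
    then obtain Q C where x: "x = (Q, C)" and *: "partition_on I Q" "C \<in> Q" "i \<notin> C" by auto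
    then have "I - (I - C) = C" by (auto simp: partition_on_def)
    then show ?case using * by (auto simp: x)
  next
    case (4 x)
    then obtain Q C where x: "x = (Q, C)" and *: "partition_on I Q" "C \<in> Q" "i \<notin> C" by auto
    then have "C \<noteq> {}" "C \<subseteq> I" by (auto simp: partition_on_def)
    then have "i \<in> I - C" "I - C \<subset> I" using * I by auto
    moreover have "partition_on (I - C) (Q - {C})"
      using * by (auto simp: partition_on_def disjoint_def)
    ultimately show ?case by (simp add: x)
  next
    case (5 x)
    then obtain A P where x: "x = (A, P)" and *: "i \<in> A" "A \<subset> I" "partition_on A P" by auto
    then have n: "I - A \<notin> P" by (auto simp: partition_on_def)
    have "finite P" using * finA finite_elements by blast
    with n show ?case by (simp add: x mult_ac)
  qed
  also have "\<dots> = (\<Sum>Q | partition_on I Q. of_nat (card Q - 1) * \<mu> (card Q - 1) * (\<Prod>B\<in>Q. f B))"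
    using I finite_elements[OF I(1)]
    by (subst sum.Sigma[symmetric])
      (auto simp: finite_partitions_on card_blocks_not_containing algebra_simps intro!: sum.cong)
  finally have "(\<Sum>A | i \<in> A \<and> A \<subseteq> I. cumulant f A * f (I - A)) =
      (\<Sum>Q | partition_on I Q. (\<mu> (card Q) + of_nat (card Q - 1) * \<mu> (card Q - 1)) * (\<Prod>B\<in>Q. f B))"
    by (simp add: cumulant_def \<mu>_def sum.distrib ring_distribs)
  also have "\<dots> = (\<Sum>Q | partition_on I Q. if Q = {I} then f I else 0)"
  proof (intro sum.cong refl)
    fix Q assume "Q \<in> {Q. partition_on I Q}"
    then have Q: "partition_on I Q" by simp
    have finQ: "finite Q" using finite_elements[OF I(1) Q] .
    have "Q \<noteq> {}" using Q I by (auto simp: partition_on_def)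
    show "(\<mu> (card Q) + of_nat (card Q - 1) * \<mu> (card Q - 1)) * prod f Q = (if Q = {I} then f I else 0)"
    proof (cases "card Q = 1")
      case True
      then obtain B where "Q = {B}" by (auto simp: card_1_singleton_iff)
      then have "Q = {I}" using Q by (auto simp: partition_on_def)
      then show ?thesis by (simp add: \<mu>_def)
    next
      case False
      then have "card Q \<ge> 2"
        using \<open>Q \<noteq> {}\<close> finQ by (metis One_nat_def Suc_1 card_eq_0_iff le_neq_implies_less not_less_eq_eq not_less less_one)
      then obtain k where k: "card Q = Suc (Suc k)" by (metis Suc_1 Suc_le_D le_Suc_ex plus_1_eq_Suc add_Suc)
      then have "\<mu> (card Q) + of_nat (card Q - 1) * \<mu> (card Q - 1) = 0"
        by (simp add: \<mu>_def algebra_simps)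
      moreover have "Q \<noteq> {I}" using False by auto
      ultimately show ?thesis by simp
    qed
  qed
  also have "\<dots> = f I"
    using I partition_on_space[of I] by (auto simp: finite_partitions_on)
  finally show ?thesis .
qed

lift_definition setfun_of :: "('i set \<Rightarrow> 'a) \<Rightarrow> ('i, 'a::zero) setfun" is
  "\<lambda>f I. if finite I then f I else 0" by simp

text \<open>On the empty set \<open>cumulant\<close> gives 1, from the empty partition, whereas a
  logarithm needs the constant term 0.\<close>

definition cumulant_setfun :: "('i set \<Rightarrow> 'a::comm_ring_1) \<Rightarrow> ('i, 'a) setfun" where
  "cumulant_setfun f = setfun_of (\<lambda>I. if I = {} then 0 else cumulant f I)"

lemma is_log_cumulant:
  fixes f :: "'i set \<Rightarrow> 'a::comm_ring_1"
  assumes "f {} = 1" shows "is_log (setfun_of f) (cumulant_setfun f)"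
  unfolding is_log_def
proof (intro conjI allI setfun_eqI)
  fix i :: 'i and I :: "'i set" assume I: "finite I"
  have "set_coeff (delta i (cumulant_setfun f) * setfun_of f) I =
    (\<Sum>A\<in>Pow I. if i \<in> A then cumulant f A * f (I - A) else 0)"
    using I unfolding set_coeff_times
    by (auto simp: delta.rep_eq cumulant_setfun_def setfun_of.rep_eq finite_subset intro!: sum.cong)
  also have "\<dots> = (\<Sum>A | i \<in> A \<and> A \<subseteq> I. cumulant f A * f (I - A))"
    using I by (subst sum.inter_filter[symmetric]) (auto intro!: sum.cong)
  also have "\<dots> = (if i \<in> I then f I else 0)"
    using cumulant_recursion[of I i f] I assms by (auto intro!: sum.neutral)
  finally show "set_coeff (delta i (setfun_of f)) I =
      set_coeff (delta i (cumulant_setfun f) * setfun_of f) I"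
    using I by (simp add: delta.rep_eq setfun_of.rep_eq)
qed (use assms in \<open>auto simp: setfun_of.rep_eq cumulant_setfun_def\<close>)

lemma is_log_unique:
  fixes F K K' :: "('i, 'a::comm_ring_1) setfun"
  assumes "is_log F K" "is_log F K'" shows "K = K'"
proof (rule setfun_eqI)
  fix I :: "'i set" assume I: "finite I"
  show "set_coeff K I = set_coeff K' I"
  proof (cases "I = {}")
    case False
    then obtain i where i: "i \<in> I" by auto
    have "(delta i K - delta i K') * F = 0"
      using assms by (simp add: is_log_def algebra_simps)
    then have "delta i K - delta i K' = 0"
      by (rule setfun_cancel) (use assms in \<open>simp add: is_log_def\<close>)
    then have "set_coeff (delta i K) I = set_coeff (delta i K') I" by simp
    then show ?thesis using i by (simp add: delta.rep_eq)
  qed (use assms in \<open>simp add: is_log_def\<close>)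
qed

section \<open>Small cumulants from multiplicative differences\<close>

text \<open>Orders are measured relative to |I|: in this normalisation offsets add under products,
  and the estimate wanted for cumulants is offset -1.\<close>

definition O_setfun :: "int \<Rightarrow> ('i, rat ratfun) setfun \<Rightarrow> bool" where
  "O_setfun k f \<longleftrightarrow> (\<forall>I. finite I \<longrightarrow> is_O_alpha (set_coeff f I) (int (card I) + k))"

lemma O_setfun_add: "O_setfun k f \<Longrightarrow> O_setfun k g \<Longrightarrow> O_setfun k (f + g)"
  by (simp add: O_setfun_def is_O_alpha_add)

lemma O_setfun_mult:
  assumes "O_setfun k f" "O_setfun l g" shows "O_setfun (k + l) (f * g)"
  unfolding O_setfun_def set_coeff_times
proof (intro allI impI is_O_alpha_sum)
  fix I A :: "'a set" assume I: "finite I" "A \<in> Pow I"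
  then have "finite A" "card I = card A + card (I - A)"
    by (auto simp: finite_subset card_Diff_subset card_mono)
  then show "is_O_alpha (set_coeff f A * set_coeff g (I - A)) (int (card I) + (k + l))"
    using is_O_alpha_mult[of "set_coeff f A" "int (card A) + k" "set_coeff g (I - A)"
        "int (card (I - A)) + l"] assms I
    by (simp add: O_setfun_def algebra_simps)
qed

lemma O_setfun_delta: "O_setfun k f \<Longrightarrow> O_setfun k (delta i f)"
  by (simp add: O_setfun_def delta.rep_eq)

lemma O_setfun_mono: "O_setfun k f \<Longrightarrow> l \<le> k \<Longrightarrow> O_setfun l f"
  unfolding O_setfun_def by (auto elim!: is_O_alpha_mono)

lemma O_setfun_const_mult:
  assumes "is_O_alpha c l" "O_setfun k f" shows "O_setfun (k + l) (const_setfun c * f)"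
  unfolding O_setfun_def set_coeff_const_mult
proof (intro allI impI)
  fix I :: "'a set" assume "finite I"
  then have "is_O_alpha (set_coeff f I) (int (card I) + k)" using assms(2) by (simp add: O_setfun_def)
  from is_O_alpha_mult[OF assms(1) this]
  show "is_O_alpha (c * set_coeff f I) (int (card I) + (k + l))" by (simp add: algebra_simps)
qed

text \<open>For finite A this is the composite of all \<open>delta a\<close> with a in A.\<close>

lift_definition restrict_above :: "'i set \<Rightarrow> ('i, 'a::zero) setfun \<Rightarrow> ('i, 'a) setfun" is
  "\<lambda>A f I. if A \<subseteq> I then f I else 0" by simp

text \<open>Applying all \<open>delta a\<close> to F = exp K produces F times a polynomial in
  derivatives of K. Each new derivation hits either y, which keeps its offset, or F, which brings in
  a factor of offset -1. Every term is supported on sets containing A.\<close>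

lemma restrict_above_log:
  fixes F K :: "('i, rat ratfun) setfun"
  assumes "is_log F K" "O_setfun (-1) K" "finite A"
  shows "\<exists>y. restrict_above A F = y * F \<and> O_setfun (- int (card A)) y \<and> restrict_above A y = y"
  using assms(3)
proof (induction A)
  case empty
  have "O_setfun 0 (1 :: ('i, rat ratfun) setfun)"
    using is_O_alpha_power_int[of 0, where 'a = rat] by (auto simp: O_setfun_def one_setfun.rep_eq)
  then show ?case
    by (intro exI[of _ 1]) (auto intro!: setfun_eqI simp: restrict_above.rep_eq)
next
  case (insert a A)
  then obtain y where y: "restrict_above A F = y * F" "O_setfun (- int (card A)) y"
    "restrict_above A y = y" by auto
  define y' where "y' = delta a y + y * delta a K"
  have ra: "restrict_above (insert a A) f = delta a (restrict_above A f)" for f :: "('i, rat ratfun) setfun"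
    by (rule setfun_eqI) (auto simp: restrict_above.rep_eq delta.rep_eq)
  have "restrict_above (insert a A) F = y' * F"
    using assms(1) unfolding ra y(1) y'_def is_log_def
    by (simp add: derivation_mult[OF derivation_delta] algebra_simps)
  moreover have "O_setfun (- int (card (insert a A))) y'"
  proof -
    have "O_setfun (- int (card A) - 1) (y * delta a K)"
      using O_setfun_mult[OF y(2) O_setfun_delta[OF assms(2)]] by simp
    moreover have "O_setfun (- int (card A) - 1) (delta a y)"
      by (rule O_setfun_mono[OF O_setfun_delta[OF y(2)]]) simp
    moreover have "- int (card (insert a A)) = - int (card A) - 1" using insert by simp
    ultimately show ?thesis by (simp only: y'_def O_setfun_add)
  qed
  moreover have "restrict_above (insert a A) y' = y'"
  proof (rule setfun_eqI)
    fix I :: "'i set" assume I: "finite I"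
    have z: "set_coeff y B = 0" if "\<not> A \<subseteq> B" for B
    proof -
      have "set_coeff y B = set_coeff (restrict_above A y) B" by (simp only: y(3))
      then show ?thesis using that by (simp add: restrict_above.rep_eq)
    qed
    have "set_coeff y' I = 0" if I: "\<not> insert a A \<subseteq> I"
    proof -
      have "set_coeff (delta a y) I = 0" using I z[of I] by (auto simp: delta.rep_eq)
      moreover have "set_coeff y B * set_coeff (delta a K) (I - B) = 0" if "B \<in> Pow I" for B
        using I z[of B] that by (auto simp: delta.rep_eq)
      then have "set_coeff (y * delta a K) I = 0"
        unfolding set_coeff_times by (rule sum.neutral[OF ballI])
      ultimately show ?thesis by (simp add: y'_def)
    qed
    then show "set_coeff (restrict_above (insert a A) y') I = set_coeff y' I"
      by (simp add: restrict_above.rep_eq)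
  qed
  ultimately show ?case by blast
qed

text \<open>All sets in the support of \<open>y\<close> contain \<open>A\<close>, so \<open>y\<^sup>2 = 0\<close> and \<open>log (1 + z y) = z y\<close>.\<close>

lemma is_log_perturb:
  fixes F K :: "('i, rat ratfun) setfun"
  assumes F: "is_log F K" "O_setfun (-1) K" and A: "finite A" "A \<noteq> {}"
    and z: "is_O_alpha z (int (card A) - 1)"
  shows "\<exists>K'. is_log (F + const_setfun z * restrict_above A F) K' \<and> O_setfun (-1) K'"
proof -
  from A obtain a where a: "a \<in> A" by auto
  from restrict_above_log[OF F A(1)] obtain y where y: "restrict_above A F = y * F"
    "O_setfun (- int (card A)) y" "restrict_above A y = y" by auto
  define K' where "K' = K + const_setfun z * y"
  have y0: "set_coeff y B = 0" if "\<not> A \<subseteq> B" for B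
  proof -
    have "set_coeff y B = set_coeff (restrict_above A y) B" by (simp only: y(3))
    then show ?thesis using that by (simp add: restrict_above.rep_eq)
  qed
  have yy: "delta i y * y = 0" for i
  proof (rule setfun_eqI)
    fix I :: "'i set" assume "finite I"
    have "set_coeff (delta i y) B * set_coeff y (I - B) = 0" for B
      using y0[of B] y0[of "I - B"] a by (auto simp: delta.rep_eq)
    then show "set_coeff (delta i y * y) I = set_coeff 0 I"
      unfolding set_coeff_times by (simp only: sum.neutral_const zero_setfun.rep_eq)
  qed
  have "is_log (F + const_setfun z * restrict_above A F) K'"
    unfolding is_log_def
  proof (intro conjI allI)
    show "set_coeff (F + const_setfun z * restrict_above A F) {} = 1" "set_coeff K' {} = 0"
      using F(1) A(2) y0[of "{}"]
      by (simp_all add: is_log_def set_coeff_const_mult restrict_above.rep_eq K'_def del: set_coeff_times_empty)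
    fix i
    have dF: "delta i F = delta i K * F" using F(1) by (simp add: is_log_def)
    have "delta i K' = delta i K + const_setfun z * delta i y"
      by (simp add: K'_def derivation_add[OF derivation_delta] derivation_mult[OF derivation_delta])
    moreover have "delta i (F + const_setfun z * (y * F)) =
        delta i F + const_setfun z * (delta i y * F + y * delta i F)"
      by (simp add: derivation_add[OF derivation_delta] derivation_mult[OF derivation_delta])
    \<comment> \<open>The last term, the only one quadratic in \<open>c\<close>, contains the
      vanishing product \<open>delta i y * y\<close>.\<close>
    moreover have "(k + c * d) * (F + c * (y * F)) = k * F + c * (d * F + y * (k * F)) + c * c * F * (d * y)"
      for k c d :: "('i, rat ratfun) setfun"
      by (simp add: algebra_simps)
    ultimately have "delta i (F + const_setfun z * (y * F)) = delta i K' * (F + const_setfun z * (y * F))"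
      by (simp only: yy dF mult_zero_right add_0_right)
    then show "delta i (F + const_setfun z * restrict_above A F) =
        delta i K' * (F + const_setfun z * restrict_above A F)"
      by (simp add: y(1))
  qed
  \<comment> \<open>The order \<open>card A - 1\<close> of z and the offset \<open>- card A\<close>
    of y add up to -1.\<close>
  moreover have "O_setfun (-1) K'"
    using O_setfun_add[OF F(2)] O_setfun_const_mult[OF z y(2)] by (simp add: K'_def)
  ultimately show ?thesis by blast
qed

text \<open>The constant function 1 is the exponential of the sum of all t_i, so K is supported on
  singletons, where |I| - 1 = 0.\<close>

lemma is_log_one:
  "\<exists>K. is_log (setfun_of (\<lambda>_. 1) :: ('i, rat ratfun) setfun) K \<and> O_setfun (-1) K"
proof (intro exI conjI)
  define K :: "('i, rat ratfun) setfun" where "K = setfun_of (\<lambda>I. if card I = 1 then 1 else 0)"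
  show "O_setfun (-1) K"
    using is_O_alpha_no_pole[OF no_pole_at_0_of_nat[of 1]]
    by (auto simp: O_setfun_def K_def setfun_of.rep_eq)
  show "is_log (setfun_of (\<lambda>_. 1)) K"
    unfolding is_log_def
  proof (intro conjI allI setfun_eqI)
    fix i :: 'i and I :: "'i set" assume I: "finite I"
    have "set_coeff (delta i K * setfun_of (\<lambda>_. 1)) I = (\<Sum>A\<in>Pow I. if A = {i} then 1 else 0)"
      unfolding set_coeff_times using I
      by (intro sum.cong) (auto simp: delta.rep_eq K_def setfun_of.rep_eq card_1_singleton_iff finite_subset)
    also have "\<dots> = (if i \<in> I then 1 else 0)" using I by simp
    finally show "set_coeff (delta i (setfun_of (\<lambda>_. 1))) I =
        set_coeff (delta i K * setfun_of (\<lambda>_. 1)) I"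
      using I by (simp add: delta.rep_eq setfun_of.rep_eq)
  qed (simp_all add: K_def setfun_of.rep_eq)
qed

text \<open>Multiplying the values above A by \<open>w A\<close> adds \<open>w A - 1\<close> times
  the restriction above A. Each factor is therefore one perturbation step, starting from the
  constant function 1.\<close>

lemma is_log_prod_above:
  fixes w :: "'i set \<Rightarrow> rat ratfun"
  assumes "finite \<A>"
    and "\<And>A. A \<in> \<A> \<Longrightarrow> finite A \<and> A \<noteq> {} \<and> is_O_alpha (w A - 1) (int (card A) - 1)"
  shows "\<exists>K. is_log (setfun_of (\<lambda>I. \<Prod>A\<in>\<A>. if A \<subseteq> I then w A else 1)) K \<and> O_setfun (-1) K"
  using assms
proof (induction \<A>)
  case empty
  then show ?case using is_log_one by simp
next
  case (insert A \<A>)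
  let ?F = "setfun_of (\<lambda>I. \<Prod>A\<in>\<A>. if A \<subseteq> I then w A else 1)"
  obtain K where K: "is_log ?F K" "O_setfun (-1) K" using insert by auto
  have A: "finite A" "A \<noteq> {}" "is_O_alpha (w A - 1) (int (card A) - 1)" using insert.prems by auto
  have "setfun_of (\<lambda>I. \<Prod>A\<in>insert A \<A>. if A \<subseteq> I then w A else 1) =
      ?F + const_setfun (w A - 1) * restrict_above A ?F"
    using insert.hyps
    by (intro setfun_eqI) (simp add: setfun_of.rep_eq set_coeff_const_mult restrict_above.rep_eq algebra_simps)
  then show ?case using is_log_perturb[OF K A] by simp
qed

section \<open>Multiplicative Moebius inversion on subsets\<close>

definition mobius_prod :: "('i set \<Rightarrow> 'a::field) \<Rightarrow> 'i set \<Rightarrow> 'a" where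
  "mobius_prod u A = (\<Prod>B\<in>Pow A. if even (card (A - B)) then u B else inverse (u B))"

lemma mobius_prod_insert:
  assumes "finite A" "a \<notin> A"
  shows "mobius_prod u (insert a A) = mobius_prod (\<lambda>B. u (insert a B)) A * inverse (mobius_prod u A)"
proof -
  have inj: "inj_on (insert a) (Pow A)" using assms(2) by (auto simp: inj_on_def)
  have 1: "card (insert a A - B) = Suc (card (A - B))" if "B \<in> Pow A" for B
    using that assms by (subst insert_Diff_if) auto
  have 2: "insert a A - insert a B = A - B" if "B \<in> Pow A" for B
    using that assms by auto
  have "mobius_prod u (insert a A) =
      (\<Prod>B\<in>Pow A. if even (card (insert a A - B)) then u B else inverse (u B)) *
      (\<Prod>B\<in>insert a ` Pow A. if even (card (insert a A - B)) then u B else inverse (u B))"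
    unfolding mobius_prod_def Pow_insert using assms by (intro prod.union_disjoint) auto
  also have "(\<Prod>B\<in>Pow A. if even (card (insert a A - B)) then u B else inverse (u B)) =
      inverse (mobius_prod u A)"
    unfolding mobius_prod_def prod_inversef[symmetric] by (intro prod.cong) (auto simp: 1)
  also have "(\<Prod>B\<in>insert a ` Pow A. if even (card (insert a A - B)) then u B else inverse (u B)) =
      mobius_prod (\<lambda>B. u (insert a B)) A"
    unfolding mobius_prod_def prod.reindex[OF inj] using 2 by (intro prod.cong) (simp_all del: Diff_insert Diff_insert2)
  finally show ?thesis by (simp add: mult.commute)
qed

lemma mobius_prod_nonzero: "finite A \<Longrightarrow> (\<And>B. B \<subseteq> A \<Longrightarrow> u B \<noteq> 0) \<Longrightarrow> mobius_prod u A \<noteq> 0"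
  by (auto simp: mobius_prod_def)

text \<open>The factors for A and \<open>insert a A\<close> multiply to the factor at A of the
  function \<open>\<lambda>B. u (insert a B)\<close>; the inverse cancels since u does not
  vanish.\<close>

lemma prod_mobius_prod:
  assumes "finite I" "\<And>B. B \<subseteq> I \<Longrightarrow> u B \<noteq> (0 :: 'a::field)"
  shows "(\<Prod>A\<in>Pow I. mobius_prod u A) = u I"
  using assms
proof (induction I arbitrary: u)
  case empty
  then show ?case by (simp add: mobius_prod_def)
next
  case (insert a I)
  have inj: "inj_on (insert a) (Pow I)" using insert.hyps by (auto simp: inj_on_def)
  have "(\<Prod>A\<in>Pow (insert a I). mobius_prod u A) =
      (\<Prod>A\<in>Pow I. mobius_prod u A) * (\<Prod>A\<in>insert a ` Pow I. mobius_prod u A)"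
    unfolding Pow_insert using insert.hyps by (intro prod.union_disjoint) auto
  also have "(\<Prod>A\<in>insert a ` Pow I. mobius_prod u A) =
      (\<Prod>A\<in>Pow I. mobius_prod (\<lambda>B. u (insert a B)) A * inverse (mobius_prod u A))"
    unfolding prod.reindex[OF inj]
    using insert.hyps by (intro prod.cong) (auto intro!: mobius_prod_insert intro: finite_subset)
  also have "(\<Prod>A\<in>Pow I. mobius_prod u A) * \<dots> = (\<Prod>A\<in>Pow I. mobius_prod (\<lambda>B. u (insert a B)) A)"
    unfolding prod.distrib[symmetric]
  proof (intro prod.cong refl)
    fix A assume "A \<in> Pow I"
    then have "mobius_prod u A \<noteq> 0"
      using insert.prems insert.hyps by (intro mobius_prod_nonzero) (auto intro: finite_subset)
    then show "mobius_prod u A * (mobius_prod (\<lambda>B. u (insert a B)) A * inverse (mobius_prod u A)) =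
        mobius_prod (\<lambda>B. u (insert a B)) A" by simp
  qed
  also have "\<dots> = u (insert a I)"
    by (rule insert.IH, rule insert.prems) auto
  finally show ?case .
qed

lemma cumulant_cong:
  assumes "\<And>A. A \<subseteq> I \<Longrightarrow> f A = g A" shows "cumulant f I = cumulant g I"
  unfolding cumulant_def
proof (intro sum.cong refl arg_cong2[where f = "(*)"] prod.cong)
  fix P B assume "P \<in> {P. partition_on I P}" "B \<in> P"
  then show "f B = g B" by (intro assms) (auto simp: partition_on_def)
qed

text \<open>Moebius inversion writes u on subsets of I as a product of factors
  \<open>mobius_prod u A\<close> switched on above A. The product makes sense on all sets, while
  nothing is known of u outside I; the cumulant at I only sees subsets of I.\<close>

theorem is_O_alpha_cumulant:
  fixes u :: "'i set \<Rightarrow> rat ratfun"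
  assumes I: "finite I" "I \<noteq> {}" and u: "u {} = 1" "\<And>A. A \<subseteq> I \<Longrightarrow> u A \<noteq> 0"
    and w: "\<And>A. A \<subseteq> I \<Longrightarrow> A \<noteq> {} \<Longrightarrow> is_O_alpha (mobius_prod u A - 1) (int (card A) - 1)"
  shows "is_O_alpha (cumulant u I) (int (card I) - 1)"
proof -
  let ?\<A> = "Pow I - {{}}"
  let ?f = "\<lambda>J. \<Prod>A\<in>?\<A>. if A \<subseteq> J then mobius_prod u A else 1"
  have f: "?f J = u J" if "J \<subseteq> I" for J
  proof -
    have "?f J = (\<Prod>A\<in>Pow I. if A \<subseteq> J then mobius_prod u A else 1)"
      by (rule prod.mono_neutral_left) (use I u(1) in \<open>auto simp: mobius_prod_def\<close>)
    also have "\<dots> = (\<Prod>A\<in>Pow J. mobius_prod u A)"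
      using that I by (intro prod.mono_neutral_cong_right) auto
    also have "\<dots> = u J"
      using that I u(2) by (intro prod_mobius_prod) (auto intro: finite_subset)
    finally show ?thesis .
  qed
  obtain K where K: "is_log (setfun_of ?f) K" "O_setfun (-1) K"
    using is_log_prod_above[of ?\<A> "mobius_prod u"] I w
    by (metis (no_types, lifting) DiffE PowD finite_Diff finite_Pow_iff finite_subset insertCI)
  have "K = cumulant_setfun ?f"
    by (rule is_log_unique[OF K(1) is_log_cumulant]) (use f[of "{}"] u(1) in simp)
  then have "set_coeff K I = cumulant ?f I"
    using I by (simp add: cumulant_setfun_def setfun_of.rep_eq)
  also have "\<dots> = cumulant u I" by (rule cumulant_cong[OF f])
  finally have "set_coeff K I = cumulant u I" .
  moreover have "is_O_alpha (set_coeff K I) (int (card I) - 1)"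
    using K(2) I by (simp add: O_setfun_def)
  ultimately show ?thesis by simp
qed

lemma mobius_prod_mult:
  "finite A \<Longrightarrow> mobius_prod (\<lambda>B. u B * v B) A = mobius_prod u A * mobius_prod v A"
  unfolding mobius_prod_def prod.distrib[symmetric] by (intro prod.cong) auto

lemma mobius_prod_const:
  assumes "finite A" "A \<noteq> {}" "c \<noteq> 0" shows "mobius_prod (\<lambda>_. c) A = 1"
proof -
  from assms(2) obtain a where "a \<in> A" by auto
  then have "A = insert a (A - {a})" by auto
  then show ?thesis
    using mobius_prod_insert[of "A - {a}" a "\<lambda>_. c"] assms
      mobius_prod_nonzero[of "A - {a}" "\<lambda>_. c"] by simp
qed

text \<open>The quotient in one direction a is the constant \<open>v a\<close>, and the remaining
  nonempty difference of a constant is 1.\<close>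

lemma mobius_prod_multiplicative:
  assumes "finite A" "card A \<ge> 2" "\<And>i. i \<in> A \<Longrightarrow> v i \<noteq> (0 :: 'a::field)"
  shows "mobius_prod (\<lambda>B. \<Prod>i\<in>B. v i) A = 1"
proof -
  from assms(2) obtain a where a: "a \<in> A" by fastforce
  define A' where "A' = A - {a}"
  have A': "A = insert a A'" "a \<notin> A'" "finite A'"
    using a assms by (auto simp: A'_def)
  have "A' \<noteq> {}" using A' assms(2) by auto
  note A' = A' this
  have "mobius_prod (\<lambda>B. \<Prod>i\<in>insert a B. v i) A' = mobius_prod (\<lambda>B. v a * (\<Prod>i\<in>B. v i)) A'"
    unfolding mobius_prod_def
  proof (intro prod.cong refl)
    fix B assume "B \<in> Pow A'"
    then have "finite B" "a \<notin> B" using A' by (auto intro: finite_subset)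
    then show "(if even (card (A' - B)) then prod v (insert a B) else inverse (prod v (insert a B))) =
        (if even (card (A' - B)) then v a * prod v B else inverse (v a * prod v B))" by simp
  qed
  also have "\<dots> = mobius_prod (\<lambda>B. \<Prod>i\<in>B. v i) A'"
    unfolding mobius_prod_mult[OF A'(3), of "\<lambda>_. v a"]
      mobius_prod_const[OF A'(3,4) assms(3)[OF a]] by (rule mult_1_left)
  finally have "mobius_prod (\<lambda>B. \<Prod>i\<in>insert a B. v i) A' = mobius_prod (\<lambda>B. \<Prod>i\<in>B. v i) A'" .
  moreover have "mobius_prod (\<lambda>B. \<Prod>i\<in>B. v i) A' \<noteq> 0"
    using A'(1,3) assms(3) by (intro mobius_prod_nonzero) (auto simp: finite_subset subset_iff)
  ultimately show ?thesis using A'(2,3) by (simp add: A'(1) mobius_prod_insert)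
qed

section \<open>Finite differences of powers and power sums\<close>

lemma sum_Pow_insert:
  assumes "finite A" "a \<notin> A"
  shows "(\<Sum>B\<in>Pow (insert a A). (- 1) ^ card (insert a A - B) * f B) =
    (\<Sum>B\<in>Pow A. (- 1) ^ card (A - B) * (f (insert a B) - f B :: 'a::comm_ring_1))"
proof -
  have inj: "inj_on (insert a) (Pow A)" using assms(2) by (auto simp: inj_on_def)
  have 1: "card (insert a A - B) = Suc (card (A - B))" if "B \<in> Pow A" for B
    using that assms by (subst insert_Diff_if) auto
  have 2: "insert a A - insert a B = A - B" if "B \<in> Pow A" for B
    using that assms by auto
  have "(\<Sum>B\<in>Pow (insert a A). (- 1) ^ card (insert a A - B) * f B) =
      (\<Sum>B\<in>Pow A. (- 1) ^ card (insert a A - B) * f B) +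
      (\<Sum>B\<in>insert a ` Pow A. (- 1) ^ card (insert a A - B) * f B)"
    unfolding Pow_insert using assms by (intro sum.union_disjoint) auto
  also have "\<dots> = (\<Sum>B\<in>Pow A. - ((- 1) ^ card (A - B) * f B) + (- 1) ^ card (A - B) * f (insert a B))"
    unfolding sum.reindex[OF inj] sum.distrib using 1 2
    by (intro arg_cong2[where f = "(+)"] sum.cong) (simp_all del: Diff_insert Diff_insert2)
  finally show ?thesis by (simp add: algebra_simps)
qed

text \<open>Each element of A contributes one finite difference, which lowers the degree by the
  binomial theorem; a polynomial of degree k < card A is exhausted.\<close>

lemma alternating_sum_power:
  fixes x :: "'i \<Rightarrow> 'a::comm_ring_1"
  assumes "finite A" "k < card A"
  shows "(\<Sum>B\<in>Pow A. (- 1) ^ card (A - B) * (z + sum x B) ^ k) = 0"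
  using assms
proof (induction A arbitrary: k z)
  case (insert a A)
  have 1: "(z + sum x (insert a B)) ^ k - (z + sum x B) ^ k =
      (\<Sum>j<k. of_nat (k choose j) * x a ^ (k - j) * (z + sum x B) ^ j)" if "B \<in> Pow A" for B
  proof -
    have "a \<notin> B" "finite B" using that insert.hyps by (auto intro: finite_subset)
    then have "(z + sum x (insert a B)) ^ k = ((z + sum x B) + x a) ^ k" by (simp add: algebra_simps)
    also have "\<dots> = (\<Sum>j\<le>k. of_nat (k choose j) * (z + sum x B) ^ j * x a ^ (k - j))"
      by (rule binomial_ring)
    also have "\<dots> = (\<Sum>j<k. of_nat (k choose j) * (z + sum x B) ^ j * x a ^ (k - j)) + (z + sum x B) ^ k"
      by (simp add: lessThan_Suc_atMost[symmetric])
    finally show ?thesis by (simp add: mult_ac)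
  qed
  have "(\<Sum>B\<in>Pow (insert a A). (- 1) ^ card (insert a A - B) * (z + sum x B) ^ k) =
      (\<Sum>B\<in>Pow A. (- 1) ^ card (A - B) *
        (\<Sum>j<k. of_nat (k choose j) * x a ^ (k - j) * (z + sum x B) ^ j))"
    unfolding sum_Pow_insert[OF insert.hyps] using 1 by (intro sum.cong) simp_all
  also have "\<dots> = (\<Sum>j<k. of_nat (k choose j) * x a ^ (k - j) *
      (\<Sum>B\<in>Pow A. (- 1) ^ card (A - B) * (z + sum x B) ^ j))"
    unfolding sum_distrib_left by (subst sum.swap) (simp add: mult_ac)
  also have "\<dots> = 0"
    using insert by (intro sum.neutral) auto
  finally show ?case .
qed simp

lemma sum_lessThan_add:
  "(\<Sum>b<m + n. f b) = (\<Sum>b<m. f b) + (\<Sum>b<n. f (b + m) :: 'a::comm_monoid_add)" for m n :: nat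
  by (induction n) (simp_all add: add_ac)

text \<open>One difference turns the power sum up to \<open>sum x B\<close> into a sum of
  \<open>x a\<close> shifted k-th powers, of degree k in \<open>sum x B\<close>; the remaining card
  A - 1 > k differences kill it. No closed formula for power sums is required.\<close>

lemma alternating_sum_power_sum:
  fixes x :: "'i \<Rightarrow> nat"
  assumes "finite A" "k + 1 < card A"
  shows "(\<Sum>B\<in>Pow A. (- 1) ^ card (A - B) * (\<Sum>a<sum x B. of_nat a ^ k :: 'a::comm_ring_1)) = 0"
proof -
  from assms(2) obtain a where a: "a \<in> A" by fastforce
  define A' where "A' = A - {a}"
  have A': "A = insert a A'" "a \<notin> A'" "finite A'" "k < card A'"
    using a assms by (auto simp: A'_def)
  have 1: "(\<Sum>b<sum x (insert a B). of_nat b ^ k) - (\<Sum>b<sum x B. of_nat b ^ k) =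
      (\<Sum>b<x a. (of_nat b + (\<Sum>i\<in>B. of_nat (x i))) ^ k :: 'a)" if "B \<in> Pow A'" for B
  proof -
    have "a \<notin> B" "finite B" using that A' by (auto intro: finite_subset)
    then have "(\<Sum>b<sum x (insert a B). of_nat b ^ k :: 'a) = (\<Sum>b<sum x B + x a. of_nat b ^ k)"
      by (simp add: add.commute)
    also have "\<dots> = (\<Sum>b<sum x B. of_nat b ^ k) + (\<Sum>b<x a. of_nat (b + sum x B) ^ k)"
      by (rule sum_lessThan_add)
    finally show ?thesis by simp
  qed
  have "(\<Sum>B\<in>Pow A. (- 1) ^ card (A - B) * (\<Sum>a<sum x B. of_nat a ^ k :: 'a)) =
      (\<Sum>B\<in>Pow A'. (- 1) ^ card (A' - B) * (\<Sum>b<x a. (of_nat b + (\<Sum>i\<in>B. of_nat (x i))) ^ k))"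
    unfolding A'(1) sum_Pow_insert[OF A'(3,2)] using 1 by (intro sum.cong) simp_all
  also have "\<dots> = (\<Sum>b<x a. \<Sum>B\<in>Pow A'. (- 1) ^ card (A' - B) * (of_nat b + (\<Sum>i\<in>B. of_nat (x i))) ^ k)"
    unfolding sum_distrib_left by (rule sum.swap)
  also have "\<dots> = 0"
    using A' by (intro sum.neutral ballI alternating_sum_power)
  finally show ?thesis .
qed

section \<open>Logarithmic derivatives of formal power series\<close>

definition is_logderiv :: "'a::field_char_0 fps \<Rightarrow> 'a fps \<Rightarrow> bool" where
  "is_logderiv f s \<longleftrightarrow> fps_deriv f = f * s"

lemma is_logderiv_mult: "is_logderiv f s \<Longrightarrow> is_logderiv g t \<Longrightarrow> is_logderiv (f * g) (s + t)"
  by (simp add: is_logderiv_def algebra_simps)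

lemma is_logderiv_prod:
  "(\<And>x. x \<in> A \<Longrightarrow> is_logderiv (f x) (s x)) \<Longrightarrow> is_logderiv (prod f A) (sum s A)"
proof (induction A rule: infinite_finite_induct)
  case (insert x A)
  then show ?case by (simp add: is_logderiv_mult)
qed (simp_all add: is_logderiv_def)

lemma is_logderiv_inverse:
  assumes "is_logderiv f s" "f $ 0 \<noteq> 0" shows "is_logderiv (inverse f) (- s)"
proof -
  have "fps_deriv (inverse f) = - (f * s) * (inverse f * inverse f)"
    using assms by (simp add: is_logderiv_def fps_inverse_deriv power2_eq_square)
  also have "\<dots> = (inverse f * f) * (inverse f * - s)" by (simp only: mult_ac mult_minus_left mult_minus_right)
  finally show ?thesis using assms(2) by (simp add: is_logderiv_def inverse_mult_eq_1)
qed

text \<open>The series is the geometric expansion of a / (c + a X).\<close>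

lemma is_logderiv_linear:
  assumes "c \<noteq> 0"
  shows "is_logderiv (fps_of_poly [:c, a:]) (Abs_fps (\<lambda>k. (- 1) ^ k * a ^ Suc k / c ^ Suc k))"
  unfolding is_logderiv_def
proof (rule fps_ext)
  fix n
  show "fps_deriv (fps_of_poly [:c, a:]) $ n =
      (fps_of_poly [:c, a:] * Abs_fps (\<lambda>k. (- 1) ^ k * a ^ Suc k / c ^ Suc k)) $ n"
    using assms
    by (cases n) (auto simp: fps_of_poly_pCons ring_distribs mult.assoc coeff_pCons field_simps split: nat.splits)
qed

text \<open>Comparing coefficients in w' = w s expresses k w_k through s_0, ..., s_(k-1), and these
  all vanish.\<close>

lemma fps_eq_1_up_to:
  fixes w :: "'a::field_char_0 fps"
  assumes "is_logderiv w s" "w $ 0 = 1" "\<And>k. Suc k < n \<Longrightarrow> s $ k = 0" "0 < k" "k < n"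
  shows "w $ k = 0"
proof -
  obtain j where j: "k = Suc j" using assms(4) by (cases k) auto
  have "of_nat k * w $ k = (w * s) $ j"
    using assms(1) j by (metis fps_deriv_nth is_logderiv_def Suc_eq_plus1)
  also have "\<dots> = 0"
    unfolding fps_mult_nth using assms(3,5) j by (intro sum.neutral) auto
  finally show ?thesis using assms(4) by simp
qed

lemma to_fract_prod: "to_fract (prod f A) = (\<Prod>x\<in>A. to_fract (f x))"
  by (induction A rule: infinite_finite_induct) auto

lemma to_fract_monom: "to_fract (monom 1 n) = (alpha ^ n :: 'r::field ratfun)"
proof (induction n)
  case (Suc n)
  have "monom (1 :: 'r) (Suc n) = [:0, 1:] * monom 1 n" by (simp add: monom_Suc)
  then show ?case by (simp only: to_fract_mult Suc alpha_def power_Suc)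
qed (simp add: monom_0 flip: one_pCons)

lemma fps_nth_prod_0: "prod f A $ 0 = (\<Prod>x\<in>A. f x $ 0)"
  by (induction A rule: infinite_finite_induct) auto

text \<open>The multiplicative difference is a quotient N / D of polynomials with D(0) nonzero, so
  the claim is that the power series w = N / D is 1 modulo X^(card A - 1). Its constant term is the
  difference of a multiplicative function of B, hence 1, and the low coefficients of its logarithmic
  derivative are alternating sums of power sums, hence 0.\<close>

lemma mobius_prod_interval_prod:
  fixes x y :: "'i \<Rightarrow> nat"
  assumes A: "finite A" "A \<noteq> {}" and yx: "\<And>i. i \<in> A \<Longrightarrow> y i \<le> x i" and c: "c > 0"
  shows "is_O_alpha (mobius_prod (\<lambda>B. \<Prod>a\<in>{sum y B..<sum x B}. alpha * of_nat a + of_nat c) A - 1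
    :: rat ratfun) (int (card A) - 1)"
proof -
  define P :: "'i set \<Rightarrow> rat poly" where "P B = (\<Prod>a\<in>{sum y B..<sum x B}. [:of_nat c, of_nat a:])" for B
  define N where "N = (\<Prod>B | B \<in> Pow A \<and> even (card (A - B)). P B)"
  define D where "D = (\<Prod>B | B \<in> Pow A \<and> odd (card (A - B)). P B)"
  define n where "n = card A - 1"
  have c0: "of_nat c \<noteq> (0 :: rat)" using c by simp
  have P0: "poly (P B) 0 \<noteq> 0" for B using c by (simp add: P_def poly_prod)
  then have D0: "poly D 0 \<noteq> 0" using A by (simp add: D_def poly_prod)
  then have "D \<noteq> 0" by auto
  have lin: "alpha * of_nat a + of_nat c = (to_fract [:of_nat c, of_nat a:] :: rat ratfun)" for a
    by (simp add: alpha_def to_fract_def Fraction_Field.of_nat_fract of_nat_poly)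
  have "mobius_prod (\<lambda>B. \<Prod>a\<in>{sum y B..<sum x B}. alpha * of_nat a + of_nat c) A =
      (\<Prod>B\<in>Pow A. if even (card (A - B)) then to_fract (P B) else inverse (to_fract (P B)))"
    unfolding mobius_prod_def by (simp only: lin P_def to_fract_prod)
  also have "\<dots> = to_fract N * inverse (to_fract D)"
    using A by (simp add: prod.If_cases N_def D_def to_fract_prod prod_inversef[symmetric] Int_def)
  finally have mob: "mobius_prod (\<lambda>B. \<Prod>a\<in>{sum y B..<sum x B}. alpha * of_nat a + of_nat c) A - 1 =
      (to_fract (N - D) * inverse (to_fract D) :: rat ratfun)"
    using \<open>D \<noteq> 0\<close> by (simp add: left_diff_distrib)
  have "monom 1 n dvd N - D"
    unfolding monom_1_dvd_iff'
  proof (intro allI impI)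
    fix k assume k: "k < n"
    \<comment> \<open>A value k < n exists only if A has at least two elements, as the constant term
      requires; for a singleton the divisibility by X^0 is void.\<close>
    then have A2: "card A \<ge> 2" by (simp add: n_def)
    define s :: "nat \<Rightarrow> rat fps" where
      "s a = Abs_fps (\<lambda>k. (- 1) ^ k * of_nat a ^ Suc k / of_nat c ^ Suc k)" for a
    define w where
      "w = (\<Prod>B\<in>Pow A. if even (card (A - B)) then fps_of_poly (P B) else inverse (fps_of_poly (P B)))"
    define S where "S = (\<Sum>B\<in>Pow A. if even (card (A - B)) then \<Sum>a\<in>{sum y B..<sum x B}. s a
        else - (\<Sum>a\<in>{sum y B..<sum x B}. s a))"
    have fP: "fps_of_poly (P B) $ 0 \<noteq> 0" for B using P0[of B] by (simp add: poly_0_coeff_0)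
    have "is_logderiv (fps_of_poly (P B)) (\<Sum>a\<in>{sum y B..<sum x B}. s a)" for B
      unfolding P_def fps_of_poly_prod s_def by (intro is_logderiv_prod is_logderiv_linear c0)
    then have ld: "is_logderiv w S"
      unfolding w_def S_def using is_logderiv_inverse[OF _ fP] by (intro is_logderiv_prod) auto
    have "w $ 0 = mobius_prod (\<lambda>B. fps_of_poly (P B) $ 0) A"
      unfolding w_def mobius_prod_def fps_nth_prod_0 by (intro prod.cong) auto
    also have "\<dots> = mobius_prod (\<lambda>B. \<Prod>i\<in>B. of_nat c ^ (x i - y i)) A"
      unfolding mobius_prod_def
    proof (intro prod.cong refl)
      fix B assume B: "B \<in> Pow A"
      have "fps_of_poly (P B) $ 0 = of_nat c ^ (sum x B - sum y B)"
        by (simp add: P_def flip: poly_0_coeff_0) (simp add: poly_prod)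
      also have "sum x B - sum y B = (\<Sum>i\<in>B. x i - y i)"
        using B yx by (intro sum_subtractf_nat[symmetric]) auto
      finally show "(if even (card (A - B)) then fps_of_poly (P B) $ 0 else inverse (fps_of_poly (P B) $ 0)) =
         (if even (card (A - B)) then \<Prod>i\<in>B. of_nat c ^ (x i - y i)
          else inverse (\<Prod>i\<in>B. of_nat c ^ (x i - y i)))"
        by (simp add: power_sum)
    qed
    also have "\<dots> = 1"
      using A A2 c by (intro mobius_prod_multiplicative) auto
    finally have w0: "w $ 0 = 1" .
    \<comment> \<open>Coefficient j involves power sums of exponent j + 1, polynomials of degree j +
      2 in the end points, and \<open>Suc j < n\<close> means j + 2 < card A.\<close>
    have S0: "S $ j = 0" if "Suc j < n" for j
    proof -
      have *: "(\<Sum>a\<in>{sum y B..<sum x B}. s a) $ j =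
          (- 1) ^ j / of_nat c ^ Suc j *
          ((\<Sum>a<sum x B. of_nat a ^ Suc j) - (\<Sum>a<sum y B. of_nat a ^ Suc j))" if "B \<in> Pow A" for B
      proof -
        have "sum y B \<le> sum x B" using that yx by (intro sum_mono) auto
        then have "(\<Sum>a<sum x B. of_nat a ^ Suc j :: rat) - (\<Sum>a<sum y B. of_nat a ^ Suc j) =
            (\<Sum>a\<in>{sum y B..<sum x B}. of_nat a ^ Suc j)"
          using sum_diff_nat_ivl[of 0 "sum y B" "sum x B"] by (simp add: lessThan_atLeast0)
        then show ?thesis
          by (simp only: fps_sum_nth s_def fps_nth_Abs_fps sum_distrib_left) (simp add: field_simps)
      qed
      have "S $ j = (\<Sum>B\<in>Pow A. (- 1) ^ card (A - B) * ((\<Sum>a\<in>{sum y B..<sum x B}. s a) $ j))"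
        unfolding S_def fps_sum_nth by (intro sum.cong) (auto simp: fps_sum_nth)
      also have "\<dots> = (\<Sum>B\<in>Pow A. (- 1) ^ j / of_nat c ^ Suc j *
          ((- 1) ^ card (A - B) * (\<Sum>a<sum x B. of_nat a ^ Suc j) -
           (- 1) ^ card (A - B) * (\<Sum>a<sum y B. of_nat a ^ Suc j)))"
        by (intro sum.cong refl) (simp only: * right_diff_distrib mult_ac)
      also have "\<dots> = 0"
        unfolding sum_distrib_left[symmetric] sum_subtractf
        using alternating_sum_power_sum[OF A(1), of "Suc j", where 'a = rat] that
        by (simp add: n_def)
      finally show ?thesis .
    qed
    have NP: "fps_of_poly N = w * fps_of_poly D"
    proof -
      have "w = fps_of_poly N * inverse (fps_of_poly D)"
        unfolding w_def N_def D_def fps_of_poly_prod using A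
        by (simp add: prod.If_cases inverse_prod_fps Int_def)
      moreover have "fps_of_poly D $ 0 \<noteq> 0" using D0 by (simp add: poly_0_coeff_0)
      ultimately show ?thesis by (simp add: mult.assoc inverse_mult_eq_1)
    qed
    have "coeff N k = (w * fps_of_poly D) $ k" by (simp flip: NP)
    also have "\<dots> = (\<Sum>i\<in>{0..k}. if i = 0 then coeff D k else 0)"
      unfolding fps_mult_nth
      using fps_eq_1_up_to[OF ld w0 S0] k w0 by (intro sum.cong) auto
    also have "\<dots> = coeff D k" by simp
    finally show "coeff (N - D) k = 0" by simp
  qed
  then obtain R where "N - D = monom 1 n * R" by auto
  then have "mobius_prod (\<lambda>B. \<Prod>a\<in>{sum y B..<sum x B}. alpha * of_nat a + of_nat c) A - 1 =
      (alpha ^ n * Fraction_Field.Fract R D :: rat ratfun)"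
    by (simp only: mob to_fract_mult to_fract_monom Fract_conv_to_fract divide_inverse mult.assoc)
  moreover have "is_O_alpha (alpha ^ n * Fraction_Field.Fract R D :: rat ratfun) (int n + 0)"
    using is_O_alpha_power_int[of "int n"] D0
    by (intro is_O_alpha_mult is_O_alpha_no_pole) (auto simp: no_pole_at_0_def)
  moreover have "int n = int (card A) - 1"
    using A by (simp add: n_def of_nat_diff card_gt_0_iff Suc_leI)
  ultimately show ?thesis by simp
qed

lemma mobius_prod_prod:
  fixes u :: "'t \<Rightarrow> 'i set \<Rightarrow> 'b::field"
  assumes "finite T" "finite A"
  shows "mobius_prod (\<lambda>B. \<Prod>t\<in>T. u t B) A = (\<Prod>t\<in>T. mobius_prod (u t) A)"
  using assms(1)
proof (induction T)
  case empty
  have "mobius_prod (\<lambda>B. 1 :: 'b::field) A = 1" unfolding mobius_prod_def by (rule prod.neutral) simp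
  then show ?case by simp
next
  case (insert t T)
  have "mobius_prod (\<lambda>B. \<Prod>t\<in>insert t T. u t B) A = mobius_prod (\<lambda>B. u t B * (\<Prod>t\<in>T. u t B)) A"
    unfolding prod.insert[OF insert.hyps] ..
  also have "\<dots> = mobius_prod (u t) A * (\<Prod>t\<in>T. mobius_prod (u t) A)"
    unfolding mobius_prod_mult[OF assms(2)] insert.IH ..
  also have "\<dots> = (\<Prod>t\<in>insert t T. mobius_prod (u t) A)"
    by (rule prod.insert[OF insert.hyps, symmetric])
  finally show ?case .
qed

text \<open>The cross term is of order 2 k, and 2 k \<ge> k because k \<ge> 0.\<close>

lemma is_O_alpha_prod_minus_1:
  assumes "finite T" "\<And>t. t \<in> T \<Longrightarrow> is_O_alpha (w t - 1) k" "k \<ge> 0"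
  shows "is_O_alpha (prod w T - 1) k"
  using assms(1,2)
proof (induction T)
  case (insert t T)
  have "prod w (insert t T) - 1 = (w t - 1) * (prod w T - 1) + ((w t - 1) + (prod w T - 1))"
    using insert.hyps by (simp add: algebra_simps)
  moreover have "is_O_alpha ((w t - 1) * (prod w T - 1)) (k + k)"
    using insert by (intro is_O_alpha_mult) auto
  then have "is_O_alpha ((w t - 1) * (prod w T - 1)) k"
    by (rule is_O_alpha_mono) (use assms(3) in simp)
  moreover have "is_O_alpha (w t - 1) k" "is_O_alpha (prod w T - 1) k" using insert by auto
  ultimately show ?case by (simp only: is_O_alpha_add)
qed simp

section \<open>Cumulants of hook products\<close>

lemma is_partition_add: "is_partition p \<Longrightarrow> is_partition q \<Longrightarrow> is_partition (p + q)"
  by (simp add: is_partition_def lookup_add add_mono)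

lemma is_partition_sum: "(\<And>i. i \<in> I \<Longrightarrow> is_partition (lam i)) \<Longrightarrow> is_partition (sum lam I)"
proof (induction I rule: infinite_finite_induct)
  case (insert i I)
  then show ?case using is_partition_add[of "lam i" "sum lam I"] by simp
qed (simp_all add: is_partition_def)

lemma is_partitionD: "is_partition p \<Longrightarrow> i \<le> j \<Longrightarrow> lookup p j \<le> lookup p i"
  by (simp add: is_partition_def)

lemma down_closed_nat:
  assumes "finite (S :: nat set)" "\<And>i j. j \<in> S \<Longrightarrow> i \<le> j \<Longrightarrow> i \<in> S"
  shows "S = {..<card S}"
proof (cases "S = {}")
  case False
  have "S = {..Max S}"
  proof
    show "S \<subseteq> {..Max S}" using assms(1) by auto
    show "{..Max S} \<subseteq> S" using assms(2)[OF Max_in[OF assms(1) False]] by auto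
  qed
  then have "card S = Suc (Max S)" by (metis card_atMost)
  with \<open>S = {..Max S}\<close> show ?thesis by (metis lessThan_Suc_atMost)
qed simp

lemma keys_partition: assumes "is_partition p" shows "keys p = {..<part_length p}"
  unfolding part_length_def
proof (rule down_closed_nat)
  fix i j assume "j \<in> keys p" "i \<le> j"
  then show "i \<in> keys p" using is_partitionD[OF assms, of i j] by (simp add: in_keys_iff)
qed simp

lemma lookup_partition_eq_0_iff: "is_partition p \<Longrightarrow> lookup p j = 0 \<longleftrightarrow> part_length p \<le> j"
proof -
  assume p: "is_partition p"
  have "j \<in> keys p \<longleftrightarrow> j < part_length p" unfolding keys_partition[OF p] by (rule lessThan_iff)
  then show ?thesis by (auto simp: in_keys_iff)
qed

lemma less_conjugate_iff:
  assumes "is_partition p" shows "j < lookup (conjugate p) i \<longleftrightarrow> i < lookup p j"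
proof -
  have "{j. i < lookup p j} = {..<card {j. i < lookup p j}}"
  proof (rule down_closed_nat)
    show "finite {j. i < lookup p j}"
      by (rule finite_subset[of _ "keys p"]) (auto simp: in_keys_iff)
    show "i' \<in> {j. i < lookup p j}" if "j \<in> {j. i < lookup p j}" "i' \<le> j" for i' j
      using that is_partitionD[OF assms, of i' j] by simp
  qed
  then have "j \<in> {j. i < lookup p j} \<longleftrightarrow> j < card {j. i < lookup p j}" by blast
  then show ?thesis by (simp add: conjugate.rep_eq)
qed

lemma conjugate_eq_iff:
  assumes "is_partition p" "h \<ge> 1"
  shows "lookup (conjugate p) i = h \<longleftrightarrow> lookup p h \<le> i \<and> i < lookup p (h - 1)"
proof -
  have "lookup (conjugate p) i = h \<longleftrightarrow> \<not> h < lookup (conjugate p) i \<and> h - 1 < lookup (conjugate p) i"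
    using assms(2) by linarith
  then show ?thesis by (simp only: less_conjugate_iff[OF assms(1)] not_less)
qed

text \<open>Boxes are grouped by row j and column height h. Columns of height h are those with
  \<open>lookup p h\<close> \<le> i < \<open>lookup p (h - 1)\<close>; there leg + 1 is the constant
  h - j, and the arm runs through an interval whose end points are differences of parts. Heights
  beyond the length give empty intervals, so a common bound \<open>L\<close> lets one index set
  serve several partitions.\<close>

lemma hook_alpha_eq:
  assumes p: "is_partition p" and L: "part_length p \<le> L"
  shows "hook_alpha p = (\<Prod>h\<in>{1..L}. \<Prod>j<h.
    \<Prod>a\<in>{lookup p j - lookup p (h - 1)..<lookup p j - lookup p h}. alpha * of_nat a + of_nat (h - j))"
proof -
  have "hook_alpha p = (\<Prod>(h, j, a)\<in>Sigma {1..L} (\<lambda>h. Sigma {..<h}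
      (\<lambda>j. {lookup p j - lookup p (h - 1)..<lookup p j - lookup p h})). alpha * of_nat a + of_nat (h - j))"
    unfolding hook_alpha_def
  \<comment> \<open>Box (i, j) goes to its column height, its row and its arm
    \<open>lookup p j - 1 - i\<close>, from which i is recovered.\<close>
  proof (rule prod.reindex_bij_witness[where i = "\<lambda>(h, j, a). (lookup p j - 1 - a, j)"
        and j = "\<lambda>(i, j). (lookup (conjugate p) i, j, lookup p j - 1 - i)"], goal_cases)
    case (1 s)
    then show ?case by (auto simp: diagram_def)
  next
    case (2 s)
    then obtain i j where s: "s = (i, j)" "i < lookup p j" by (auto simp: diagram_def)
    define h where "h = lookup (conjugate p) i"
    have "j < h" using less_conjugate_iff[OF p] s by (simp add: h_def)
    then have h: "lookup p h \<le> i" "i < lookup p (h - 1)" using conjugate_eq_iff[OF p, of h i] by (auto simp: h_def)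
    then have "h - 1 < part_length p" using lookup_partition_eq_0_iff[OF p, of "h - 1"] by linarith
    moreover have "lookup p (h - 1) \<le> lookup p j" using \<open>j < h\<close> by (intro is_partitionD[OF p]) simp
    ultimately show ?case using s h L \<open>j < h\<close> by (auto simp flip: h_def)
  next
    case (3 s)
    then obtain h j a where s: "s = (h, j, a)" "1 \<le> h" "h \<le> L" "j < h"
      "lookup p j - lookup p (h - 1) \<le> a" "a < lookup p j - lookup p h" by auto
    have "lookup p (h - 1) \<le> lookup p j" using s by (intro is_partitionD[OF p]) simp
    then have "lookup (conjugate p) (lookup p j - 1 - a) = h"
      using s by (subst conjugate_eq_iff[OF p]) auto
    then show ?case using s by auto
  next
    case (4 s)
    then obtain h j a where s: "s = (h, j, a)" "1 \<le> h" "h \<le> L" "j < h"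
      "lookup p j - lookup p (h - 1) \<le> a" "a < lookup p j - lookup p h" by auto
    then show ?case using lookup_partition_eq_0_iff[OF p, of j] by (auto simp: diagram_def)
  next
    case (5 s)
    then obtain i j where s: "s = (i, j)" "i < lookup p j" by (auto simp: diagram_def)
    then have "j < lookup (conjugate p) i" using less_conjugate_iff[OF p] by simp
    then have "of_nat (lookup (conjugate p) i - (j + 1)) + 1 = (of_nat (lookup (conjugate p) i - j) :: rat ratfun)"
      by (metis Suc_diff_Suc Suc_eq_plus1 add.commute of_nat_Suc)
    then show ?case using s by (simp add: arm_def leg_def add.assoc)
  qed
  also have "\<dots> = (\<Prod>h\<in>{1..L}. \<Prod>j<h.
      \<Prod>a\<in>{lookup p j - lookup p (h - 1)..<lookup p j - lookup p h}. alpha * of_nat a + of_nat (h - j))"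
    by (subst prod.Sigma[symmetric], simp, simp, intro prod.cong refl, subst prod.Sigma[symmetric]) simp_all
  finally show ?thesis .
qed

text \<open>Each factor is a linear polynomial in \<alpha> with positive constant term;
  multiplicative differences need such invertible values.\<close>

lemma hook_alpha_nonzero: "hook_alpha p \<noteq> 0"
proof -
  have split: "[:of_nat (Suc l), of_nat a:] = [:0, 1:] * [:of_nat a:] + [:of_nat l:] + ([:1:] :: rat poly)" for a l
    by simp
  have lin: "to_fract [:of_nat (Suc l), of_nat a:] = (alpha * of_nat a + of_nat l + 1 :: rat ratfun)" for a l
    unfolding split to_fract_add to_fract_mult to_fract_const_of_nat alpha_def one_pCons[symmetric] to_fract_1 ..
  have "alpha * of_nat a + of_nat l + 1 \<noteq> (0 :: rat ratfun)" for a l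
    unfolding lin[symmetric] to_fract_eq_0_iff by (simp del: of_nat_Suc)
  moreover have "prod f A \<noteq> 0" if "\<And>x. x \<in> A \<Longrightarrow> f x \<noteq> 0" for f :: "nat \<times> nat \<Rightarrow> rat ratfun" and A
    using that by (induction A rule: infinite_finite_induct) auto
  ultimately show ?thesis by (simp only: hook_alpha_def not_False_eq_True)
qed

lemma hook_alpha_0: "hook_alpha 0 = 1"
  by (simp add: hook_alpha_def diagram_def part_length_def)

lemma mobius_prod_cong: "(\<And>B. B \<subseteq> A \<Longrightarrow> u B = v B) \<Longrightarrow> mobius_prod u A = mobius_prod v A"
  unfolding mobius_prod_def by (rule prod.cong[OF refl]) (simp only: Pow_iff)

text \<open>A common bound on the lengths makes the pairs (h, j) the same for all B. The truncated
  subtractions are exact on partitions, so the end points of the intervals are sums over B.\<close>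

lemma is_O_alpha_cumulant_hook:
  fixes lam :: "'i \<Rightarrow> nat \<Rightarrow>\<^sub>0 nat"
  assumes I: "finite I" "I \<noteq> {}" and lam: "\<And>i. is_partition (lam i)"
  shows "is_O_alpha (cumulant (\<lambda>B. hook_alpha (sum lam B)) I) (int (card I) - 1)"
proof (rule is_O_alpha_cumulant[OF I])
  show "hook_alpha (sum lam {}) = 1" by (simp add: hook_alpha_0)
  show "hook_alpha (sum lam A) \<noteq> 0" for A by (rule hook_alpha_nonzero)
  fix A assume A: "A \<subseteq> I" "A \<noteq> {}"
  then have finA: "finite A" using I finite_subset by blast
  obtain L where L: "\<And>i. i \<in> A \<Longrightarrow> part_length (lam i) \<le> L"
    using finA by (metis finite_imageI finite_nat_set_iff_bounded_le imageI)
  define x y where "x = (\<lambda>(h, j) i. lookup (lam i) j - lookup (lam i) h)"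
    and "y = (\<lambda>(h, j) i. lookup (lam i) j - lookup (lam i) (h - 1))"
  define T where "T = Sigma {1..L} (\<lambda>h. {..<h::nat})"
  have "mobius_prod (\<lambda>B. hook_alpha (sum lam B)) A =
      mobius_prod (\<lambda>B. \<Prod>t\<in>T. \<Prod>a\<in>{sum (y t) B..<sum (x t) B}. alpha * of_nat a + of_nat (fst t - snd t)) A"
  proof (rule mobius_prod_cong)
    fix B assume B: "B \<subseteq> A"
    have part: "is_partition (sum lam B)" by (rule is_partition_sum[OF lam])
    then have len: "part_length (sum lam B) \<le> L"
      using L B lookup_partition_eq_0_iff[OF lam]
      by (subst lookup_partition_eq_0_iff[symmetric]) (auto simp: lookup_sum subset_iff intro!: sum.neutral)
    have T: "(\<Prod>t\<in>T. g t) = (\<Prod>h\<in>{1..L}. \<Prod>j<h. g (h, j))" for g :: "nat \<times> nat \<Rightarrow> rat ratfun"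
      unfolding T_def by (subst prod.Sigma) auto
    show "hook_alpha (sum lam B) =
        (\<Prod>t\<in>T. \<Prod>a\<in>{sum (y t) B..<sum (x t) B}. alpha * of_nat a + of_nat (fst t - snd t))"
      unfolding hook_alpha_eq[OF part len] T
    proof (intro prod.cong refl, goal_cases)
      case (1 h j)
      then have "j < h" by simp
      then show ?case
        unfolding x_def y_def lookup_sum using is_partitionD[OF lam] by (simp add: sum_subtractf_nat)
    qed auto
  qed
  also have "\<dots> = (\<Prod>t\<in>T. mobius_prod (\<lambda>B. \<Prod>a\<in>{sum (y t) B..<sum (x t) B}.
      alpha * of_nat a + of_nat (fst t - snd t)) A)"
    using finA by (intro mobius_prod_prod) (auto simp: T_def)
  finally show "is_O_alpha (mobius_prod (\<lambda>B. hook_alpha (sum lam B)) A - 1) (int (card A) - 1)"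
  proof (simp only:, intro is_O_alpha_prod_minus_1 mobius_prod_interval_prod)
    fix t i assume t: "t \<in> T"
    then show "y t i \<le> x t i" "0 < fst t - snd t"
      using is_partitionD[OF lam, of "fst t - 1" "fst t" i] by (auto simp: x_def y_def T_def)
  qed (use A finA in \<open>auto simp: T_def card_gt_0_iff Suc_le_eq\<close>)
qed

section \<open>The Laplace--Beltrami operator on coefficients\<close>

lemma poly_mapping_sum_single: "f = (\<Sum>m\<in>keys f. Poly_Mapping.single m (lookup f m))"
  for f :: "'k \<Rightarrow>\<^sub>0 'a::comm_monoid_add"
  by (rule poly_mapping_eqI) (auto simp: lookup_sum lookup_single when_def in_keys_iff)

lemma poly_mapping_additive_induct:
  assumes "\<And>m c. P (Poly_Mapping.single m c)" "\<And>f g. P f \<Longrightarrow> P g \<Longrightarrow> P (f + g)"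
  shows "P (f :: 'k \<Rightarrow>\<^sub>0 'a::comm_monoid_add)"
proof -
  have "P (\<Sum>m\<in>A. Poly_Mapping.single m (lookup f m))" if "finite A" for A
    using that
  proof (induction A)
    case empty
    then show ?case using assms(1)[of undefined 0] by simp
  qed (simp add: assms)
  from this[OF finite_keys] show ?thesis
    by (rule ssubst[where P = P, OF poly_mapping_sum_single])
qed

text \<open>The Euler operator x_i d/dx_i, diagonal on monomials. Both parts of the
  Laplace--Beltrami operator reduce to it: x_i^2 d/dx_i is x_i theta_i, and x_i^2 times the second
  derivative is theta_i^2 - theta_i.\<close>

lift_definition theta :: "nat \<Rightarrow> 'a::comm_ring_1 mpoly \<Rightarrow> 'a mpoly" is
  "\<lambda>i f m. of_nat (lookup m i) * f m"
  by (rule finite_subset[rotated]) auto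

lemma theta_single: "theta i (Poly_Mapping.single m c) = Poly_Mapping.single m (of_nat (lookup m i) * c)"
  by (rule poly_mapping_eqI) (simp add: theta.rep_eq lookup_single when_def)

lemma theta_add: "theta i (f + g) = theta i f + theta i g"
  by (rule poly_mapping_eqI) (simp add: theta.rep_eq lookup_add ring_distribs)

lemma derivation_theta: "derivation (theta i :: 'a::comm_ring_1 mpoly \<Rightarrow> _)"
  unfolding derivation_def
proof (intro conjI allI)
  fix f g :: "'a mpoly"
  show "theta i (f * g) = theta i f * g + f * theta i g"
  proof (induction f rule: poly_mapping_additive_induct)
    case (1 m c)
    show ?case
    proof (induction g rule: poly_mapping_additive_induct)
      case (1 n d)
      show ?case
        by (simp add: theta_single mult_single lookup_add algebra_simps flip: single_add)
    next
      case (2 g h)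
      then show ?case by (simp add: theta_add algebra_simps)
    qed
  next
    case (2 g h)
    then show ?case by (simp add: theta_add algebra_simps)
  qed
qed (rule theta_add)

lemma theta_eq_sum:
  "theta i f = (\<Sum>m\<in>keys f. Poly_Mapping.single m (of_nat (lookup m i) * lookup f m))"
  by (rule poly_mapping_eqI)
    (auto simp: lookup_sum lookup_single theta.rep_eq when_def in_keys_iff)

lemma mvar_mult_partial_deriv: "mvar i * partial_deriv i f = theta i f"
  unfolding partial_deriv_def theta_eq_sum sum_distrib_left
proof (intro sum.cong refl)
  fix m assume "m \<in> keys f"
  show "mvar i * Poly_Mapping.single (m - Poly_Mapping.single i 1) (of_nat (lookup m i) * lookup f m) =
      Poly_Mapping.single m (of_nat (lookup m i) * lookup f m)"
  proof (cases "lookup m i = 0")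
    case False
    then have "Poly_Mapping.single i 1 + (m - Poly_Mapping.single i 1) = m"
      by (intro poly_mapping_eqI) (auto simp: lookup_add lookup_minus lookup_single when_def)
    then show ?thesis by (simp add: mvar_def mult_single)
  qed simp
qed

lemma theta_mvar: "theta i (mvar i) = mvar i"
  by (simp add: mvar_def theta_single)

lemma mvar_power2_mult_partial_deriv2:
  "mvar i ^ 2 * partial_deriv i (partial_deriv i f) = theta i (theta i f) - theta i f"
proof -
  have "theta i (theta i f) = theta i (mvar i * partial_deriv i f)"
    by (simp only: mvar_mult_partial_deriv)
  also have "\<dots> = theta i f + mvar i * theta i (partial_deriv i f)"
    by (subst derivation_mult[OF derivation_theta]) (simp only: theta_mvar mvar_mult_partial_deriv)
  also have "theta i (partial_deriv i f) = mvar i * partial_deriv i (partial_deriv i f)"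
    by (simp only: mvar_mult_partial_deriv)
  finally show ?thesis by (simp add: power2_eq_square mult.assoc)
qed

lemma lookup_single_mult:
  "lookup (Poly_Mapping.single a c * g) (a + m) = c * lookup (g :: 'a::comm_ring_1 mpoly) m"
  by (induction g rule: poly_mapping_additive_induct)
    (auto simp: mult_single lookup_single when_def lookup_add ring_distribs)

lemma lookup_mvar_mult:
  "lookup (mvar i * g) m = (if lookup m i = 0 then 0 else lookup (g :: 'a::comm_ring_1 mpoly) (m - Poly_Mapping.single i 1))"
proof (cases "lookup m i = 0")
  case True
  have "m \<notin> keys (mvar i * g)"
  proof
    assume "m \<in> keys (mvar i * g)"
    then obtain n where "m = Poly_Mapping.single i 1 + n"
      using subsetD[OF keys_mult] by (fastforce simp: mvar_def)
    with True show False by (simp add: lookup_add)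
  qed
  then show ?thesis using True by (simp add: in_keys_iff)
next
  case False
  then have "m = Poly_Mapping.single i 1 + (m - Poly_Mapping.single i 1)"
    by (intro poly_mapping_eqI) (auto simp: lookup_add lookup_minus lookup_single when_def)
  then show ?thesis using False lookup_single_mult[of "Poly_Mapping.single i 1" 1 g "m - Poly_Mapping.single i 1"]
    by (simp add: mvar_def)
qed

section \<open>Division by differences of variables and the first-order operator\<close>

lemma mvar_eq_iff: "mvar i = (mvar j :: 'a::comm_ring_1 mpoly) \<longleftrightarrow> i = j"
proof
  assume "mvar i = (mvar j :: 'a mpoly)"
  then have "keys (mvar i :: 'a mpoly) = keys (mvar j :: 'a mpoly)" by simp
  then have "keys (Poly_Mapping.single i (1 :: nat)) = keys (Poly_Mapping.single j (1 :: nat))"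
    by (simp add: mvar_def)
  then show "i = j" by simp
qed simp

text \<open>The truncated subtraction is exact for \<open>k \<le> lookup m j\<close>.\<close>

definition shift :: "nat \<Rightarrow> nat \<Rightarrow> nat \<Rightarrow> (nat \<Rightarrow>\<^sub>0 nat) \<Rightarrow> nat \<Rightarrow>\<^sub>0 nat" where
  "shift i j k m = m + Poly_Mapping.single i k - Poly_Mapping.single j k"

lemma lookup_shift:
  assumes "i \<noteq> j"
  shows "lookup (shift i j k m) a =
    (if a = i then lookup m i + k else if a = j then lookup m j - k else lookup m a)"
  using assms by (simp add: shift_def lookup_add lookup_minus lookup_single when_def)

text \<open>The quotient is written down as a sum of coefficients of H along a string of shifts. In
  the product with x_i - x_j two such sums differ by their first term, which is the coefficient of H
  at m; at the boundary, where x_i does not occur in m, the whole string sums to 0.\<close>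

lemma antisymmetric_divisible:
  fixes H :: "'a::field_char_0 mpoly"
  assumes ij: "i \<noteq> j"
    and anti: "\<And>m. lookup H (Poly_Mapping.map_key (Transposition.transpose i j) m) = - lookup H m"
  shows "\<exists>G. (mvar i - mvar j) * G = H \<and>
    (\<forall>m. lookup G m = (\<Sum>k\<le>lookup m j. lookup H (shift i j k (m + Poly_Mapping.single i 1))))"
proof -
  let ?g = "\<lambda>m. \<Sum>k\<le>lookup m j. lookup H (shift i j k (m + Poly_Mapping.single i 1))"
  have "finite {m. ?g m \<noteq> 0}"
  proof (rule finite_subset)
    \<comment> \<open>The exponent m is recovered from k and the shifted exponent h in the support
      of H, and \<open>lookup h i = lookup m i + 1 + k\<close> bounds k.\<close>
    show "{m. ?g m \<noteq> 0} \<subseteq> (\<lambda>(h, k). h + Poly_Mapping.single j k - Poly_Mapping.single i (Suc k)) `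
        Sigma (keys H) (\<lambda>h. {..lookup h i})"
    proof
      fix m assume "m \<in> {m. ?g m \<noteq> 0}"
      then obtain k where k: "k \<le> lookup m j" "lookup H (shift i j k (m + Poly_Mapping.single i 1)) \<noteq> 0"
        by (auto elim!: sum.not_neutral_contains_not_neutral)
      let ?h = "shift i j k (m + Poly_Mapping.single i 1)"
      have "?h \<in> keys H" using k by (simp add: in_keys_iff)
      moreover have "k \<le> lookup ?h i" using ij by (simp add: lookup_shift)
      moreover have "m = ?h + Poly_Mapping.single j k - Poly_Mapping.single i (Suc k)"
        using k ij by (intro poly_mapping_eqI)
          (auto simp: lookup_add lookup_minus lookup_shift lookup_single when_def)
      ultimately show "m \<in> (\<lambda>(h, k). h + Poly_Mapping.single j k - Poly_Mapping.single i (Suc k)) `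
        Sigma (keys H) (\<lambda>h. {..lookup h i})"
        by (intro image_eqI[of _ _ "(?h, k)"]) auto
    qed
  qed auto
  then have "lookup (Abs_poly_mapping ?g) = ?g" by (rule lookup_Abs_poly_mapping)
  then obtain G where "lookup G = ?g" by blast
  then have G: "lookup G m = ?g m" for m by (rule fun_cong)
  have "(mvar i - mvar j) * G = H"
  proof (rule poly_mapping_eqI)
    fix m
    let ?S = "\<lambda>k. lookup H (shift i j k m)"
    have i: "lookup (mvar i * G) m = (\<Sum>k\<le>lookup m j. ?S k)" if "lookup m i \<noteq> 0"
    proof -
      have 1: "m - Poly_Mapping.single i 1 + Poly_Mapping.single i 1 = m"
        using that by (intro poly_mapping_eqI) (auto simp: lookup_add lookup_minus lookup_single when_def)
      have 2: "lookup (m - Poly_Mapping.single i 1) j = lookup m j"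
        using ij by (simp add: lookup_minus lookup_single)
      show ?thesis using that by (simp only: lookup_mvar_mult G 1 2 if_False)
    qed
    have j: "lookup (mvar j * G) m = (\<Sum>k\<le>lookup m j. ?S k) - ?S 0"
    proof (cases "lookup m j")
      case 0
      then show ?thesis by (simp add: lookup_mvar_mult)
    next
      case (Suc n)
      have 1: "shift i j k (m - Poly_Mapping.single j 1 + Poly_Mapping.single i 1) = shift i j (Suc k) m" for k
        using Suc ij by (intro poly_mapping_eqI)
          (auto simp: lookup_add lookup_minus lookup_shift lookup_single when_def)
      have 2: "lookup (m - Poly_Mapping.single j 1) j = n"
        using Suc by (simp add: lookup_minus lookup_single)
      have "lookup (mvar j * G) m = (\<Sum>k\<le>n. ?S (Suc k))"
        using Suc by (simp only: lookup_mvar_mult G 1 2 nat.distinct if_False)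
      then show ?thesis
        unfolding Suc by (subst sum.atMost_Suc_shift) simp
    qed
    \<comment> \<open>The transposition reverses the string, taking k to
      \<open>lookup m j - k\<close>, so by antisymmetry the sum equals its own negative.\<close>
    have z: "(\<Sum>k\<le>lookup m j. ?S k) = 0" if "lookup m i = 0"
    proof -
      have "Poly_Mapping.map_key (Transposition.transpose i j) (shift i j k m) = shift i j (lookup m j - k) m"
        if "k \<le> lookup m j" for k
        using that \<open>lookup m i = 0\<close> ij by (intro poly_mapping_eqI)
          (auto simp: lookup_map_key_inj lookup_shift Transposition.transpose_def inj_on_def)
      then have "?S (lookup m j - k) = - ?S k" if "k \<le> lookup m j" for k
        using that anti by metis
      then have "(\<Sum>k\<le>lookup m j. ?S (lookup m j - k)) = - (\<Sum>k\<le>lookup m j. ?S k)"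
        by (simp add: sum_negf)
      moreover have "(\<Sum>k\<le>lookup m j. ?S (lookup m j - k)) = (\<Sum>k\<le>lookup m j. ?S k)"
        by (rule sum.reindex_bij_witness[where i = "\<lambda>k. lookup m j - k" and j = "\<lambda>k. lookup m j - k"]) auto
      ultimately show ?thesis by simp
    qed
    have "shift i j 0 m = m" by (simp add: shift_def)
    then show "lookup ((mvar i - mvar j) * G) m = lookup H m"
      using i j z by (cases "lookup m i = 0") (simp_all add: left_diff_distrib lookup_minus lookup_mvar_mult[of i])
  qed
  then show ?thesis using G by blast
qed

lemma sum_pairs_lessThan:
  fixes g :: "nat \<Rightarrow> nat \<Rightarrow> 'a::comm_monoid_add"
  shows "(\<Sum>i<N. \<Sum>j\<in>{..<N} - {i}. g i j) = (\<Sum>j<N. \<Sum>i<j. g i j + g j i)"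
proof (induction N)
  case (Suc N)
  have "(\<Sum>j\<in>{..<Suc N} - {i}. g i j) = (\<Sum>j\<in>{..<N} - {i}. g i j) + g i N" if "i < N" for i
  proof -
    have "{..<Suc N} - {i} = insert N ({..<N} - {i})" using that by auto
    then show ?thesis by (simp add: add.commute)
  qed
  moreover have "{..<Suc N} - {N} = {..<N}" by auto
  ultimately have "(\<Sum>i<Suc N. \<Sum>j\<in>{..<Suc N} - {i}. g i j) =
      (\<Sum>i<N. (\<Sum>j\<in>{..<N} - {i}. g i j) + g i N) + (\<Sum>j<N. g N j)"
    by simp
  also have "\<dots> = (\<Sum>j<Suc N. \<Sum>i<j. g i j + g j i)"
    by (simp add: sum.distrib Suc add_ac)
  finally show ?case .
qed simp

text \<open>Along the string of shifts, the coefficient of f at \<open>shift i j k m\<close> with k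
  > 0 occurs twice: with m_i + k from theta_i and with - (m_j - k) from theta_j. For k = 0 it occurs
  once, with m_i.\<close>

lemma D1_pair:
  fixes f :: "'a::field_char_0 mpoly"
  assumes ij: "i \<noteq> j"
    and sym: "\<And>m. lookup f (Poly_Mapping.map_key (Transposition.transpose i j) m) = lookup f m"
  shows "\<exists>G. (mvar i - mvar j) * G = mvar i * theta i f - mvar j * theta j f \<and>
    (\<forall>m. lookup G m = of_nat (lookup m i) * lookup f m +
      (\<Sum>k\<in>{1..lookup m j}. (of_nat (lookup m i + 2 * k) - of_nat (lookup m j)) * lookup f (shift i j k m)))"
proof -
  let ?H = "mvar i * theta i f - mvar j * theta j f"
  let ?t = "Poly_Mapping.map_key (Transposition.transpose i j) :: (nat \<Rightarrow>\<^sub>0 nat) \<Rightarrow> _"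
  have t: "lookup (?t m) a = lookup m (Transposition.transpose i j a)" for m a
    by (simp add: lookup_map_key_inj)
  have H: "lookup ?H m =
    (if lookup m i = 0 then 0 else of_nat (lookup m i - 1) * lookup f (m - Poly_Mapping.single i 1)) -
    (if lookup m j = 0 then 0 else of_nat (lookup m j - 1) * lookup f (m - Poly_Mapping.single j 1))" for m
    by (simp add: lookup_minus lookup_mvar_mult theta.rep_eq lookup_single)
  have "?t m - Poly_Mapping.single i 1 = ?t (m - Poly_Mapping.single j 1)"
    "?t m - Poly_Mapping.single j 1 = ?t (m - Poly_Mapping.single i 1)" for m
    using ij by (intro poly_mapping_eqI;
        auto simp: t lookup_minus lookup_single when_def Transposition.transpose_def)+
  then have "lookup ?H (?t m) = - lookup ?H m" for m
    by (simp only: H sym) (simp add: t)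
  from antisymmetric_divisible[OF ij this] obtain G where
    G: "(mvar i - mvar j) * G = ?H"
    "\<And>m. lookup G m = (\<Sum>k\<le>lookup m j. lookup ?H (shift i j k (m + Poly_Mapping.single i 1)))"
    by blast
  have "lookup G m = of_nat (lookup m i) * lookup f m +
      (\<Sum>k\<in>{1..lookup m j}. (of_nat (lookup m i + 2 * k) - of_nat (lookup m j)) * lookup f (shift i j k m))"
    for m
  proof -
    let ?c = "\<lambda>k. lookup f (shift i j k m)" and ?a = "lookup m i" and ?b = "lookup m j"
    have 1: "shift i j k (m + Poly_Mapping.single i 1) - Poly_Mapping.single i 1 = shift i j k m" for k
      using ij by (intro poly_mapping_eqI)
        (auto simp: lookup_minus lookup_add lookup_shift lookup_single when_def)
    have 2: "shift i j k (m + Poly_Mapping.single i 1) - Poly_Mapping.single j 1 = shift i j (Suc k) m" for k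
      using ij by (intro poly_mapping_eqI)
        (auto simp: lookup_minus lookup_add lookup_shift lookup_single when_def)
    have 3: "lookup (shift i j k (m + Poly_Mapping.single i 1)) i = ?a + Suc k"
      "lookup (shift i j k (m + Poly_Mapping.single i 1)) j = ?b - k" for k
      using ij by (auto simp: lookup_shift lookup_add lookup_single)
    have "lookup G m = (\<Sum>k\<le>?b. of_nat (?a + k) * ?c k -
        (if ?b - k = 0 then 0 else of_nat (?b - k - 1) * ?c (Suc k)))"
      unfolding G(2) H 1 2 3 by (intro sum.cong refl) simp
    also have "\<dots> = (\<Sum>k\<le>?b. of_nat (?a + k) * ?c k) -
        (\<Sum>k\<le>?b. if ?b - k = 0 then 0 else of_nat (?b - k - 1) * ?c (Suc k))"
      by (rule sum_subtractf)
    also have "(\<Sum>k\<le>?b. if ?b - k = 0 then 0 else of_nat (?b - k - 1) * ?c (Suc k)) =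
        (\<Sum>k<?b. of_nat (?b - Suc k) * ?c (Suc k))"
      by (rule sum.mono_neutral_cong_right) auto
    also have "\<dots> = (\<Sum>k\<in>{1..?b}. of_nat (?b - k) * ?c k)"
      by (rule sum.reindex_bij_witness[where i = "\<lambda>k. k - 1" and j = Suc]) auto
    also have "(\<Sum>k\<le>?b. of_nat (?a + k) * ?c k) =
        of_nat ?a * lookup f m + (\<Sum>k\<in>{1..?b}. of_nat (?a + k) * ?c k)"
    proof -
      have "{..?b} = insert 0 {1..?b}" by auto
      then show ?thesis by (simp add: shift_def)
    qed
    also have "of_nat ?a * lookup f m + (\<Sum>k\<in>{1..?b}. of_nat (?a + k) * ?c k) -
        (\<Sum>k\<in>{1..?b}. of_nat (?b - k) * ?c k) = of_nat ?a * lookup f m +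
        (\<Sum>k\<in>{1..?b}. of_nat (?a + k) * ?c k - of_nat (?b - k) * ?c k)"
      by (simp add: sum_subtractf)
    also have "(\<Sum>k\<in>{1..?b}. of_nat (?a + k) * ?c k - of_nat (?b - k) * ?c k) =
        (\<Sum>k\<in>{1..?b}. (of_nat (?a + 2 * k) - of_nat ?b) * ?c k)"
      by (intro sum.cong refl) (simp add: of_nat_diff algebra_simps)
    finally show ?thesis .
  qed
  with G(1) show ?thesis by blast
qed

text \<open>Non-diagonal part of the first-order operator. Only pairs i < j occur, so k units always
  move to an earlier position, which is upwards in the dominance order.\<close>

definition offdiag :: "nat \<Rightarrow> 'a::comm_ring_1 mpoly \<Rightarrow> (nat \<Rightarrow>\<^sub>0 nat) \<Rightarrow> 'a" where
  "offdiag N f m = (\<Sum>j<N. \<Sum>i<j. \<Sum>k\<in>{1..lookup m j}.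
     (of_nat (lookup m i + 2 * k) - of_nat (lookup m j)) * lookup f (shift i j k m))"

lemma D1_term:
  assumes "i \<noteq> j"
  shows "Fraction_Field.Fract (mvar i ^ 2) (mvar i - mvar j) * to_fract (partial_deriv i f) =
    to_fract (mvar i * theta i f) / to_fract (mvar i - mvar j)"
proof -
  have "mvar i ^ 2 * partial_deriv i f = mvar i * theta i f"
    by (simp add: power2_eq_square mult.assoc mvar_mult_partial_deriv)
  then show ?thesis by (simp add: Fract_conv_to_fract flip: to_fract_mult)
qed

lemma shift_map_key:
  assumes "bij \<sigma>" "i \<noteq> j"
  shows "shift i j k (Poly_Mapping.map_key \<sigma> m) = Poly_Mapping.map_key \<sigma> (shift (\<sigma> i) (\<sigma> j) k m)"
proof -
  have inj: "inj \<sigma>" using assms(1) by (rule bij_is_inj)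
  then have "\<sigma> i \<noteq> \<sigma> j" using assms(2) by (simp add: inj_eq)
  then show ?thesis using assms(2)
    by (intro poly_mapping_eqI) (auto simp: lookup_shift lookup_map_key_inj inj inj_eq)
qed

text \<open>The summands for (i, j) and (j, i) combine to a polynomial. Symmetry of the result is
  invisible in a sum over i < j; it appears when twice the coefficient is written as a sum over all
  ordered pairs.\<close>

lemma D1_sym_poly:
  fixes f :: "'a::field_char_0 mpoly"
  assumes f: "is_sym_poly N f"
  shows "\<exists>P. D1 N f = to_fract P \<and> is_sym_poly N P \<and>
    (\<forall>m. lookup P m = (\<Sum>j<N. \<Sum>i<j. of_nat (lookup m i)) * lookup f m + offdiag N f m)"
proof -
  define g where "g i j m = of_nat (lookup m i) * lookup f m +
      (\<Sum>k\<in>{1..lookup m j}. (of_nat (lookup m i + 2 * k) - of_nat (lookup m j)) * lookup f (shift i j k m))"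
    for i j m
  let ?P = "\<lambda>i j G. (mvar i - mvar j) * G = mvar i * theta i f - mvar j * theta j f \<and>
    (\<forall>m. lookup G m = g i j m)"
  have ex: "\<exists>G. ?P i j G" if "i \<noteq> j" "i < N" "j < N" for i j
    unfolding g_def
  proof (rule D1_pair)
    have "Transposition.transpose i j permutes {..<N}" using that by (intro permutes_swap_id) auto
    then show "lookup f (Poly_Mapping.map_key (Transposition.transpose i j) m) = lookup f m" for m
      using f by (simp add: is_sym_poly_def)
  qed (use that in simp)
  define G where "G i j = (SOME G. ?P i j G)" for i j
  have "?P i j (G i j)" if "i \<noteq> j" "i < N" "j < N" for i j
    unfolding G_def by (rule someI_ex[OF ex[OF that]])
  then have G: "\<And>i j. i \<noteq> j \<Longrightarrow> i < N \<Longrightarrow> j < N \<Longrightarrow>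
      (mvar i - mvar j) * G i j = mvar i * theta i f - mvar j * theta j f"
    "\<And>i j m. i \<noteq> j \<Longrightarrow> i < N \<Longrightarrow> j < N \<Longrightarrow> lookup (G i j) m = g i j m"
    by blast+
  define P where "P = (\<Sum>j<N. \<Sum>i<j. G i j)"
  have "D1 N f = (\<Sum>i<N. \<Sum>j\<in>{..<N} - {i}. to_fract (mvar i * theta i f) / to_fract (mvar i - mvar j))"
    unfolding D1_def by (intro sum.cong refl D1_term) auto
  also have "\<dots> = (\<Sum>j<N. \<Sum>i<j. to_fract (mvar i * theta i f) / to_fract (mvar i - mvar j) +
      to_fract (mvar j * theta j f) / to_fract (mvar j - mvar i))"
    by (rule sum_pairs_lessThan)
  also have "\<dots> = (\<Sum>j<N. \<Sum>i<j. to_fract (G i j))"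
  proof (intro sum.cong refl)
    fix j i assume *: "j \<in> {..<N}" "i \<in> {..<j}"
    define d where "d = (to_fract (mvar i - mvar j) :: 'a mpoly fract)"
    have "d \<noteq> 0" using * by (auto simp: d_def mvar_eq_iff simp del: to_fract_diff)
    have neg: "to_fract (mvar j - mvar i) = - d" by (simp add: d_def)
    have "to_fract (mvar i * theta i f) - to_fract (mvar j * theta j f) = d * to_fract (G i j)"
      using G(1)[of i j] * by (simp add: d_def del: to_fract_diff to_fract_mult flip: to_fract_diff to_fract_mult)
    then have "to_fract (mvar i * theta i f) / d + to_fract (mvar j * theta j f) / (- d) = to_fract (G i j)"
      using \<open>d \<noteq> 0\<close> by (simp add: nonzero_divide_eq_eq mult.commute[of d] flip: diff_divide_distrib del: to_fract_mult)
    then show "to_fract (mvar i * theta i f) / to_fract (mvar i - mvar j) +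
      to_fract (mvar j * theta j f) / to_fract (mvar j - mvar i) = to_fract (G i j)"
      unfolding neg d_def[symmetric] .
  qed
  also have "\<dots> = to_fract P" by (simp add: P_def)
  finally have D1: "D1 N f = to_fract P" .
  have P: "lookup P m = (\<Sum>j<N. \<Sum>i<j. g i j m)" for m
    unfolding P_def lookup_sum by (intro sum.cong refl) (simp add: G(2))
  \<comment> \<open>The formula for \<open>g\<close> is not symmetric in i and j; the equality comes
    from uniqueness of the quotient by x_i - x_j.\<close>
  have g_commute: "g i j m = g j i m" if "i \<noteq> j" "i < N" "j < N" for i j m
  proof -
    have "(mvar i - mvar j) * (G i j - G j i) = (mvar i - mvar j) * G i j + (mvar j - mvar i) * G j i"
      by (simp add: algebra_simps)
    also have "\<dots> = 0"
      unfolding G(1)[OF that] G(1)[OF that(1)[symmetric] that(3,2)] by simp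
    finally have "(mvar i - mvar j) * (G i j - G j i) = 0" .
    then have "G i j = G j i" using that by (simp add: mvar_eq_iff)
    then show ?thesis using G(2)[of i j m] G(2)[of j i m] that by simp
  qed
  have P2: "2 * lookup P m = (\<Sum>i<N. \<Sum>j\<in>{..<N} - {i}. g i j m)" for m
  proof -
    have "(\<Sum>i<N. \<Sum>j\<in>{..<N} - {i}. g i j m) = (\<Sum>j<N. \<Sum>i<j. g i j m + g j i m)"
      by (rule sum_pairs_lessThan)
    also have "\<dots> = (\<Sum>j<N. \<Sum>i<j. 2 * g i j m)"
    proof (intro sum.cong refl)
      fix j i assume "j \<in> {..<N}" "i \<in> {..<j}"
      then show "g i j m + g j i m = 2 * g i j m" using g_commute[of j i m] by simp
    qed
    finally show ?thesis by (simp add: P sum_distrib_left)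
  qed
  have "is_sym_poly N P"
    unfolding is_sym_poly_def
  proof (intro conjI ballI allI impI)
    fix m assume "m \<in> keys P"
    then obtain i j where ij: "j < N" "i < j" "g i j m \<noteq> 0"
      unfolding in_keys_iff P by (metis (no_types, lifting) lessThan_iff sum.neutral)
    obtain k where "lookup f (shift i j k m) \<noteq> 0" "k \<le> lookup m j"
    proof (cases "lookup f m = 0")
      case True
      then have "(\<Sum>k\<in>{1..lookup m j}. (of_nat (lookup m i + 2 * k) - of_nat (lookup m j)) * lookup f (shift i j k m)) \<noteq> 0"
        using ij by (simp add: g_def)
      then obtain k where "k \<in> {1..lookup m j}" "lookup f (shift i j k m) \<noteq> 0"
        by (metis (no_types, lifting) mult_zero_right sum.neutral)
      then show ?thesis by (intro that) auto
    next
      case False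
      then show ?thesis by (intro that[of 0]) (simp_all add: shift_def)
    qed
    then have "keys (shift i j k m) \<subseteq> {..<N}" using f by (auto simp: is_sym_poly_def in_keys_iff)
    then have "lookup (shift i j k m) a = 0" if "a \<ge> N" for a
      using that by (meson in_keys_iff lessThan_iff not_less subsetD)
    then have "lookup m a = 0" if "a \<ge> N" for a
      using that ij by (fastforce simp: lookup_shift split: if_splits)
    then show "keys m \<subseteq> {..<N}" by (force simp: in_keys_iff not_less[symmetric])
  next
    fix \<sigma> m assume \<sigma>: "\<sigma> permutes {..<N}"
    have bij: "bij \<sigma>" and inj: "inj \<sigma>" using \<sigma> by (auto simp: permutes_bij permutes_inj)
    have f\<sigma>: "lookup f (Poly_Mapping.map_key \<sigma> n) = lookup f n" for n
      using f \<sigma> by (simp add: is_sym_poly_def)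
    have "g i j (Poly_Mapping.map_key \<sigma> m) = g (\<sigma> i) (\<sigma> j) m" if "i \<noteq> j" for i j
      unfolding g_def lookup_map_key_inj[OF inj] f\<sigma> shift_map_key[OF bij that] ..
    then have "2 * lookup P (Poly_Mapping.map_key \<sigma> m) = (\<Sum>i<N. \<Sum>j\<in>{..<N} - {i}. g (\<sigma> i) (\<sigma> j) m)"
      unfolding P2 by (intro sum.cong refl) auto
    also have "\<dots> = (\<Sum>i<N. \<Sum>j\<in>{..<N} - {\<sigma> i}. g (\<sigma> i) j m)"
    proof (rule sum.cong[OF refl])
      fix i
      have "bij_betw \<sigma> ({..<N} - {i}) ({..<N} - {\<sigma> i})"
        using permutes_imp_bij[OF \<sigma>] inj by (auto simp: bij_betw_def image_set_diff inj_on_def)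
      then show "(\<Sum>j\<in>{..<N} - {i}. g (\<sigma> i) (\<sigma> j) m) = (\<Sum>j\<in>{..<N} - {\<sigma> i}. g (\<sigma> i) j m)"
        by (rule sum.reindex_bij_betw)
    qed
    also have "\<dots> = 2 * lookup P m"
      unfolding P2 by (rule sum.reindex_bij_betw[OF permutes_imp_bij[OF \<sigma>]])
    finally show "lookup P (Poly_Mapping.map_key \<sigma> m) = lookup P m" by simp
  qed
  moreover have "lookup P m = (\<Sum>j<N. \<Sum>i<j. of_nat (lookup m i)) * lookup f m + offdiag N f m" for m
    unfolding P offdiag_def g_def sum_distrib_right sum.distrib[symmetric] ..
  ultimately show ?thesis using D1 by blast
qed

section \<open>The second-order operator and the diagonal entries\<close>

lemma lookup_mconst_mult: "lookup (mconst c * f) m = c * lookup (f :: 'a::comm_ring_1 mpoly) m"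
  using lookup_single_mult[of 0 c f m] by (simp add: mconst_def)

lemma D2_eq: "D2 N f = to_fract (mconst (1 / 2) * (\<Sum>i<N. theta i (theta i f) - theta i f))"
  by (simp add: D2_def mvar_power2_mult_partial_deriv2)

lemma two_b_stat:
  assumes "keys m \<subseteq> {..<N}"
  shows "2 * of_nat (b_stat m) = (\<Sum>j<N. of_nat (lookup m j) * of_nat (lookup m j) - of_nat (lookup m j) :: 'a::comm_ring_1)"
proof -
  have c: "2 * of_nat (n choose 2) = (of_nat n * of_nat n - of_nat n :: 'a)" for n
  proof -
    have "even (n * (n - 1))" by (cases n) auto
    then have "2 * (n choose 2) = n * (n - 1)" unfolding choose_two by (rule dvd_mult_div_cancel)
    then have "(of_nat (2 * (n choose 2)) :: 'a) = of_nat (n * (n - 1))" by (simp only:)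
    then show ?thesis by (cases n) (simp_all add: algebra_simps)
  qed
  have b: "b_stat m = (\<Sum>j<N. lookup m j choose 2)"
    unfolding b_stat_def by (rule sum.mono_neutral_left) (use assms in \<open>auto simp: in_keys_iff\<close>)
  show ?thesis unfolding b of_nat_sum sum_distrib_left c ..
qed

lemma lookup_D2:
  fixes f :: "'a::field_char_0 mpoly"
  assumes "keys m \<subseteq> {..<N}"
  shows "lookup (mconst (1 / 2) * (\<Sum>i<N. theta i (theta i f) - theta i f)) m = of_nat (b_stat m) * lookup f m"
proof -
  have "lookup (mconst (1 / 2) * (\<Sum>i<N. theta i (theta i f) - theta i f)) m =
      1 / 2 * ((\<Sum>i<N. of_nat (lookup m i) * of_nat (lookup m i) - of_nat (lookup m i)) * lookup f m)"
    unfolding lookup_mconst_mult lookup_sum lookup_minus theta.rep_eq sum_distrib_right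
    by (simp add: algebra_simps)
  then show ?thesis unfolding two_b_stat[OF assms, symmetric] by simp
qed

text \<open>The statistic usually written n(\<lambda>), the sum of (i - 1) \<lambda>_i. For
  partitions it is b of the conjugate; this form also gives the diagonal entries at unsorted
  exponents.\<close>

definition n_stat :: "(nat \<Rightarrow>\<^sub>0 nat) \<Rightarrow> nat" where
  "n_stat m = (\<Sum>i\<in>keys m. i * lookup m i)"

lemma n_stat_superset: "finite A \<Longrightarrow> keys m \<subseteq> A \<Longrightarrow> n_stat m = (\<Sum>i\<in>A. i * lookup m i)"
  unfolding n_stat_def by (rule sum.mono_neutral_left) (auto simp: in_keys_iff)

lemma sum_lookup_pairs:
  assumes "keys m \<subseteq> {..<N}"
  shows "(\<Sum>j<N. \<Sum>i<j. of_nat (lookup m i)) = (of_nat N - 1) * of_nat (weight m) - (of_nat (n_stat m) :: 'a::comm_ring_1)"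
proof -
  have "(\<Sum>j<N. \<Sum>i<j. of_nat (lookup m i)) = (of_nat N - 1) * (\<Sum>i<N. of_nat (lookup m i)) - (\<Sum>i<N. of_nat i * of_nat (lookup m i) :: 'a)"
    by (induction N) (simp_all add: algebra_simps)
  then show ?thesis
    using weight_superset[of "{..<N}" m] n_stat_superset[of "{..<N}" m] assms by simp
qed

lemma is_sym_poly_scaled:
  fixes f g :: "'a::comm_ring_1 mpoly"
  assumes f: "is_sym_poly N f" and g: "\<And>m. lookup g m = c m * lookup f m"
    and c: "\<And>\<sigma> m. bij \<sigma> \<Longrightarrow> c (Poly_Mapping.map_key \<sigma> m) = c m"
  shows "is_sym_poly N g"
  unfolding is_sym_poly_def
proof (intro conjI ballI allI impI)
  fix m assume "m \<in> keys g"
  then have "m \<in> keys f" by (auto simp: in_keys_iff g)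
  then show "keys m \<subseteq> {..<N}" using f by (simp add: is_sym_poly_def)
next
  fix \<sigma> m assume "\<sigma> permutes {..<N}"
  then show "lookup g (Poly_Mapping.map_key \<sigma> m) = lookup g m"
    using f by (simp add: g c permutes_bij is_sym_poly_def)
qed

lemma is_sym_poly_mconst_mult:
  "is_sym_poly N f \<Longrightarrow> is_sym_poly N (mconst c * f :: 'a::comm_ring_1 mpoly)"
  by (rule is_sym_poly_scaled[of N f _ "\<lambda>_. c"]) (simp_all add: lookup_mconst_mult)

lemma b_stat_map_key:
  assumes "bij \<sigma>" shows "b_stat (Poly_Mapping.map_key \<sigma> p) = b_stat p"
proof -
  have "bij_betw \<sigma> (\<sigma> -` keys p) (keys p)"
    using assms by (auto simp: bij_betw_def bij_def inj_on_def image_vimage_eq)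
  from sum.reindex_bij_betw[OF this, of "\<lambda>i. lookup p i choose 2"] show ?thesis
    by (simp add: b_stat_def keys_map_key lookup_map_key_inj bij_is_inj assms)
qed

lemma is_sym_poly_D2:
  fixes f :: "'a::field_char_0 mpoly"
  assumes f: "is_sym_poly N f"
  shows "is_sym_poly N (mconst (1 / 2) * (\<Sum>i<N. theta i (theta i f) - theta i f))" (is "is_sym_poly N ?g")
proof -
  have "lookup ?g m = of_nat (b_stat m) * lookup f m" for m
  proof (cases "keys m \<subseteq> {..<N}")
    case False
    then have "lookup f m = 0" using f by (auto simp: is_sym_poly_def in_keys_iff)
    then show ?thesis by (simp add: lookup_mconst_mult lookup_sum lookup_minus theta.rep_eq)
  qed (rule lookup_D2)
  then show ?thesis
    by (rule is_sym_poly_scaled[OF f]) (simp add: b_stat_map_key)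
qed

theorem D_alpha_sym_poly:
  assumes f: "is_sym_poly N f"
  shows "\<exists>P. D_alpha N f = to_fract P \<and> is_sym_poly N P \<and> (\<forall>m. keys m \<subseteq> {..<N} \<longrightarrow> lookup P m =
    (alpha * of_nat (b_stat m) - of_nat (n_stat m) + (of_nat N - 1) * of_nat (weight m)) * lookup f m +
    offdiag N f m)"
proof -
  let ?g = "mconst (1 / 2) * (\<Sum>i<N. theta i (theta i f) - theta i f)"
  obtain P where P: "D1 N f = to_fract P" "is_sym_poly N P"
    "\<And>m. lookup P m = (\<Sum>j<N. \<Sum>i<j. of_nat (lookup m i)) * lookup f m + offdiag N f m"
    using D1_sym_poly[OF f] by blast
  have "D_alpha N f = to_fract (P + mconst alpha * ?g)"
    by (simp only: D_alpha_def P(1) D2_eq to_fract_add to_fract_mult)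
  moreover have "is_sym_poly N (P + mconst alpha * ?g)"
    by (intro is_sym_poly_add P(2) is_sym_poly_mconst_mult is_sym_poly_D2 f)
  moreover have "lookup (P + mconst alpha * ?g) m =
    (alpha * of_nat (b_stat m) - of_nat (n_stat m) + (of_nat N - 1) * of_nat (weight m)) * lookup f m +
    offdiag N f m" if "keys m \<subseteq> {..<N}" for m
    unfolding lookup_add lookup_mconst_mult[of alpha] lookup_D2[OF that] P(3) sum_lookup_pairs[OF that]
    by (simp add: algebra_simps)
  ultimately show ?thesis by blast
qed

section \<open>Sorting and dominance\<close>

text \<open>Both sides sum the row index over all boxes: a column of height h contributes 0 + ... +
  (h - 1).\<close>

lemma n_stat_eq_b_stat_conjugate:
  assumes p: "is_partition p" shows "b_stat (conjugate p) = n_stat p"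
proof -
  have tri: "n choose 2 = (\<Sum>j<n. j)" for n
    by (induction n) (simp_all add: numeral_2_eq_2)
  let ?M = "lookup p 0" and ?L = "part_length p"
  have sub: "keys (conjugate p) \<subseteq> {..<?M}"
    using less_conjugate_iff[OF p, of 0] by (auto simp: in_keys_iff)
  have "b_stat (conjugate p) = (\<Sum>i<?M. lookup (conjugate p) i choose 2)"
    unfolding b_stat_def using sub by (rule sum.mono_neutral_left[rotated]) (auto simp: in_keys_iff)
  also have "\<dots> = (\<Sum>i<?M. \<Sum>j<?L. if i < lookup p j then j else 0)"
  proof (intro sum.cong refl)
    fix i
    have "{..<lookup (conjugate p) i} = {j \<in> {..<?L}. i < lookup p j}"
      using less_conjugate_iff[OF p, of _ i] lookup_partition_eq_0_iff[OF p]
      by (auto simp: set_eq_iff) (metis not_less not_less_zero)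
    then show "lookup (conjugate p) i choose 2 = (\<Sum>j<?L. if i < lookup p j then j else 0)"
      unfolding tri by (simp only: sum.inter_filter[OF finite_lessThan])
  qed
  also have "\<dots> = (\<Sum>j<?L. \<Sum>i<?M. if i < lookup p j then j else 0)"
    by (rule sum.swap)
  also have "\<dots> = (\<Sum>j<?L. j * lookup p j)"
  proof (intro sum.cong refl)
    fix j
    have "{i \<in> {..<?M}. i < lookup p j} = {..<lookup p j}"
      using is_partitionD[OF p, of 0 j] by auto
    then show "(\<Sum>i<?M. if i < lookup p j then j else 0) = j * lookup p j"
      by (simp add: sum.inter_filter[symmetric])
  qed
  also have "\<dots> = n_stat p"
    using keys_partition[OF p] by (simp add: n_stat_def)
  finally show ?thesis .
qed

section \<open>Partial sums and dominance\<close>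

definition psum :: "nat \<Rightarrow> (nat \<Rightarrow>\<^sub>0 nat) \<Rightarrow> nat" where
  "psum k m = (\<Sum>i<k. lookup m i)"

lemma psum_add: "psum k (p + q) = psum k p + psum k q"
  by (simp add: psum_def lookup_add sum.distrib)

lemma psum_eqI: "(\<And>k. psum k p = psum k q) \<Longrightarrow> p = q"
proof (rule poly_mapping_eqI)
  fix i assume *: "\<And>k. psum k p = psum k q"
  show "lookup p i = lookup q i" using *[of i] *[of "Suc i"] by (simp add: psum_def)
qed

lemma strictly_dominates_psum:
  "strictly_dominates p q \<longleftrightarrow> weight q = weight p \<and> q \<noteq> p \<and> (\<forall>k. psum k q \<le> psum k p)"
  by (simp add: strictly_dominates_def psum_def)

text \<open>The largest element of S is at least card S - 1, so its part is at most the last one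
  counted by \<open>psum (card S) p\<close>.\<close>

lemma sum_le_psum:
  assumes p: "is_partition p" and "finite S"
  shows "sum (lookup p) S \<le> psum (card S) p"
  using assms(2)
proof (induction "card S" arbitrary: S)
  case 0
  then show ?case by simp
next
  case (Suc k)
  then have ne: "S \<noteq> {}" by auto
  define s where "s = Max S"
  have s: "s \<in> S" using Max_in[OF Suc.prems ne] by (simp add: s_def)
  have "S \<subseteq> {..s}" using Suc.prems by (auto simp: s_def)
  then have "Suc k \<le> Suc s" using card_mono[of "{..s}" S] Suc.hyps(2) by simp
  then have "lookup p s \<le> lookup p k" using is_partitionD[OF p, of k s] by simp
  moreover have "sum (lookup p) (S - {s}) \<le> psum k p"
  proof -
    have c: "card (S - {s}) = k" using Suc.hyps(2) Suc.prems s by simp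
    from Suc.hyps(1)[OF c[symmetric]] show ?thesis using Suc.prems c by simp
  qed
  moreover have "sum (lookup p) S = lookup p s + sum (lookup p) (S - {s})"
    using Suc.prems s by (rule sum.remove)
  ultimately show ?case by (simp flip: Suc.hyps(2) add: psum_def)
qed

lemma psum_map_key_le:
  assumes "is_partition p" "bij \<sigma>" shows "psum k (Poly_Mapping.map_key \<sigma> p) \<le> psum k p"
proof -
  have inj: "inj \<sigma>" using assms(2) by (rule bij_is_inj)
  then have i: "inj_on \<sigma> {..<k}" by (rule inj_on_subset) simp
  have "psum k (Poly_Mapping.map_key \<sigma> p) = sum (lookup p) (\<sigma> ` {..<k})"
    by (simp add: psum_def lookup_map_key_inj[OF inj] sum.reindex[OF i])
  also have "\<dots> \<le> psum (card (\<sigma> ` {..<k})) p" by (rule sum_le_psum[OF assms(1)]) simp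
  finally show ?thesis by (simp add: card_image[OF i])
qed

text \<open>Summation by parts: \<open>lookup m i\<close> is counted in N - i of the partial
  sums.\<close>

lemma n_stat_psum:
  assumes "keys m \<subseteq> {..<N}"
  shows "N * weight m = n_stat m + (\<Sum>k<N. psum (Suc k) m)"
proof -
  have "N * (\<Sum>i<N. lookup m i) = (\<Sum>i<N. i * lookup m i) + (\<Sum>k<N. psum (Suc k) m)"
    by (induction N) (simp_all add: algebra_simps psum_def)
  then show ?thesis
    using weight_superset[of "{..<N}" m] n_stat_superset[of "{..<N}" m] assms by simp
qed

text \<open>By \<open>n_stat_psum\<close>, \<open>n_stat\<close> is a constant minus the sum of the
  partial sums, one of which is strictly larger for p. This inequality drives every recursion on
  coefficients and makes the denominators invertible at \<alpha> = 0.\<close>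

lemma strictly_dominates_n_stat:
  assumes "strictly_dominates p q" shows "n_stat p < n_stat q"
proof -
  have "finite (keys p \<union> keys q)" by simp
  then obtain N where "keys p \<union> keys q \<subseteq> {..<N}"
    by (meson finite_nat_iff_bounded)
  then have N: "keys p \<subseteq> {..<N}" "keys q \<subseteq> {..<N}" by auto
  have d: "weight q = weight p" "q \<noteq> p" "\<And>k. psum k q \<le> psum k p"
    using assms by (auto simp: strictly_dominates_psum)
  have "\<exists>k<N. psum (Suc k) q < psum (Suc k) p"
  proof (rule ccontr)
    assume "\<not> ?thesis"
    then have eq: "psum (Suc k) q = psum (Suc k) p" if "k < N" for k
      using d(3)[of "Suc k"] that by (meson le_neq_implies_less)
    have "lookup p i = lookup q i" for i
    proof (cases "i < N")
      case True
      then have "psum i q = psum i p" using eq[of "i - 1"] by (cases i) (auto simp: psum_def)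
      then show ?thesis using eq[OF True] by (simp add: psum_def)
    next
      case False
      then have "i \<notin> keys p" "i \<notin> keys q" using N by auto
      then show ?thesis by (simp add: in_keys_iff)
    qed
    then show False using d(2) poly_mapping_eqI by metis
  qed
  then have "(\<Sum>k<N. psum (Suc k) q) < (\<Sum>k<N. psum (Suc k) p)"
    using d(3) by (intro sum_strict_mono_ex1) auto
  then show ?thesis using n_stat_psum[OF N(1)] n_stat_psum[OF N(2)] d(1) by simp
qed

section \<open>Sorting of exponent vectors\<close>

lemma bij_rearrangement_compose:
  assumes "bij \<sigma>" "bij \<tau>"
  shows "Poly_Mapping.map_key \<sigma> (Poly_Mapping.map_key \<tau> m) = Poly_Mapping.map_key (\<tau> \<circ> \<sigma>) m"
  using assms by (simp add: map_key_compose bij_is_inj)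

text \<open>A rearrangement with least \<open>n_stat\<close> is sorted, since exchanging a pair out
  of order decreases \<open>n_stat\<close>.\<close>

lemma exists_sorting:
  assumes m: "keys m \<subseteq> {..<N}"
  shows "\<exists>\<sigma>. \<sigma> permutes {..<N} \<and> is_partition (Poly_Mapping.map_key \<sigma> m)"
proof -
  define S where "S = {Poly_Mapping.map_key \<sigma> m | \<sigma>. \<sigma> permutes {..<N}}"
  have "m \<in> S" unfolding S_def using permutes_id map_key_id[of m]
    by (intro CollectI exI[of _ "\<lambda>x. x"]) (simp add: id_def)
  then obtain q where q: "q \<in> S" and min: "\<And>q'. q' \<in> S \<Longrightarrow> n_stat q \<le> n_stat q'"
    using arg_min_natI[of "\<lambda>q. q \<in> S" m n_stat] arg_min_nat_le[of "\<lambda>q. q \<in> S" _ n_stat] by metis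
  from q obtain \<sigma> where \<sigma>: "\<sigma> permutes {..<N}" "q = Poly_Mapping.map_key \<sigma> m" by (auto simp: S_def)
  have keys_S: "keys q' \<subseteq> {..<N}" if "q' \<in> S" for q'
    using that m by (auto simp: S_def keys_map_key permutes_inj permutes_in_image dest!: subsetD)
      (use permutes_in_image in fastforce)
  have "is_partition q"
    unfolding is_partition_def
  proof (intro allI impI leI notI)
    fix i j assume ij: "i \<le> j" and less: "lookup q i < lookup q j"
    then have "i < j" by (cases "i = j") auto
    have "j \<in> keys q" using less by (simp add: in_keys_iff)
    then have "j < N" using keys_S[OF q] by auto
    define t where "t = Transposition.transpose i j"
    have t: "t permutes {..<N}" unfolding t_def using \<open>i < j\<close> \<open>j < N\<close> by (intro permutes_swap_id) auto
    define q' where "q' = Poly_Mapping.map_key t q"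
    have "q' = Poly_Mapping.map_key (\<sigma> \<circ> t) m"
      unfolding q'_def \<sigma>(2) using t \<sigma>(1) by (intro bij_rearrangement_compose permutes_bij)
    then have q': "q' \<in> S" unfolding S_def using permutes_compose[OF t \<sigma>(1)] by blast
    have lk: "lookup q' a = lookup q (t a)" for a
      by (simp add: q'_def lookup_map_key_inj permutes_inj[OF t])
    have split: "(\<Sum>a<N. a * g a) = i * g i + j * g j + (\<Sum>a\<in>{..<N} - {i, j}. a * g a)" for g :: "nat \<Rightarrow> nat"
    proof -
      have "{..<N} = insert i (insert j ({..<N} - {i, j}))" using \<open>i < j\<close> \<open>j < N\<close> by auto
      then have "(\<Sum>a<N. a * g a) = (\<Sum>a\<in>insert i (insert j ({..<N} - {i, j})). a * g a)" by simp
      then show ?thesis using \<open>i < j\<close> by simp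
    qed
    have "(\<Sum>a\<in>{..<N} - {i, j}. a * lookup q' a) = (\<Sum>a\<in>{..<N} - {i, j}. a * lookup q a)"
      by (intro sum.cong refl) (auto simp: lk t_def Transposition.transpose_def)
    then have "n_stat q' + (i * lookup q i + j * lookup q j) = n_stat q + (i * lookup q j + j * lookup q i)"
      using n_stat_superset[of "{..<N}" q] n_stat_superset[of "{..<N}" q'] keys_S[OF q] keys_S[OF q']
      by (simp add: split lk t_def)
    moreover have "i * lookup q j + j * lookup q i < i * lookup q i + j * lookup q j"
    proof -
      obtain d e where "j = i + Suc d" "lookup q j = lookup q i + Suc e"
        using \<open>i < j\<close> less by (metis add_Suc_right less_imp_Suc_add)
      then show ?thesis by (simp add: algebra_simps)
    qed
    ultimately have "n_stat q' < n_stat q" by linarith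
    with min[OF q'] show False by simp
  qed
  with \<sigma> show ?thesis by auto
qed

definition sort_part :: "(nat \<Rightarrow>\<^sub>0 nat) \<Rightarrow> nat \<Rightarrow>\<^sub>0 nat" where
  "sort_part m = (SOME p. is_partition p \<and> (\<exists>\<sigma>. bij \<sigma> \<and> p = Poly_Mapping.map_key \<sigma> m))"

text \<open>Each is a rearrangement of the other, and a partition has the largest partial sums among
  its rearrangements.\<close>

lemma partition_rearrangement_unique:
  assumes "is_partition p" "is_partition q" "bij \<sigma>" "q = Poly_Mapping.map_key \<sigma> p"
  shows "q = p"
proof (rule psum_eqI, rule antisym)
  fix k
  show "psum k q \<le> psum k p" using psum_map_key_le[OF assms(1,3)] assms(4) by simp
  have "p = Poly_Mapping.map_key (inv \<sigma>) q"
    unfolding assms(4) using assms(3)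
    by (intro poly_mapping_eqI)
      (simp add: lookup_map_key_inj bij_is_inj bij_imp_bij_inv surj_f_inv_f bij_is_surj)
  then show "psum k p \<le> psum k q"
    using psum_map_key_le[OF assms(2) bij_imp_bij_inv[OF assms(3)]] by simp
qed

lemma map_key_inv:
  assumes "bij \<sigma>" shows "Poly_Mapping.map_key (inv \<sigma>) (Poly_Mapping.map_key \<sigma> m) = m"
  using assms by (intro poly_mapping_eqI)
    (simp add: lookup_map_key_inj bij_is_inj bij_imp_bij_inv surj_f_inv_f bij_is_surj)

lemma sort_part_unique:
  assumes "is_partition p" "bij \<sigma>" "p = Poly_Mapping.map_key \<sigma> m"
  shows "sort_part m = p"
proof -
  have "\<exists>p. is_partition p \<and> (\<exists>\<sigma>. bij \<sigma> \<and> p = Poly_Mapping.map_key \<sigma> m)" using assms by blast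
  from someI_ex[OF this] obtain \<tau> where \<tau>: "is_partition (sort_part m)" "bij \<tau>"
    "sort_part m = Poly_Mapping.map_key \<tau> m" by (auto simp: sort_part_def)
  have "m = Poly_Mapping.map_key (inv \<sigma>) p" by (simp add: assms(3) map_key_inv[OF assms(2)])
  then have "sort_part m = Poly_Mapping.map_key (inv \<sigma> \<circ> \<tau>) p"
    using \<tau>(3) bij_rearrangement_compose[OF \<tau>(2) bij_imp_bij_inv[OF assms(2)], of p] by simp
  then show ?thesis
    by (rule partition_rearrangement_unique[OF assms(1) \<tau>(1) bij_comp[OF \<tau>(2) bij_imp_bij_inv[OF assms(2)]]])
qed

lemma sort_part_permutes:
  assumes "keys m \<subseteq> {..<N}"
  obtains \<sigma> where "\<sigma> permutes {..<N}" "sort_part m = Poly_Mapping.map_key \<sigma> m"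
  using exists_sorting[OF assms] sort_part_unique permutes_bij by metis

lemma exists_keys_bound: "\<exists>N. keys m \<subseteq> {..<N::nat}"
  using finite_keys finite_nat_iff_bounded by blast

lemma is_partition_sort_part: "is_partition (sort_part m)"
  using exists_keys_bound[of m] exists_sorting[of m] sort_part_unique permutes_bij by metis

lemma sort_part_bij: "\<exists>\<sigma>. bij \<sigma> \<and> sort_part m = Poly_Mapping.map_key \<sigma> m"
  using exists_keys_bound[of m] sort_part_permutes[of m] permutes_bij by metis

lemma sort_part_partition: "is_partition p \<Longrightarrow> sort_part p = p"
  using sort_part_unique[of p "\<lambda>x. x" p] map_key_id[of p] bij_id by (simp add: id_def)

lemma sort_part_map_key:
  assumes "bij \<sigma>" shows "sort_part (Poly_Mapping.map_key \<sigma> m) = sort_part m"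
proof -
  obtain \<tau> where \<tau>: "bij \<tau>" "sort_part (Poly_Mapping.map_key \<sigma> m) = Poly_Mapping.map_key \<tau> (Poly_Mapping.map_key \<sigma> m)"
    using sort_part_bij by blast
  show ?thesis
    by (rule sort_part_unique[symmetric, OF is_partition_sort_part bij_comp[OF \<tau>(1) assms]])
      (simp only: \<tau>(2) bij_rearrangement_compose[OF \<tau>(1) assms])
qed

lemma keys_sort_part:
  assumes "keys m \<subseteq> {..<N}" shows "keys (sort_part m) \<subseteq> {..<N}"
proof -
  obtain \<sigma> where "\<sigma> permutes {..<N}" "sort_part m = Poly_Mapping.map_key \<sigma> m"
    using sort_part_permutes[OF assms] .
  then show ?thesis
    using assms permutes_in_image[of \<sigma> "{..<N}"] by (auto simp: keys_map_key permutes_inj)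
qed

lemma weight_sort_part: "weight (sort_part m) = weight m"
  using sort_part_bij[of m] weight_map_key by metis

lemma psum_sort_part: "psum k m \<le> psum k (sort_part m)"
proof -
  obtain \<sigma> where \<sigma>: "bij \<sigma>" "sort_part m = Poly_Mapping.map_key \<sigma> m" using sort_part_bij by blast
  then have "m = Poly_Mapping.map_key (inv \<sigma>) (sort_part m)" by (simp add: map_key_inv)
  then show ?thesis
    using psum_map_key_le[OF is_partition_sort_part bij_imp_bij_inv[OF \<sigma>(1)], of k m] by simp
qed

lemma rearrangements_iff:
  assumes "is_partition p"
  shows "m \<in> rearrangements N p \<longleftrightarrow> keys m \<subseteq> {..<N} \<and> sort_part m = p"
proof
  assume "m \<in> rearrangements N p"
  then show "keys m \<subseteq> {..<N} \<and> sort_part m = p"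
    using sort_part_map_key sort_part_partition[OF assms] by (auto simp: rearrangements_def)
next
  assume *: "keys m \<subseteq> {..<N} \<and> sort_part m = p"
  obtain \<sigma> where \<sigma>: "bij \<sigma>" "sort_part m = Poly_Mapping.map_key \<sigma> m" using sort_part_bij by blast
  then have "m = Poly_Mapping.map_key (inv \<sigma>) p" using * by (metis map_key_inv)
  then show "m \<in> rearrangements N p"
    using * bij_imp_bij_inv[OF \<sigma>(1)] by (auto simp: rearrangements_def)
qed

lemma sym_poly_lookup_sort_part:
  assumes f: "is_sym_poly N f" and m: "keys m \<subseteq> {..<N}"
  shows "lookup f (sort_part m) = lookup f m"
proof -
  obtain \<sigma> where "\<sigma> permutes {..<N}" "sort_part m = Poly_Mapping.map_key \<sigma> m"
    using sort_part_permutes[OF m] .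
  then show ?thesis using f by (simp add: is_sym_poly_def)
qed

lemma sym_poly_eqI:
  assumes f: "is_sym_poly N f" and g: "is_sym_poly N g"
    and eq: "\<And>q. is_partition q \<Longrightarrow> keys q \<subseteq> {..<N} \<Longrightarrow> lookup f q = lookup g q"
  shows "f = g"
proof (rule poly_mapping_eqI)
  fix m
  show "lookup f m = lookup g m"
  proof (cases "keys m \<subseteq> {..<N}")
    case True
    then show ?thesis
      using eq[OF is_partition_sort_part keys_sort_part[OF True]]
        sym_poly_lookup_sort_part[OF f True] sym_poly_lookup_sort_part[OF g True] by simp
  next
    case False
    then have "m \<notin> keys f" "m \<notin> keys g" using f g by (auto simp: is_sym_poly_def)
    then show ?thesis by (simp add: in_keys_iff)
  qed
qed

text \<open>Moving k units from j to the earlier i raises the partial sums ending between them by k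
  and leaves the others alone; sorting can only raise them further.\<close>

lemma shift_dominates:
  assumes "i < j" "1 \<le> k" "k \<le> lookup q j"
  shows "strictly_dominates (sort_part (shift i j k q)) q"
proof -
  let ?s = "shift i j k q"
  have w: "weight ?s = weight q"
  proof -
    have "?s + Poly_Mapping.single j k = q + Poly_Mapping.single i k"
      using assms by (intro poly_mapping_eqI) (auto simp: lookup_shift lookup_add lookup_single when_def)
    then have "weight ?s + weight (Poly_Mapping.single j k) = weight q + weight (Poly_Mapping.single i k)"
      by (metis weight_add)
    moreover have "weight (Poly_Mapping.single a k) = k" for a by (simp add: weight_def)
    ultimately show ?thesis by simp
  qed
  have p: "psum a ?s = psum a q + (if i < a \<and> a \<le> j then k else 0)" for a
  proof (induction a)
    case (Suc a)
    have "psum (Suc a) ?s = psum a ?s + lookup ?s a" "psum (Suc a) q = psum a q + lookup q a"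
      by (simp_all add: psum_def)
    then show ?case using Suc assms by (auto simp: lookup_shift)
  qed (simp add: psum_def)
  have "psum (Suc i) q < psum (Suc i) (sort_part ?s)"
    using p[of "Suc i"] psum_sort_part[of "Suc i" ?s] assms by simp
  moreover have "psum a q \<le> psum a (sort_part ?s)" for a
    using p[of a] psum_sort_part[of a ?s] by simp
  ultimately show ?thesis
    using w by (auto simp: strictly_dominates_psum weight_sort_part)
qed

lemma keys_shift:
  assumes "i < N" "i \<noteq> j" "keys q \<subseteq> {..<N}" shows "keys (shift i j k q) \<subseteq> {..<N}"
proof
  fix a assume "a \<in> keys (shift i j k q)"
  then have "a = i \<or> lookup q a \<noteq> 0" using assms(2) by (auto simp: in_keys_iff lookup_shift split: if_splits)
  then have "a = i \<or> a \<in> keys q" by (simp add: in_keys_iff)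
  then show "a \<in> {..<N}" using assms by auto
qed

section \<open>Construction of Jack symmetric functions\<close>

text \<open>The denominator is the difference of the eigenvalues of \<open>D\<^sub>\<alpha>\<close> belonging to \<open>p\<close> and \<open>q\<close>.\<close>

function jack_coeff :: "(nat \<Rightarrow>\<^sub>0 nat) \<Rightarrow> (nat \<Rightarrow>\<^sub>0 nat) \<Rightarrow> rat ratfun" where
  "jack_coeff p q = (if q = p then hook_alpha p else if is_partition q \<and> strictly_dominates p q then
     (\<Sum>j<part_length q. \<Sum>i<j. \<Sum>k\<in>{1..lookup q j}. (of_nat (lookup q i + 2 * k) - of_nat (lookup q j)) *
        jack_coeff p (sort_part (shift i j k q))) /
     (alpha * (of_nat (b_stat p) - of_nat (b_stat q)) + (of_nat (n_stat q) - of_nat (n_stat p)))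
   else 0)"
  by auto
termination
  \<comment> \<open>The recursion climbs in the dominance order, so \<open>n_stat\<close>
    decreases.\<close>
  by (relation "measure (\<lambda>(p, q). n_stat q)")
    (auto intro!: strictly_dominates_n_stat shift_dominates)

declare jack_coeff.simps [simp del]

lemma linear_unit:
  assumes "m < (n :: nat)"
  shows "no_pole_at_0 (inverse (alpha * (of_nat a - of_nat b) + (of_nat n - of_nat m)) :: rat ratfun)"
    and "alpha * (of_nat a - of_nat b) + (of_nat n - of_nat m) \<noteq> (0 :: rat ratfun)"
proof -
  define v :: "rat poly" where "v = [:of_nat n - of_nat m, of_nat a - of_nat b:]"
  have v: "v = [:0, 1:] * ([:of_nat a:] - [:of_nat b:]) + ([:of_nat n:] - [:of_nat m:])"
    by (simp add: v_def)
  have eq: "alpha * (of_nat a - of_nat b) + (of_nat n - of_nat m) = to_fract v"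
    unfolding v to_fract_add to_fract_mult to_fract_diff to_fract_const_of_nat alpha_def ..
  have "poly v 0 \<noteq> 0" using assms by (simp add: v_def)
  then have "v \<noteq> 0" by auto
  then show "alpha * (of_nat a - of_nat b) + (of_nat n - of_nat m) \<noteq> (0 :: rat ratfun)"
    unfolding eq by (simp only: to_fract_eq_0_iff not_False_eq_True)
  show "no_pole_at_0 (inverse (alpha * (of_nat a - of_nat b) + (of_nat n - of_nat m)) :: rat ratfun)"
    unfolding eq using \<open>poly v 0 \<noteq> 0\<close> by (auto simp: no_pole_at_0_def to_fract_def)
qed

text \<open>Every coefficient is read at a sorted exponent. Positions j beyond the length contribute
  nothing, so N drops out, which is the source of stability.\<close>

definition offdiag_sorted :: "((nat \<Rightarrow>\<^sub>0 nat) \<Rightarrow> 'a::comm_ring_1) \<Rightarrow> (nat \<Rightarrow>\<^sub>0 nat) \<Rightarrow> 'a" where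
  "offdiag_sorted c q = (\<Sum>j<part_length q. \<Sum>i<j. \<Sum>k\<in>{1..lookup q j}.
     (of_nat (lookup q i + 2 * k) - of_nat (lookup q j)) * c (sort_part (shift i j k q)))"

lemma offdiag_sym_poly:
  fixes f :: "'a::comm_ring_1 mpoly"
  assumes f: "is_sym_poly N f" and q: "is_partition q" "keys q \<subseteq> {..<N}"
  shows "offdiag N f q = offdiag_sorted (lookup f) q"
proof -
  have "part_length q \<le> N" using q by (simp add: keys_partition)
  have "offdiag N f q = (\<Sum>j<N. \<Sum>i<j. \<Sum>k\<in>{1..lookup q j}.
      (of_nat (lookup q i + 2 * k) - of_nat (lookup q j)) * lookup f (sort_part (shift i j k q)))"
    unfolding offdiag_def
    using q by (intro sum.cong refl) (simp add: sym_poly_lookup_sort_part[OF f keys_shift])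
  also have "\<dots> = offdiag_sorted (lookup f) q"
    unfolding offdiag_sorted_def
    using \<open>part_length q \<le> N\<close> lookup_partition_eq_0_iff[OF q(1)]
    by (intro sum.mono_neutral_right) (auto simp: not_less)
  finally show ?thesis .
qed

lemma strictly_dominates_trans:
  assumes "strictly_dominates p q" "strictly_dominates q r" shows "strictly_dominates p r"
  using strictly_dominates_n_stat[OF assms(1)] strictly_dominates_n_stat[OF assms(2)] assms
  by (auto simp: strictly_dominates_psum intro: order_trans)

lemma jack_coeff_eq_0: "\<not> (q = p \<or> is_partition q \<and> strictly_dominates p q) \<Longrightarrow> jack_coeff p q = 0"
  by (subst jack_coeff.simps) (simp only: de_Morgan_disj if_False)

lemma jack_coeff_self: "jack_coeff p p = hook_alpha p"
  by (simp add: jack_coeff.simps)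

text \<open>For q strictly below p this is the defining recursion. Otherwise the left side vanishes,
  because a partition strictly above q and weakly below p would place q strictly below p; on the
  right, either q = p and the factor is 0, or the coefficient is 0.\<close>

lemma offdiag_sorted_jack_coeff:
  assumes q: "is_partition q"
  shows "offdiag_sorted (jack_coeff p) q =
    (alpha * (of_nat (b_stat p) - of_nat (b_stat q)) + (of_nat (n_stat q) - of_nat (n_stat p))) * jack_coeff p q"
proof (cases "strictly_dominates p q")
  case True
  then have "n_stat p < n_stat q" by (rule strictly_dominates_n_stat)
  then have "q \<noteq> p" by auto
  have "jack_coeff p q = offdiag_sorted (jack_coeff p) q /
      (alpha * (of_nat (b_stat p) - of_nat (b_stat q)) + (of_nat (n_stat q) - of_nat (n_stat p)))"
    using True q \<open>q \<noteq> p\<close> unfolding offdiag_sorted_def by (subst jack_coeff.simps) (simp only: simp_thms if_True if_False)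
  then show ?thesis
    using linear_unit(2)[OF \<open>n_stat p < n_stat q\<close>] by (simp only: times_divide_eq_right nonzero_mult_div_cancel_left not_False_eq_True)
next
  case False
  have "jack_coeff p (sort_part (shift i j k q)) = 0" if "i < j" "k \<in> {1..lookup q j}" for i j k
  proof (rule jack_coeff_eq_0, rule notI)
    have d: "strictly_dominates (sort_part (shift i j k q)) q"
      using that by (intro shift_dominates) auto
    assume "sort_part (shift i j k q) = p \<or>
      is_partition (sort_part (shift i j k q)) \<and> strictly_dominates p (sort_part (shift i j k q))"
    then show False using d False strictly_dominates_trans by metis
  qed
  then have "offdiag_sorted (jack_coeff p) q = 0"
    unfolding offdiag_sorted_def by (intro sum.neutral ballI) simp
  moreover have "q = p \<or> jack_coeff p q = 0" using False jack_coeff_eq_0 by blast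
  ultimately show ?thesis by auto
qed

definition jack_sum :: "(nat \<Rightarrow>\<^sub>0 nat) \<Rightarrow> nat \<Rightarrow> rat ratfun mpoly" where
  "jack_sum p N = mconst (hook_alpha p) * monomial_sym_poly N p +
     (\<Sum>q | is_partition q \<and> strictly_dominates p q. mconst (jack_coeff p q) * monomial_sym_poly N q)"

lemma lookup_monomial_expansion:
  assumes p: "is_partition p"
  shows "lookup (mconst (a p) * monomial_sym_poly N p +
     (\<Sum>q | is_partition q \<and> strictly_dominates p q. mconst (a q) * monomial_sym_poly N q)) m =
    (if keys m \<subseteq> {..<N} \<and> (sort_part m = p \<or> strictly_dominates p (sort_part m)) then a (sort_part m)
     else (0 :: 'a::comm_ring_1))"
proof -
  have "lookup (\<Sum>q | is_partition q \<and> strictly_dominates p q. mconst (a q) * monomial_sym_poly N q) m =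
      (\<Sum>q | is_partition q \<and> strictly_dominates p q. if q = sort_part m then
        (if keys m \<subseteq> {..<N} then a (sort_part m) else 0) else 0)"
    unfolding lookup_sum
    by (intro sum.cong refl) (auto simp: lookup_mconst_mult lookup_monomial_sym_poly rearrangements_iff)
  also have "\<dots> = (if strictly_dominates p (sort_part m) \<and> keys m \<subseteq> {..<N} then a (sort_part m) else 0)"
    by (simp add: finite_strictly_dominated is_partition_sort_part)
  finally have 1: "lookup (\<Sum>q | is_partition q \<and> strictly_dominates p q. mconst (a q) * monomial_sym_poly N q) m =
      (if strictly_dominates p (sort_part m) \<and> keys m \<subseteq> {..<N} then a (sort_part m) else 0)" .
  have "\<not> strictly_dominates p p" by (simp add: strictly_dominates_def)
  then show ?thesis
    unfolding lookup_add 1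
    by (auto simp: lookup_mconst_mult lookup_monomial_sym_poly rearrangements_iff[OF p])
qed

lemma lookup_jack_sum:
  assumes "is_partition p"
  shows "lookup (jack_sum p N) m = (if keys m \<subseteq> {..<N} then jack_coeff p (sort_part m) else 0)"
  unfolding jack_sum_def jack_coeff_self[symmetric] lookup_monomial_expansion[OF assms]
  by (auto simp: jack_coeff_eq_0 is_partition_sort_part)

lemma is_sym_poly_sum:
  "(\<And>x. x \<in> A \<Longrightarrow> is_sym_poly N (f x)) \<Longrightarrow> is_sym_poly N (sum f A :: 'a::comm_ring_1 mpoly)"
  by (induction A rule: infinite_finite_induct) (auto simp: is_sym_poly_0 is_sym_poly_add)

lemma is_sym_poly_jack_sum: "is_sym_poly N (jack_sum p N)"
  unfolding jack_sum_def
  by (intro is_sym_poly_add is_sym_poly_sum is_sym_poly_mconst_mult is_sym_poly_monomial_sym_poly)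

lemma jack_eigenvalue_eq:
  "is_partition p \<Longrightarrow> jack_eigenvalue N p =
    alpha * of_nat (b_stat p) - of_nat (n_stat p) + (of_nat N - 1) * of_nat (weight p)"
  by (simp add: jack_eigenvalue_def n_stat_eq_b_stat_conjugate)

lemma is_jack_poly_jack_sum:
  assumes p: "is_partition p" shows "is_jack_poly N p (jack_sum p N)"
  unfolding is_jack_poly_def
proof (intro conjI)
  let ?f = "jack_sum p N"
  show sym: "is_sym_poly N ?f" by (rule is_sym_poly_jack_sum)
  obtain P where P: "D_alpha N ?f = to_fract P" "is_sym_poly N P"
    "\<And>m. keys m \<subseteq> {..<N} \<Longrightarrow> lookup P m =
      (alpha * of_nat (b_stat m) - of_nat (n_stat m) + (of_nat N - 1) * of_nat (weight m)) * lookup ?f m +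
      offdiag N ?f m"
    using D_alpha_sym_poly[OF sym] by blast
  have "P = mconst (jack_eigenvalue N p) * ?f"
  proof (rule sym_poly_eqI[OF P(2) is_sym_poly_mconst_mult[OF sym]])
    fix q assume q: "is_partition q" "keys q \<subseteq> {..<N}"
    have f: "lookup ?f q = jack_coeff p q"
      using q by (simp add: lookup_jack_sum[OF p] sort_part_partition)
    have "offdiag N ?f q = offdiag_sorted (jack_coeff p) q"
      unfolding offdiag_sym_poly[OF sym q] offdiag_sorted_def
    proof (intro sum.cong refl arg_cong2[where f = "(*)"])
      fix j i k assume "j \<in> {..<part_length q}" "i \<in> {..<j}"
      then have "i < N" "i \<noteq> j" using q by (auto simp: keys_partition)
      then have "keys (sort_part (shift i j k q)) \<subseteq> {..<N}" using q by (intro keys_sort_part keys_shift)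
      then show "lookup ?f (sort_part (shift i j k q)) = jack_coeff p (sort_part (shift i j k q))"
        by (simp add: lookup_jack_sum[OF p] sort_part_partition is_partition_sort_part)
    qed
    also have "\<dots> = (alpha * (of_nat (b_stat p) - of_nat (b_stat q)) +
        (of_nat (n_stat q) - of_nat (n_stat p))) * jack_coeff p q"
      by (rule offdiag_sorted_jack_coeff[OF q(1)])
    finally have o: "offdiag N ?f q = (alpha * (of_nat (b_stat p) - of_nat (b_stat q)) +
        (of_nat (n_stat q) - of_nat (n_stat p))) * jack_coeff p q" .
    \<comment> \<open>The terms of the eigenvalue with N cancel only for equal weights.\<close>
    have "weight q = weight p \<or> jack_coeff p q = 0"
      using jack_coeff_eq_0[of q p] by (auto simp: strictly_dominates_def)
    then show "lookup P q = lookup (mconst (jack_eigenvalue N p) * ?f) q"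
      unfolding P(3)[OF q(2)] o lookup_mconst_mult f jack_eigenvalue_eq[OF p]
      by (elim disjE) (simp_all add: algebra_simps)
  qed
  then show "D_alpha N ?f = to_fract (mconst (jack_eigenvalue N p) * ?f)" by (simp add: P(1))
  show "\<exists>a. ?f = mconst (hook_alpha p) * monomial_sym_poly N p +
        (\<Sum>q | is_partition q \<and> strictly_dominates p q. mconst (a q) * monomial_sym_poly N q)"
    unfolding jack_sum_def by blast
qed

text \<open>Going down from p, the eigenvalue equation at q determines the coefficient from those at
  partitions above q, as the difference of eigenvalues is nonzero.\<close>

lemma is_jack_poly_unique:
  assumes p: "is_partition p" "keys p \<subseteq> {..<N}" and f: "is_jack_poly N p f"
  shows "f = jack_sum p N"
proof -
  from f have sym: "is_sym_poly N f" and eig: "D_alpha N f = to_fract (mconst (jack_eigenvalue N p) * f)"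
    by (auto simp: is_jack_poly_def)
  from f obtain a where f_eq: "f = mconst (hook_alpha p) * monomial_sym_poly N p +
        (\<Sum>q | is_partition q \<and> strictly_dominates p q. mconst (a q) * monomial_sym_poly N q)"
    by (auto simp: is_jack_poly_def)
  \<comment> \<open>The expansion leaves the value of \<open>a\<close> at p free; fixing it there
    makes the coefficient formula uniform.\<close>
  define a' where "a' = a(p := hook_alpha p)"
  have "f = mconst (a' p) * monomial_sym_poly N p +
        (\<Sum>q | is_partition q \<and> strictly_dominates p q. mconst (a' q) * monomial_sym_poly N q)"
    unfolding f_eq a'_def by (intro arg_cong2[where f = "(+)"] sum.cong) (auto simp: strictly_dominates_def)
  then have lookup_f: "lookup f m = (if keys m \<subseteq> {..<N} \<and> (sort_part m = p \<or> strictly_dominates p (sort_part m))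
      then a' (sort_part m) else 0)" for m
    using lookup_monomial_expansion[OF p(1), of a'] by simp
  obtain P where P: "D_alpha N f = to_fract P"
    "\<And>m. keys m \<subseteq> {..<N} \<Longrightarrow> lookup P m =
      (alpha * of_nat (b_stat m) - of_nat (n_stat m) + (of_nat N - 1) * of_nat (weight m)) * lookup f m +
      offdiag N f m"
    using D_alpha_sym_poly[OF sym] by blast
  have "to_fract P = to_fract (mconst (jack_eigenvalue N p) * f)" using P(1) eig by (simp only:)
  then have PE: "P = mconst (jack_eigenvalue N p) * f" by (simp only: to_fract_eq_iff)
  have "lookup f q = jack_coeff p q" if "is_partition q" "keys q \<subseteq> {..<N}" for q
    using that
  proof (induction "n_stat q" arbitrary: q rule: less_induct)
    case less
    note q = less.prems
    have sort: "sort_part q = q" by (rule sort_part_partition[OF q(1)])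
    show ?case
    proof (cases "strictly_dominates p q")
      case False
      then show ?thesis
        using jack_coeff_eq_0[of q p] q p(2) sort_part_partition[OF p(1)]
        by (auto simp: lookup_f sort jack_coeff_self a'_def)
    next
      case True
      have w: "weight q = weight p" using True by (simp add: strictly_dominates_def)
      have "offdiag N f q = offdiag_sorted (jack_coeff p) q"
        unfolding offdiag_sym_poly[OF sym q] offdiag_sorted_def
      proof (intro sum.cong refl arg_cong2[where f = "(*)"])
        fix j i k assume ijk: "j \<in> {..<part_length q}" "i \<in> {..<j}" "k \<in> {1..lookup q j}"
        then have "i < N" "i \<noteq> j" using q by (auto simp: keys_partition)
        then have "keys (sort_part (shift i j k q)) \<subseteq> {..<N}" using q by (intro keys_sort_part keys_shift)
        moreover have "n_stat (sort_part (shift i j k q)) < n_stat q"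
          using ijk by (intro strictly_dominates_n_stat shift_dominates) auto
        ultimately show "lookup f (sort_part (shift i j k q)) = jack_coeff p (sort_part (shift i j k q))"
          by (intro less.hyps is_partition_sort_part)
      qed
      then have o: "offdiag N f q = (alpha * (of_nat (b_stat p) - of_nat (b_stat q)) +
        (of_nat (n_stat q) - of_nat (n_stat p))) * jack_coeff p q"
        by (simp only: offdiag_sorted_jack_coeff[OF q(1)])
      have "(alpha * (of_nat (b_stat p) - of_nat (b_stat q)) + (of_nat (n_stat q) - of_nat (n_stat p))) * lookup f q =
        offdiag N f q"
        using P(2)[OF q(2)] unfolding PE lookup_mconst_mult jack_eigenvalue_eq[OF p(1)] w
        by (simp add: algebra_simps)
      then show ?thesis
        unfolding o using linear_unit(2)[OF strictly_dominates_n_stat[OF True]] by simp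
    qed
  qed
  then have "lookup f q = lookup (jack_sum p N) q" if "is_partition q" "keys q \<subseteq> {..<N}" for q
    using that by (simp add: lookup_jack_sum[OF p(1)] sort_part_partition)
  then show ?thesis by (rule sym_poly_eqI[OF sym is_sym_poly_jack_sum])
qed

lemma jack_poly_eq:
  assumes "is_partition p" "part_length p \<le> N" shows "jack_poly N p = jack_sum p N"
  unfolding jack_poly_def
  using assms by (intro the_equality is_jack_poly_jack_sum is_jack_poly_unique) (auto simp: keys_partition)

lemma symfun_eqI:
  fixes F G :: "'a::comm_ring_1 symfun"
  assumes "\<And>N. N \<ge> M \<Longrightarrow> in_vars F N = in_vars G N" shows "F = G"
proof -
  have restrict: "restrict_vars N (in_vars H (Suc N)) = in_vars H N" for N and H :: "'a symfun"
    using in_vars[of H] by simp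
  have "in_vars F (M - k) = in_vars G (M - k)" for k
  proof (induction k)
    case (Suc k)
    show ?case
    proof (cases "k < M")
      case True
      then have "M - k = Suc (M - Suc k)" by simp
      then show ?thesis using Suc restrict[of "M - Suc k" F] restrict[of "M - Suc k" G] by simp
    qed (use Suc in simp)
  qed (use assms in simp)
  then have "in_vars F N = in_vars G N" for N
    using assms[of N] by (cases "N \<ge> M") (auto dest: spec[of _ "M - N"] simp: not_le, metis diff_diff_cancel less_imp_le)
  then show ?thesis by (simp add: in_vars_inject[symmetric] fun_eq_iff)
qed

text \<open>Stability holds because \<open>jack_coeff\<close> does not involve N.\<close>

lemma in_vars_jack:
  assumes p: "is_partition p" shows "in_vars (jack p) N = jack_sum p N"
proof -
  have sort_weight: "weight m = weight p" if "m \<in> keys (jack_sum p N)" for m N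
  proof -
    have "jack_coeff p (sort_part m) \<noteq> 0"
      using that by (auto simp: in_keys_iff lookup_jack_sum[OF p] split: if_splits)
    then have "sort_part m = p \<or> strictly_dominates p (sort_part m)"
      using jack_coeff_eq_0[of "sort_part m" p] by blast
    then show ?thesis by (metis strictly_dominates_def weight_sort_part)
  qed
  have "jack_sum p \<in> {F. (\<forall>N. is_sym_poly N (F N)) \<and> (\<forall>N. restrict_vars N (F (Suc N)) = F N) \<and>
     (\<exists>d. \<forall>N. \<forall>m\<in>keys (F N). weight m \<le> d)}"
  proof (intro CollectI conjI allI)
    show "restrict_vars N (jack_sum p (Suc N)) = jack_sum p N" for N
      by (rule poly_mapping_eqI) (auto simp: lookup_restrict_vars lookup_jack_sum[OF p])
    show "\<exists>d. \<forall>N. \<forall>m\<in>keys (jack_sum p N). weight m \<le> d"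
      using sort_weight by (intro exI[of _ "weight p"]) simp
  qed (rule is_sym_poly_jack_sum)
  then have in_vars: "in_vars (Abs_symfun (jack_sum p)) = jack_sum p" by (rule Abs_symfun_inverse)
  have "jack p = Abs_symfun (jack_sum p)"
    unfolding jack_def
  proof (rule the_equality)
    show "\<forall>N\<ge>part_length p. in_vars (Abs_symfun (jack_sum p)) N = jack_poly N p"
      by (simp add: in_vars jack_poly_eq[OF p])
    fix F assume "\<forall>N\<ge>part_length p. in_vars F N = jack_poly N p"
    then show "F = Abs_symfun (jack_sum p)"
      by (intro symfun_eqI[of "part_length p"]) (simp add: in_vars jack_poly_eq[OF p])
  qed
  then show ?thesis by (simp add: in_vars)
qed

section \<open>The eigenvalue equation for cumulants\<close>

lemma derivation_lincomb:
  assumes "\<And>x. x \<in> A \<Longrightarrow> derivation (d x)"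
  shows "derivation (\<lambda>f. \<Sum>x\<in>A. u x * d x f :: 'a::comm_ring_1)"
  unfolding derivation_def
proof (intro conjI allI)
  fix f g
  show "(\<Sum>x\<in>A. u x * d x (f + g)) = (\<Sum>x\<in>A. u x * d x f) + (\<Sum>x\<in>A. u x * d x g)"
    unfolding sum.distrib[symmetric]
    by (intro sum.cong refl) (simp add: derivation_add[OF assms] ring_distribs)
  show "(\<Sum>x\<in>A. u x * d x (f * g)) = (\<Sum>x\<in>A. u x * d x f) * g + f * (\<Sum>x\<in>A. u x * d x g)"
    unfolding sum_distrib_left sum_distrib_right sum.distrib[symmetric]
    by (intro sum.cong refl) (simp add: derivation_mult[OF assms] algebra_simps)
qed

definition var_pairs :: "nat \<Rightarrow> (nat \<times> nat) set" where
  "var_pairs N = Sigma {..<N} (\<lambda>i. {..<N} - {i})"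

text \<open>Each unordered pair occurs twice, so up to sign this is the square of the usual
  Vandermonde determinant; it serves as a common denominator.\<close>

definition vandermonde :: "nat \<Rightarrow> 'a::comm_ring_1 mpoly" where
  "vandermonde N = (\<Prod>(i, j)\<in>var_pairs N. mvar i - mvar j)"

text \<open>The first-order operator times \<open>vandermonde N\<close>, with each denominator
  cancelled. It is polynomial on arbitrary arguments, not only on symmetric ones, and hence a
  derivation of the whole ring.\<close>

definition D1_cleared :: "nat \<Rightarrow> 'a::comm_ring_1 mpoly \<Rightarrow> 'a mpoly" where
  "D1_cleared N f = (\<Sum>s\<in>var_pairs N. (mvar (fst s) * (\<Prod>(i, j)\<in>var_pairs N - {s}. mvar i - mvar j)) * theta (fst s) f)"

lemma finite_var_pairs: "finite (var_pairs N)"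
  by (simp add: var_pairs_def)

lemma derivation_D1_cleared: "derivation (D1_cleared N)"
  unfolding D1_cleared_def by (intro derivation_lincomb derivation_theta)

lemma vandermonde_nonzero: "vandermonde N \<noteq> (0 :: 'a::idom mpoly)"
  unfolding vandermonde_def using finite_var_pairs[of N]
  by (auto simp: prod_zero_iff mvar_eq_iff var_pairs_def)

lemma vandermonde_D1:
  fixes f :: "'a::field_char_0 mpoly"
  shows "to_fract (vandermonde N) * D1 N f = to_fract (D1_cleared N f)"
proof -
  have "D1 N f = (\<Sum>s\<in>var_pairs N. to_fract (mvar (fst s) * theta (fst s) f) / to_fract (mvar (fst s) - mvar (snd s)))"
    unfolding D1_def var_pairs_def
    by (subst sum.Sigma) (auto intro!: sum.cong D1_term simp del: to_fract_mult to_fract_diff)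
  then have "to_fract (vandermonde N) * D1 N f = (\<Sum>s\<in>var_pairs N. to_fract (vandermonde N) *
      (to_fract (mvar (fst s) * theta (fst s) f) / to_fract (mvar (fst s) - mvar (snd s))))"
    by (simp only: sum_distrib_left)
  also have "\<dots> = (\<Sum>s\<in>var_pairs N. to_fract ((mvar (fst s) * (\<Prod>(i, j)\<in>var_pairs N - {s}. mvar i - mvar j)) * theta (fst s) f))"
  proof (intro sum.cong refl)
    fix s assume s: "s \<in> var_pairs N"
    let ?R = "\<Prod>(i, j)\<in>var_pairs N - {s}. mvar i - mvar j :: 'a mpoly"
    have v: "vandermonde N = (mvar (fst s) - mvar (snd s)) * ?R"
      unfolding vandermonde_def using prod.remove[OF finite_var_pairs s, of "\<lambda>(i, j). mvar i - mvar j :: 'a mpoly"]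
      by (simp add: split_def)
    have "to_fract (mvar (fst s) - mvar (snd s)) \<noteq> (0 :: 'a mpoly fract)"
      using s by (auto simp: var_pairs_def mvar_eq_iff simp del: to_fract_diff)
    then show "to_fract (vandermonde N) *
      (to_fract (mvar (fst s) * theta (fst s) f) / to_fract (mvar (fst s) - mvar (snd s))) =
      to_fract ((mvar (fst s) * ?R) * theta (fst s) f)"
      unfolding v to_fract_mult by (simp add: divide_simps mult_ac del: to_fract_diff)
  qed
  finally show ?thesis by (simp only: D1_cleared_def to_fract_sum)
qed

definition theta_op :: "nat \<Rightarrow> 'a::comm_ring_1 mpoly \<Rightarrow> 'a mpoly" where
  "theta_op N f = (\<Sum>i<N. theta i (theta i f) - theta i f)"

lemma vandermonde_D_alpha:
  "to_fract (vandermonde N) * D_alpha N f =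
    to_fract (D1_cleared N f + vandermonde N * (mconst (alpha / 2) * theta_op N f))"
proof -
  have "mconst alpha * (mconst (1 / 2) * g) = mconst (alpha / 2) * g" for g :: "rat ratfun mpoly"
    by (simp add: mconst_def mult_single flip: mult.assoc)
  then show ?thesis
    unfolding D_alpha_def ring_distribs vandermonde_D1 D2_eq theta_op_def[symmetric]
      to_fract_mult[symmetric] to_fract_add[symmetric] by (simp only:)
qed

text \<open>
  Here \<open>V + d h theta_op\<close> stands for \<open>D\<^sub>\<alpha>\<close> multiplied by the common denominator \<open>d\<close>, and \<open>sum (c j) I\<close>
  for the part \<open>\<lambda>\<^sup>I\<^sub>j\<close>. The quadratic terms come from \<open>\<theta>\<^sup>2 F = (\<theta>\<^sup>2 K + (\<theta> K)\<^sup>2) F\<close> for a derivation \<open>\<theta>\<close>.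
\<close>

lemma log_eigen_equation:
  fixes F K :: "('i, 'a::comm_ring_1 mpoly) setfun" and c :: "'j \<Rightarrow> 'i \<Rightarrow> 'a mpoly" and d h :: "'a mpoly"
  assumes log: "is_log F K" and V: "derivation V"
    and eq: "\<And>I. finite I \<Longrightarrow> V (set_coeff F I) + d * (h * theta_op N (set_coeff F I)) =
      d * ((h * (\<Sum>j\<in>M. sum (c j) I * sum (c j) I - sum (c j) I) + sum l I) * set_coeff F I)"
    and I: "finite I"
  shows "V (set_coeff K I) + d * (h * theta_op N (set_coeff K I)) =
      d * ((h * (\<Sum>j\<in>M. sum (c j) I * sum (c j) I - sum (c j) I) + sum l I) * set_coeff K I) +
      d * (h * set_coeff ((\<Sum>j\<in>M. weight_setfun (c j) K * weight_setfun (c j) K) -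
        (\<Sum>i<N. map_setfun (theta i) K * map_setfun (theta i) K)) I)"
proof -
  have F1: "set_coeff F {} = 1" and K0: "set_coeff K {} = 0"
    using log by (auto simp: is_log_def)
  have map_log: "map_setfun D F = map_setfun D K * F" if D: "derivation D" for D
    using log derivation_map_setfun[OF D]
    by (rule is_log_derivation)
      (simp_all add: delta_map_setfun derivation_0[OF D] map_setfun.rep_eq F1 K0 derivation_1[OF D])
  have weight_log: "weight_setfun b F = weight_setfun b K * F" for b
    using log derivation_weight_setfun
    by (rule is_log_derivation) (simp_all add: delta_weight_setfun weight_setfun.rep_eq)
  have map_log2: "map_setfun D (map_setfun D F) = (map_setfun D (map_setfun D K) + map_setfun D K * map_setfun D K) * F"
    if D: "derivation D" for D
    by (rule derivation_twice_log[OF derivation_map_setfun[OF D] map_log[OF D]])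
  have weight_log2: "weight_setfun b (weight_setfun b F) =
      (weight_setfun b (weight_setfun b K) + weight_setfun b K * weight_setfun b K) * F" for b
    by (rule derivation_twice_log[OF derivation_weight_setfun weight_log])
  define T where "T G = (\<Sum>i<N. map_setfun (theta i) (map_setfun (theta i) G) - map_setfun (theta i) G)"
    for G :: "('i, 'a mpoly) setfun"
  define B where "B G = (\<Sum>j\<in>M. weight_setfun (c j) (weight_setfun (c j) G) - weight_setfun (c j) G)"
    for G :: "('i, 'a mpoly) setfun"
  have T: "set_coeff (T G) I = theta_op N (set_coeff G I)" if "finite I" for G I
    using that by (simp add: T_def theta_op_def set_coeff_sum map_setfun.rep_eq)
  have B: "set_coeff (B G) I = (\<Sum>j\<in>M. sum (c j) I * sum (c j) I - sum (c j) I) * set_coeff G I" for G I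
    unfolding B_def set_coeff_sum minus_setfun.rep_eq weight_setfun.rep_eq sum_distrib_right[of _ M]
    by (intro sum.cong refl) (simp only: left_diff_distrib mult.assoc)
  define \<Theta> where "\<Theta> = (\<Sum>i<N. map_setfun (theta i) K * map_setfun (theta i) K)"
  define \<Psi> where "\<Psi> = (\<Sum>j\<in>M. weight_setfun (c j) K * weight_setfun (c j) K)"
  have TF: "T F = (T K + \<Theta>) * F"
    unfolding T_def \<Theta>_def sum.distrib[symmetric] sum_distrib_right
    by (intro sum.cong refl) (simp only: map_log2[OF derivation_theta], simp only: map_log[OF derivation_theta], simp add: algebra_simps)
  have BF: "B F = (B K + \<Psi>) * F"
    unfolding B_def \<Psi>_def sum.distrib[symmetric] sum_distrib_right
    by (intro sum.cong refl) (simp only: weight_log2, simp only: weight_log, simp add: algebra_simps)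
  let ?d = "const_setfun d" and ?h = "const_setfun h"
  have "map_setfun V F + ?d * (?h * T F) = ?d * (?h * B F + weight_setfun l F)"
    by (rule setfun_eqI)
      (simp add: map_setfun.rep_eq set_coeff_const_mult T B weight_setfun.rep_eq eq ring_distribs mult.assoc)
  \<comment> \<open>Every term of the equation for F is now a multiple of F; cancelling F leaves the
    equation for K.\<close>
  then have "(map_setfun V K + ?d * (?h * (T K + \<Theta>)) - ?d * (?h * (B K + \<Psi>) + weight_setfun l K)) * F = 0"
    unfolding TF BF map_log[OF V] weight_log[of l] by (simp add: algebra_simps)
  then have "map_setfun V K + ?d * (?h * (T K + \<Theta>)) - ?d * (?h * (B K + \<Psi>) + weight_setfun l K) = 0"
    using F1 by (rule setfun_cancel)
  then have "set_coeff (map_setfun V K + ?d * (?h * (T K + \<Theta>)) - ?d * (?h * (B K + \<Psi>) + weight_setfun l K)) I = 0"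
    by (simp only: zero_setfun.rep_eq)
  then have "V (set_coeff K I) + d * (h * (theta_op N (set_coeff K I) + set_coeff \<Theta> I)) -
      d * (h * ((\<Sum>j\<in>M. sum (c j) I * sum (c j) I - sum (c j) I) * set_coeff K I + set_coeff \<Psi> I) +
        sum l I * set_coeff K I) = 0"
    by (simp only: plus_setfun.rep_eq minus_setfun.rep_eq map_setfun.rep_eq set_coeff_const_mult
        T[OF I] B weight_setfun.rep_eq I if_True)
  then show ?thesis
    unfolding \<Theta>_def[symmetric] \<Psi>_def[symmetric] minus_setfun.rep_eq by (simp add: algebra_simps)
qed

section \<open>Orders of vanishing of coefficients\<close>

definition O_mpoly :: "int \<Rightarrow> rat ratfun mpoly \<Rightarrow> bool" where
  "O_mpoly k f \<longleftrightarrow> (\<forall>m. is_O_alpha (lookup f m) k)"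

lemma lookup_times_sum:
  fixes f g :: "'a::comm_ring_1 mpoly"
  shows "lookup (f * g) m = (\<Sum>a\<in>keys f. \<Sum>b\<in>keys g. if a + b = m then lookup f a * lookup g b else 0)"
proof -
  have "f * g = (\<Sum>a\<in>keys f. Poly_Mapping.single a (lookup f a)) * (\<Sum>b\<in>keys g. Poly_Mapping.single b (lookup g b))"
    by (simp flip: poly_mapping_sum_single)
  also have "\<dots> = (\<Sum>a\<in>keys f. \<Sum>b\<in>keys g. Poly_Mapping.single (a + b) (lookup f a * lookup g b))"
    by (simp add: sum_product mult_single)
  finally show ?thesis by (simp add: lookup_sum lookup_single when_def)
qed

lemma O_mpoly_mult: "O_mpoly k f \<Longrightarrow> O_mpoly l g \<Longrightarrow> O_mpoly (k + l) (f * g)"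
  unfolding O_mpoly_def lookup_times_sum
  by (intro allI is_O_alpha_sum) (auto intro: is_O_alpha_mult)

lemma O_mpoly_sum: "(\<And>x. x \<in> A \<Longrightarrow> O_mpoly k (f x)) \<Longrightarrow> O_mpoly k (sum f A)"
  unfolding O_mpoly_def lookup_sum by (auto intro: is_O_alpha_sum)

lemma O_mpoly_diff: "O_mpoly k f \<Longrightarrow> O_mpoly k g \<Longrightarrow> O_mpoly k (f - g)"
  unfolding O_mpoly_def lookup_minus by (auto intro: is_O_alpha_diff)

lemma O_mpoly_theta: "O_mpoly k f \<Longrightarrow> O_mpoly k (theta i f)"
  unfolding O_mpoly_def theta.rep_eq by (auto intro: is_O_alpha_scale no_pole_at_0_of_nat)

lemma O_mpoly_0: "O_mpoly k 0"
  by (simp add: O_mpoly_def)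

lemma lookup_of_nat_mult: "lookup (of_nat n * f) m = of_nat n * lookup (f :: 'a::comm_ring_1 mpoly) m"
  by (induction n) (simp_all add: ring_distribs lookup_add)

lemma lookup_of_int_mult: "lookup (of_int n * f) m = of_int n * lookup (f :: 'a::comm_ring_1 mpoly) m"
  by (cases n) (simp_all add: lookup_of_nat_mult left_diff_distrib lookup_minus)

lemma O_mpoly_of_nat_mult: "O_mpoly k f \<Longrightarrow> O_mpoly k (of_nat n * f)"
  unfolding O_mpoly_def lookup_of_nat_mult by (auto intro: is_O_alpha_scale no_pole_at_0_of_nat)

section \<open>Top exponents in the dominance order\<close>

definition below :: "(nat \<Rightarrow>\<^sub>0 nat) \<Rightarrow> 'a::zero mpoly \<Rightarrow> bool" where
  "below p f \<longleftrightarrow> (\<forall>m\<in>keys f. weight m = weight p \<and> (\<forall>k. psum k m \<le> psum k p))"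

text \<open>If a + b = p + q and the partial sums of a and b are bounded by those of p and q, all
  bounds are equalities; the top exponent arises in one way only.\<close>

lemma below_mult:
  fixes f g :: "'a::comm_ring_1 mpoly"
  assumes "below p f" "below q g"
  shows "below (p + q) (f * g)" and "lookup (f * g) (p + q) = lookup f p * lookup g q"
proof -
  show "below (p + q) (f * g)"
    unfolding below_def
  proof
    fix m assume "m \<in> keys (f * g)"
    then obtain a b where "a \<in> keys f" "b \<in> keys g" "m = a + b" using subsetD[OF keys_mult] by blast
    then show "weight m = weight (p + q) \<and> (\<forall>k. psum k m \<le> psum k (p + q))"
      using assms by (auto simp: below_def weight_add psum_add intro!: add_mono)
  qed
  have "a = p \<and> b = q" if "a \<in> keys f" "b \<in> keys g" "a + b = p + q" for a b
  proof -
    have le: "psum k a \<le> psum k p" "psum k b \<le> psum k q" for k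
      using assms that by (auto simp: below_def)
    have eq: "psum k a + psum k b = psum k p + psum k q" for k
      using that(3) by (simp flip: psum_add)
    have "psum k a = psum k p" "psum k b = psum k q" for k
      using le[of k] eq[of k] by linarith+
    then show ?thesis using psum_eqI by blast
  qed
  then have "lookup (f * g) (p + q) =
      (\<Sum>a\<in>keys f. \<Sum>b\<in>keys g. if a = p then if b = q then lookup f p * lookup g q else 0 else 0)"
    unfolding lookup_times_sum by (intro sum.cong refl) auto
  also have "\<dots> = (\<Sum>a\<in>keys f. if a = p then lookup f p * lookup g q else 0)"
    by (intro sum.cong refl) (auto simp: in_keys_iff)
  also have "\<dots> = lookup f p * lookup g q"
    by (auto simp: in_keys_iff)
  finally show "lookup (f * g) (p + q) = lookup f p * lookup g q" .
qed

lemma below_prod: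
  fixes f :: "'b \<Rightarrow> 'a::comm_ring_1 mpoly"
  assumes "finite A" "\<And>x. x \<in> A \<Longrightarrow> below (p x) (f x)"
  shows "below (sum p A) (prod f A) \<and> lookup (prod f A) (sum p A) = (\<Prod>x\<in>A. lookup (f x) (p x))"
  using assms
proof (induction A)
  case empty
  then show ?case by (auto simp: below_def lookup_one)
next
  case (insert x A)
  then show ?case using below_mult[of "p x" "f x" "sum p A" "prod f A"] by simp
qed

text \<open>For every set partition of I the block sums add up to the same exponent
  \<open>sum lam I\<close>, so taking the top coefficient commutes with the products and sums in the
  cumulant.\<close>

lemma below_cumulant:
  fixes J :: "'i set \<Rightarrow> 'a::comm_ring_1 mpoly" and lam :: "'i \<Rightarrow> nat \<Rightarrow>\<^sub>0 nat"
  assumes I: "finite I" and J: "\<And>B. B \<subseteq> I \<Longrightarrow> below (sum lam B) (J B)"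
  shows "below (sum lam I) (cumulant J I)"
    and "lookup (cumulant J I) (sum lam I) = cumulant (\<lambda>B. lookup (J B) (sum lam B)) I"
proof -
  have *: "below (sum lam I) (\<Prod>B\<in>P. J B) \<and>
      lookup (\<Prod>B\<in>P. J B) (sum lam I) = (\<Prod>B\<in>P. lookup (J B) (sum lam B))" if P: "partition_on I P" for P
  proof -
    have "sum lam I = (\<Sum>B\<in>P. sum lam B)"
      using sum.Union_disjoint[of P lam] P I finite_elements[OF I P]
      by (auto simp: partition_on_def disjoint_def intro: finite_subset)
    then show ?thesis
      using below_prod[of P "sum lam" J] finite_elements[OF I P] J P by (auto simp: partition_on_def)
  qed
  show "below (sum lam I) (cumulant J I)"
    unfolding below_def
  proof
    fix m assume "m \<in> keys (cumulant J I)"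
    then obtain P where "partition_on I P" "lookup (\<Prod>B\<in>P. J B) m \<noteq> 0"
      unfolding in_keys_iff cumulant_def lookup_sum lookup_of_int_mult
      by (metis (mono_tags, lifting) mem_Collect_eq mult_zero_right sum.neutral)
    then show "weight m = weight (sum lam I) \<and> (\<forall>k. psum k m \<le> psum k (sum lam I))"
      using * by (simp add: below_def in_keys_iff)
  qed
  show "lookup (cumulant J I) (sum lam I) = cumulant (\<lambda>B. lookup (J B) (sum lam B)) I"
    unfolding cumulant_def lookup_sum lookup_of_int_mult using * by (intro sum.cong) auto
qed

lemma is_sym_poly_prod:
  "(\<And>x. x \<in> A \<Longrightarrow> is_sym_poly N (f x)) \<Longrightarrow> is_sym_poly N (prod f A :: 'a::comm_ring_1 mpoly)"
  by (induction A rule: infinite_finite_induct) (auto simp: is_sym_poly_1 is_sym_poly_mult)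

lemma is_sym_poly_of_int_mult:
  "is_sym_poly N f \<Longrightarrow> is_sym_poly N (of_int c * f :: 'a::comm_ring_1 mpoly)"
  by (rule is_sym_poly_scaled[of N f _ "\<lambda>_. of_int c"]) (simp_all add: lookup_of_int_mult)

lemma is_sym_poly_cumulant:
  "(\<And>B. is_sym_poly N (J B)) \<Longrightarrow> is_sym_poly N (cumulant J I :: 'a::comm_ring_1 mpoly)"
  unfolding cumulant_def by (intro is_sym_poly_sum is_sym_poly_of_int_mult is_sym_poly_prod)

lemma below_jack_sum: assumes "is_partition p" shows "below p (jack_sum p N)"
  unfolding below_def
proof
  fix m assume "m \<in> keys (jack_sum p N)"
  then have "jack_coeff p (sort_part m) \<noteq> 0"
    by (auto simp: in_keys_iff lookup_jack_sum[OF assms] split: if_splits)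
  then have "sort_part m = p \<or> strictly_dominates p (sort_part m)"
    using jack_coeff_eq_0[of "sort_part m" p] by blast
  then show "weight m = weight p \<and> (\<forall>k. psum k m \<le> psum k p)"
    using psum_sort_part[of _ m] weight_sort_part[of m]
    by (auto simp: strictly_dominates_psum intro: order_trans)
qed

lemma jack_sum_0: "jack_sum 0 N = 1"
proof (rule poly_mapping_eqI)
  fix m
  have 0: "is_partition 0" by (simp add: is_partition_def)
  have w0: "q = 0" if "weight q = 0" for q
    using that by (intro poly_mapping_eqI) (metis le_zero_eq lookup_le_weight lookup_zero)
  have "jack_coeff 0 (sort_part m) = (if m = 0 then 1 else 0)"
  proof (cases "m = 0")
    case True
    then show ?thesis by (simp add: sort_part_partition[OF 0] jack_coeff_self hook_alpha_0)
  next
    case False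
    then have "weight (sort_part m) \<noteq> 0" using w0[of m] by (auto simp: weight_sort_part)
    then have "\<not> (sort_part m = 0 \<or> is_partition (sort_part m) \<and> strictly_dominates 0 (sort_part m))"
      by (auto simp: strictly_dominates_def weight_def)
    then show ?thesis using False jack_coeff_eq_0 by simp
  qed
  then show "lookup (jack_sum 0 N) m = lookup 1 m"
    by (auto simp: lookup_jack_sum[OF 0] lookup_one when_def)
qed

lemma keys_sum_subset:
  fixes lam :: "'i \<Rightarrow> nat \<Rightarrow>\<^sub>0 nat"
  shows "(\<And>i. i \<in> I \<Longrightarrow> keys (lam i) \<subseteq> S) \<Longrightarrow> keys (sum lam I) \<subseteq> S"
proof (induction I rule: infinite_finite_induct)
  case (insert i I)
  then show ?case by (simp add: keys_add_nat)
qed simp_all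

lemma n_stat_sum:
  assumes "\<And>i. i \<in> I \<Longrightarrow> keys (lam i) \<subseteq> {..<N}"
  shows "n_stat (sum lam I) = (\<Sum>i\<in>I. n_stat (lam i))"
proof -
  have "n_stat (sum lam I) = (\<Sum>a<N. \<Sum>i\<in>I. a * lookup (lam i) a)"
    by (simp add: n_stat_superset[OF _ keys_sum_subset[OF assms]] lookup_sum sum_distrib_left)
  also have "\<dots> = (\<Sum>i\<in>I. \<Sum>a<N. a * lookup (lam i) a)" by (rule sum.swap)
  also have "\<dots> = (\<Sum>i\<in>I. n_stat (lam i))"
    using assms by (intro sum.cong refl) (simp add: n_stat_superset[of "{..<N}"])
  finally show ?thesis .
qed

lemma weight_sum: "weight (sum lam I) = (\<Sum>i\<in>I. weight (lam i))"
proof (induction I rule: infinite_finite_induct)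
  case (insert i I)
  then show ?case by (simp add: weight_add)
qed (simp_all add: weight_def)

lemma mconst_mult: "mconst (a * b) = mconst a * (mconst b :: 'a::comm_ring_1 mpoly)"
  by (simp add: mconst_def mult_single)

lemma mconst_add: "mconst (a + b) = mconst a + (mconst b :: 'a::comm_ring_1 mpoly)"
  by (simp add: mconst_def single_add)

lemma mconst_of_nat: "mconst (of_nat n) = (of_nat n :: 'a::comm_ring_1 mpoly)"
  by (simp add: mconst_def)

lemma mconst_sum: "mconst (sum f A) = (\<Sum>x\<in>A. mconst (f x) :: 'a::comm_ring_1 mpoly)"
  by (induction A rule: infinite_finite_induct) (simp_all add: mconst_add, simp_all add: mconst_def)

text \<open>Twice b is the sum of the squares of the parts minus the parts, hence the \<alpha>/2;
  the other terms are additive in I. This is the shape that \<open>log_eigen_equation\<close> takes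
  as input.\<close>

lemma mconst_jack_eigenvalue:
  assumes lam: "\<And>i. is_partition (lam i)" "\<And>i. keys (lam i) \<subseteq> {..<N}"
  shows "mconst (jack_eigenvalue N (sum lam I)) = mconst (alpha / 2) *
      (\<Sum>j<N. (\<Sum>i\<in>I. of_nat (lookup (lam i) j)) * (\<Sum>i\<in>I. of_nat (lookup (lam i) j)) - (\<Sum>i\<in>I. of_nat (lookup (lam i) j))) +
      (\<Sum>i\<in>I. mconst ((of_nat N - 1) * of_nat (weight (lam i)) - of_nat (n_stat (lam i))))"
proof -
  let ?p = "sum lam I"
  have keys: "keys ?p \<subseteq> {..<N}" by (intro keys_sum_subset lam(2))
  have "jack_eigenvalue N ?p = alpha / 2 * (2 * of_nat (b_stat ?p)) +
      (\<Sum>i\<in>I. (of_nat N - 1) * of_nat (weight (lam i)) - of_nat (n_stat (lam i)))"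
    by (simp add: jack_eigenvalue_eq is_partition_sum lam(1) weight_sum n_stat_sum[of I lam, OF lam(2)]
        sum_subtractf sum_distrib_left)
  also have "2 * of_nat (b_stat ?p) = (of_nat (2 * b_stat ?p) :: rat ratfun)" by simp
  finally have "mconst (jack_eigenvalue N ?p) = mconst (alpha / 2) * of_nat (2 * b_stat ?p) +
      (\<Sum>i\<in>I. mconst ((of_nat N - 1) * of_nat (weight (lam i)) - of_nat (n_stat (lam i))))"
    by (simp only: mconst_add mconst_mult mconst_sum mconst_of_nat)
  also have "(of_nat (2 * b_stat ?p) :: rat ratfun mpoly) = 2 * of_nat (b_stat ?p)" by simp
  also have "\<dots> = (\<Sum>j<N. (\<Sum>i\<in>I. of_nat (lookup (lam i) j)) * (\<Sum>i\<in>I. of_nat (lookup (lam i) j)) - (\<Sum>i\<in>I. of_nat (lookup (lam i) j)))"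
    unfolding two_b_stat[OF keys] by (simp only: lookup_sum of_nat_sum)
  finally show ?thesis .
qed

lemma no_pole_at_0_half: "no_pole_at_0 (1 / 2 :: rat ratfun)"
proof -
  have "(2 :: rat ratfun) = to_fract [:2:]"
    by (simp add: to_fract_def flip: numeral_poly) (metis Fract_of_nat_eq of_nat_numeral)
  then have "(1 / 2 :: rat ratfun) = Fraction_Field.Fract 1 [:2:]"
    by (simp add: Fract_conv_to_fract)
  then show ?thesis unfolding no_pole_at_0_def by (intro exI[of _ 1] exI[of _ "[:2:]"]) simp
qed

lemma O_mpoly_alpha_half:
  assumes "O_mpoly k f" shows "O_mpoly (k + 1) (mconst (alpha / 2) * f)"
proof -
  have "is_O_alpha (1 / 2 * (alpha * lookup f m)) (1 + k)" for m
    using assms by (intro is_O_alpha_scale[OF no_pole_at_0_half] is_O_alpha_mult[OF is_O_alpha_alpha]) (simp add: O_mpoly_def)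
  then show ?thesis
    by (simp add: O_mpoly_def lookup_mconst_mult add.commute)
qed

text \<open>Two inductions are nested: over I for the bilinear terms Q and, for fixed I, over
  exponents downwards from \<open>sum lam I\<close>.\<close>

lemma O_mpoly_jack_cumulant:
  fixes lam :: "'i \<Rightarrow> nat \<Rightarrow>\<^sub>0 nat"
  assumes lam: "\<And>i. is_partition (lam i)" "\<And>i. keys (lam i) \<subseteq> {..<N}"
    and I: "finite I" "I \<noteq> {}"
  shows "O_mpoly (int (card I) - 1) (cumulant (\<lambda>B. jack_sum (sum lam B) N) I)"
  using I
proof (induction I rule: finite_psubset_induct)
  case (psubset I)
  define J where "J = (\<lambda>B. jack_sum (sum lam B) N)"
  define K where "K = cumulant_setfun J"
  have part: "is_partition (sum lam B)" for B by (rule is_partition_sum[OF lam(1)])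
  have keysB: "keys (sum lam B) \<subseteq> {..<N}" for B by (intro keys_sum_subset lam(2))
  have J0: "J {} = 1" by (simp add: J_def jack_sum_0)
  have log: "is_log (setfun_of J) K" unfolding K_def by (rule is_log_cumulant[of J, OF J0])
  have K0: "set_coeff K {} = 0" using log by (simp add: is_log_def)
  have K: "set_coeff K A = cumulant J A" if "finite A" "A \<noteq> {}" for A
    using that by (simp add: K_def cumulant_setfun_def setfun_of.rep_eq)
  define c where "c = (\<lambda>j i. of_nat (lookup (lam i) j) :: rat ratfun mpoly)"
  define l where "l = (\<lambda>i. mconst ((of_nat N - 1) * of_nat (weight (lam i)) - of_nat (n_stat (lam i))) :: rat ratfun mpoly)"
  define h :: "rat ratfun mpoly" where "h = mconst (alpha / 2)"
  define d :: "rat ratfun mpoly" where "d = vandermonde N"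
  define Q where "Q = set_coeff ((\<Sum>j<N. weight_setfun (c j) K * weight_setfun (c j) K) -
        (\<Sum>i<N. map_setfun (theta i) K * map_setfun (theta i) K)) I"
  define p where "p = sum lam I"
  define \<kappa> where "\<kappa> = cumulant J I"
  have \<kappa>: "set_coeff K I = \<kappa>" using K psubset by (simp add: \<kappa>_def)
  have eig: "h * (\<Sum>j<N. sum (c j) B * sum (c j) B - sum (c j) B) + sum l B = mconst (jack_eigenvalue N (sum lam B))" for B
    unfolding mconst_jack_eigenvalue[OF lam] h_def c_def l_def ..
  have V: "D1_cleared N (J B) + d * (h * theta_op N (J B)) = d * (mconst (jack_eigenvalue N (sum lam B)) * J B)" for B
  proof -
    have "D_alpha N (J B) = to_fract (mconst (jack_eigenvalue N (sum lam B)) * J B)"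
      using is_jack_poly_jack_sum[OF part, of N B] by (simp only: is_jack_poly_def J_def)
    then have "to_fract (D1_cleared N (J B) + d * (h * theta_op N (J B))) =
        to_fract (d * (mconst (jack_eigenvalue N (sum lam B)) * J B))"
      unfolding d_def h_def vandermonde_D_alpha[symmetric] to_fract_mult[of "vandermonde N"] by (simp only:)
    then show ?thesis by (simp only: to_fract_eq_iff)
  qed
  have "D1_cleared N \<kappa> + d * (h * theta_op N \<kappa>) = d * (mconst (jack_eigenvalue N p) * \<kappa>) + d * (h * Q)"
    unfolding p_def Q_def \<kappa>[symmetric] eig[symmetric]
    by (rule log_eigen_equation[OF log derivation_D1_cleared _ psubset.hyps]) (simp only: setfun_of.rep_eq if_True eig V)
  then have "to_fract d * D_alpha N \<kappa> = to_fract (d * (mconst (jack_eigenvalue N p) * \<kappa> + h * Q))"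
    unfolding d_def h_def vandermonde_D_alpha by (simp only: to_fract_eq_iff distrib_left)
  then have "to_fract d * D_alpha N \<kappa> = to_fract d * to_fract (mconst (jack_eigenvalue N p) * \<kappa> + h * Q)"
    by (simp only: to_fract_mult)
  moreover have "to_fract d \<noteq> 0" unfolding d_def to_fract_eq_0_iff by (rule vandermonde_nonzero)
  ultimately have D: "D_alpha N \<kappa> = to_fract (mconst (jack_eigenvalue N p) * \<kappa> + h * Q)"
    by (simp only: mult_cancel_left) simp
  have "O_mpoly (int (card I) - 2) Q"
  proof -
    \<comment> \<open>Here f and g stand for \<open>theta i\<close> or multiplication by a natural
      number. The extreme terms vanish as K has constant term 0; in the others both factors fall
      under the induction hypothesis.\<close>
    have small: "O_mpoly (int (card I) - 2) (f (set_coeff K A) * g (set_coeff K (I - A)))"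
      if "A \<in> Pow I" "\<And>k u. O_mpoly k u \<Longrightarrow> O_mpoly k (f u)" "\<And>k u. O_mpoly k u \<Longrightarrow> O_mpoly k (g u)" "f 0 = 0" "g 0 = 0"
      for A f g
    proof (cases "A = {} \<or> A = I")
      case True
      then have "f (set_coeff K A) = 0 \<or> g (set_coeff K (I - A)) = 0" using K0 that by auto
      then show ?thesis using O_mpoly_0 by auto
    next
      case False
      then have A: "A \<subset> I" "I - A \<subset> I" "A \<noteq> {}" "I - A \<noteq> {}" "finite A" "finite (I - A)"
        using that psubset.hyps by (auto intro: finite_subset)
      have "O_mpoly (int (card A) - 1) (set_coeff K A)"
        unfolding K[OF A(5,3)] J_def using A(1,3) by (rule psubset.IH)
      moreover have "O_mpoly (int (card (I - A)) - 1) (set_coeff K (I - A))"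
        unfolding K[OF A(6,4)] J_def using A(2,4) by (rule psubset.IH)
      ultimately have "O_mpoly ((int (card A) - 1) + (int (card (I - A)) - 1)) (f (set_coeff K A) * g (set_coeff K (I - A)))"
        using that by (intro O_mpoly_mult)
      moreover have "card I = card A + card (I - A)"
        using A psubset.hyps by (metis card_Un_disjoint Diff_disjoint Un_Diff_cancel psubset_imp_subset sup.absorb2)
      ultimately show ?thesis by simp
    qed
    have weight_op: "set_coeff (weight_setfun (c j) K) A = of_nat (\<Sum>i\<in>A. lookup (lam i) j) * set_coeff K A" for j A
      by (simp add: weight_setfun.rep_eq c_def)
    have "O_mpoly (int (card I) - 2) (set_coeff (weight_setfun (c j) K * weight_setfun (c j) K) I)" for j
      unfolding set_coeff_times weight_op
      by (intro O_mpoly_sum small[where f = "\<lambda>u. of_nat _ * u" and g = "\<lambda>u. of_nat _ * u"] O_mpoly_of_nat_mult) simp_all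
    moreover have "O_mpoly (int (card I) - 2) (set_coeff (map_setfun (theta i) K * map_setfun (theta i) K) I)" for i
      unfolding set_coeff_times
    proof (rule O_mpoly_sum)
      fix A assume A: "A \<in> Pow I"
      then have "set_coeff (map_setfun (theta i) K) A = theta i (set_coeff K A)"
        "set_coeff (map_setfun (theta i) K) (I - A) = theta i (set_coeff K (I - A))"
        using psubset.hyps by (auto simp: map_setfun.rep_eq finite_subset)
      then show "O_mpoly (int (card I) - 2) (set_coeff (map_setfun (theta i) K) A * set_coeff (map_setfun (theta i) K) (I - A))"
        using small[OF A, of "theta i" "theta i"] by (simp add: O_mpoly_theta derivation_0[OF derivation_theta])
    qed
    ultimately show ?thesis
      unfolding Q_def minus_setfun.rep_eq set_coeff_sum by (intro O_mpoly_diff O_mpoly_sum)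
  qed
  then have hQ: "O_mpoly (int (card I) - 1) (h * Q)"
    using O_mpoly_alpha_half[of "int (card I) - 2" Q] by (simp add: h_def)
  have sym: "is_sym_poly N \<kappa>"
    unfolding \<kappa>_def J_def by (intro is_sym_poly_cumulant is_sym_poly_jack_sum)
  have belowJ: "below (sum lam B) (J B)" for B unfolding J_def by (intro below_jack_sum part)
  have below: "below p \<kappa>" unfolding p_def \<kappa>_def by (rule below_cumulant(1)[OF psubset.hyps belowJ])
  have lead: "is_O_alpha (lookup \<kappa> p) (int (card I) - 1)"
  proof -
    have "lookup (J B) (sum lam B) = hook_alpha (sum lam B)" for B
      using keysB[of B] by (simp add: J_def lookup_jack_sum[OF part] sort_part_partition[OF part] jack_coeff_self)
    then have "lookup \<kappa> p = cumulant (\<lambda>B. hook_alpha (sum lam B)) I"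
      unfolding p_def \<kappa>_def by (simp add: below_cumulant(2)[OF psubset.hyps belowJ])
    then show ?thesis using is_O_alpha_cumulant_hook[OF psubset.hyps psubset.prems lam(1)] by simp
  qed
  obtain P where P: "D_alpha N \<kappa> = to_fract P"
    "\<And>m. keys m \<subseteq> {..<N} \<Longrightarrow> lookup P m =
      (alpha * of_nat (b_stat m) - of_nat (n_stat m) + (of_nat N - 1) * of_nat (weight m)) * lookup \<kappa> m +
      offdiag N \<kappa> m"
    using D_alpha_sym_poly[OF sym] by blast
  have "to_fract P = to_fract (mconst (jack_eigenvalue N p) * \<kappa> + h * Q)" using P(1) D by (simp only:)
  then have PE: "P = mconst (jack_eigenvalue N p) * \<kappa> + h * Q" by (simp only: to_fract_eq_iff)
  have ev: "jack_eigenvalue N p = alpha * of_nat (b_stat p) - of_nat (n_stat p) + (of_nat N - 1) * of_nat (weight p)"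
    unfolding p_def by (rule jack_eigenvalue_eq[OF part])
  have main: "is_O_alpha (lookup \<kappa> q) (int (card I) - 1)" if "is_partition q" "keys q \<subseteq> {..<N}" for q
    using that
  proof (induction "n_stat q" arbitrary: q rule: less_induct)
    case less
    note q = less.prems
    show ?case
    proof (cases "q \<in> keys \<kappa> \<and> q \<noteq> p")
      case False
      then show ?thesis using lead by (auto simp: in_keys_iff)
    next
      case True
      then have dom: "strictly_dominates p q" and w: "weight q = weight p"
        using below by (auto simp: below_def strictly_dominates_psum)
      let ?e = "alpha * (of_nat (b_stat p) - of_nat (b_stat q)) + (of_nat (n_stat q) - of_nat (n_stat p)) :: rat ratfun"
      have "is_O_alpha (offdiag_sorted (lookup \<kappa>) q) (int (card I) - 1)"
        unfolding offdiag_sorted_def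
      proof (intro is_O_alpha_sum is_O_alpha_scale)
        fix j i k assume ijk: "j \<in> {..<part_length q}" "i \<in> {..<j}" "k \<in> {1..lookup q j}"
        show "no_pole_at_0 (of_nat (lookup q i + 2 * k) - of_nat (lookup q j) :: rat ratfun)"
          using no_pole_at_0_of_int[of "int (lookup q i + 2 * k) - int (lookup q j)", where 'r = rat] by simp
        from ijk have "i < N" "i \<noteq> j" using q by (auto simp: keys_partition)
        then have "keys (sort_part (shift i j k q)) \<subseteq> {..<N}" using q by (intro keys_sort_part keys_shift)
        moreover have "n_stat (sort_part (shift i j k q)) < n_stat q"
          using ijk by (intro strictly_dominates_n_stat shift_dominates) auto
        ultimately show "is_O_alpha (lookup \<kappa> (sort_part (shift i j k q))) (int (card I) - 1)"
          by (intro less.hyps is_partition_sort_part)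
      qed
      moreover have "is_O_alpha (lookup (h * Q) q) (int (card I) - 1)" using hQ by (simp add: O_mpoly_def)
      ultimately have "is_O_alpha (inverse ?e * (offdiag_sorted (lookup \<kappa>) q - lookup (h * Q) q)) (int (card I) - 1)"
        by (intro is_O_alpha_scale is_O_alpha_diff linear_unit(1) strictly_dominates_n_stat dom)
      \<comment> \<open>Coefficient of the cumulant's equation at q; the terms with N cancel because
        the weights agree.\<close>
      moreover have eq: "?e * lookup \<kappa> q = offdiag_sorted (lookup \<kappa>) q - lookup (h * Q) q"
        using P(2)[OF q(2)] unfolding PE lookup_add lookup_mconst_mult ev w offdiag_sym_poly[OF sym q]
        by (simp add: algebra_simps)
      have "lookup \<kappa> q = inverse ?e * (offdiag_sorted (lookup \<kappa>) q - lookup (h * Q) q)"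
        unfolding eq[symmetric] mult.assoc[symmetric]
          left_inverse[OF linear_unit(2)[OF strictly_dominates_n_stat[OF dom]]] mult_1_left ..
      ultimately show ?thesis by simp
    qed
  qed
  have "is_O_alpha (lookup \<kappa> m) (int (card I) - 1)" for m
  proof (cases "keys m \<subseteq> {..<N}")
    case True
    then show ?thesis
      using main[OF is_partition_sort_part keys_sort_part[OF True]] by (simp add: sym_poly_lookup_sort_part[OF sym True])
  next
    case False
    then have "m \<notin> keys \<kappa>" using sym by (auto simp: is_sym_poly_def)
    then show ?thesis by (simp add: in_keys_iff)
  qed
  then show ?case by (simp add: O_mpoly_def \<kappa>_def J_def)
qed

section \<open>Passage to symmetric functions and extension of scalars\<close>

lemma in_vars_cumulant:
  "in_vars (cumulant J I :: 'a::comm_ring_1 symfun) N = cumulant (\<lambda>B. in_vars (J B) N) I"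
proof -
  have uminus: "in_vars (- F) N = - in_vars F N" for F :: "'a symfun"
    by (simp add: uminus_symfun.rep_eq)
  have of_int: "in_vars (of_int n :: 'a symfun) N = of_int n" for n :: int
    by (cases n) (simp_all add: in_vars_of_nat uminus in_vars_add one_symfun.rep_eq
        del: minus_add_distrib)
  have sum: "in_vars (sum f A) N = (\<Sum>x\<in>A. in_vars (f x) N)" for f :: "'c \<Rightarrow> 'a symfun" and A
    by (induction A rule: infinite_finite_induct) (simp_all add: in_vars_add zero_symfun.rep_eq)
  have prod: "in_vars (prod f A) N = (\<Prod>x\<in>A. in_vars (f x) N)" for f :: "'c \<Rightarrow> 'a symfun" and A
    by (induction A rule: infinite_finite_induct) (simp_all add: in_vars_mult one_symfun.rep_eq)
  show ?thesis unfolding cumulant_def sum in_vars_mult of_int prod ..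
qed

lemma monomial_coeff_eq:
  assumes "part_length p \<le> N" "is_partition p"
  shows "monomial_coeff (F :: 'a::comm_ring_1 symfun) p = lookup (in_vars F N) p"
  using assms(1)
proof (induction N rule: dec_induct)
  case base
  then show ?case by (simp add: monomial_coeff_def)
next
  case (step N)
  have "restrict_vars N (in_vars F (Suc N)) = in_vars F N" using in_vars[of F] by simp
  then have "lookup (in_vars F N) p = lookup (in_vars F (Suc N)) p"
    using step keys_partition[OF assms(2)] by (metis lessThan_subset_iff lookup_restrict_vars)
  then show ?case using step by simp
qed

text \<open>After \<open>alpha ^ n\<close> is split off as a polynomial, the remaining denominator
  keeps its nonzero constant term under the injective map \<open>of_rat\<close>.\<close>

lemma is_O_alpha_extend_scalars:
  assumes "is_O_alpha c (int n)"
  shows "is_O_alpha (extend_scalars c :: 'r::field_char_0 ratfun) (int n)"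
proof -
  obtain u v where uv: "poly v 0 \<noteq> 0" "c * alpha powi (- int n) = Fraction_Field.Fract u v"
    using assms by (auto simp: is_O_alpha_def no_pole_at_0_def)
  have "v \<noteq> 0" using uv(1) by auto
  have "c = alpha ^ n * (c * alpha powi (- int n))"
    by (simp add: power_int_minus alpha_nonzero)
  also have "\<dots> = Fraction_Field.Fract (monom 1 n * u) v"
    unfolding uv(2) to_fract_monom[symmetric] by (simp add: to_fract_def)
  finally have "(extend_scalars c :: 'r ratfun) =
      Fraction_Field.Fract (map_poly of_rat (monom 1 n * u)) (map_poly of_rat v)"
    using extend_scalars_Fract[OF \<open>v \<noteq> 0\<close>] by simp
  also have "\<dots> = alpha ^ n * Fraction_Field.Fract (map_poly of_rat u) (map_poly of_rat v)"
    unfolding map_poly_of_rat_mult to_fract_monom[symmetric] by (simp add: to_fract_def map_poly_monom)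
  finally have eq: "(extend_scalars c :: 'r ratfun) =
      alpha ^ n * Fraction_Field.Fract (map_poly of_rat u) (map_poly of_rat v)" .
  have "poly (map_poly of_rat v) (0 :: 'r) \<noteq> 0"
    using uv(1) by (simp add: poly_0_coeff_0 coeff_map_poly)
  then have "no_pole_at_0 (Fraction_Field.Fract (map_poly of_rat u) (map_poly of_rat v) :: 'r ratfun)"
    by (auto simp: no_pole_at_0_def)
  then have "is_O_alpha (alpha ^ n * Fraction_Field.Fract (map_poly of_rat u) (map_poly of_rat v) :: 'r ratfun) (int n + 0)"
    using is_O_alpha_power_int[of "int n", where 'a = 'r] by (intro is_O_alpha_mult is_O_alpha_no_pole) simp_all
  then show ?thesis by (simp add: eq)
qed

theorem theorem1p4:
  fixes r :: nat and lam :: "nat \<Rightarrow> (nat \<Rightarrow>\<^sub>0 nat)"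
  assumes "r \<ge> 1" and "\<And>i. i \<in> {1..r} \<Longrightarrow> is_partition (lam i)"
  shows "is_O_alpha (as_ratfun (jack_cumulant r lam)) (int r - 1)"
proof -
  \<comment> \<open>The lemmas ask for partitions at every index of the type; extending by 0 does
    not change the cumulant at {1..r}.\<close>
  define lam' where "lam' i = (if i \<in> {1..r} then lam i else 0)" for i
  have part: "is_partition (lam' i)" for i using assms(2) by (simp add: lam'_def is_partition_def)
  have "jack_cumulant r lam = cumulant (\<lambda>B. jack (sum lam B)) {1..r}"
    by (simp add: jack_cumulant_def cumulant_def)
  also have "\<dots> = cumulant (\<lambda>B. jack (sum lam' B)) {1..r}"
    by (intro cumulant_cong arg_cong[where f = jack] sum.cong) (auto simp: lam'_def)
  finally have cum: "jack_cumulant r lam = cumulant (\<lambda>B. jack (sum lam' B)) {1..r}" .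
  have coeff: "is_O_alpha (monomial_coeff (jack_cumulant r lam) p) (int (r - 1))" if p: "is_partition p" for p
  proof -
    \<comment> \<open>N depends on p: it must accommodate p and all parts of the given partitions,
      and the coefficient can be read off in any such number of variables.\<close>
    have "finite (keys p \<union> (\<Union>i\<in>{1..r}. keys (lam i)))" by simp
    then obtain N where "keys p \<union> (\<Union>i\<in>{1..r}. keys (lam i)) \<subseteq> {..<N}"
      by (meson finite_nat_iff_bounded)
    then have "keys p \<subseteq> {..<N}" and "\<And>i. i \<in> {1..r} \<Longrightarrow> keys (lam i) \<subseteq> {..<N}" by blast+
    then have N: "part_length p \<le> N" "\<And>i. keys (lam' i) \<subseteq> {..<N}"
      using p by (simp_all add: keys_partition lam'_def)
    have "monomial_coeff (jack_cumulant r lam) p = lookup (cumulant (\<lambda>B. jack_sum (sum lam' B) N) {1..r}) p"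
      unfolding monomial_coeff_eq[OF N(1) p] cum in_vars_cumulant in_vars_jack[OF is_partition_sum[OF part]] ..
    then show ?thesis
      using O_mpoly_jack_cumulant[OF part N(2), of "{1..r}"] assms(1) by (simp add: O_mpoly_def of_nat_diff)
  qed
  have "is_O_alpha (as_ratfun (jack_cumulant r lam)) (int (r - 1))"
    unfolding as_ratfun_def
  proof (rule is_O_alpha_sum)
    fix p assume "p \<in> {p. is_partition p \<and> monomial_coeff (jack_cumulant r lam) p \<noteq> 0}"
    then have "is_O_alpha (extend_scalars (monomial_coeff (jack_cumulant r lam) p) :: rat symfun fract ratfun) (int (r - 1))"
      by (intro is_O_alpha_extend_scalars coeff) simp
    then have "is_O_alpha (to_fract [:to_fract (monomial_symfun p):] *
        (extend_scalars (monomial_coeff (jack_cumulant r lam) p) :: rat symfun fract ratfun)) (int (r - 1))"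
      by (intro is_O_alpha_scale no_pole_at_0_to_fract)
    then show "is_O_alpha ((extend_scalars (monomial_coeff (jack_cumulant r lam) p) :: rat symfun fract ratfun) *
        to_fract [:to_fract (monomial_symfun p):]) (int (r - 1))"
      by (simp only: mult.commute)
  qed
  then show ?thesis using assms(1) by (simp add: of_nat_diff)
qed

end
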